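(* Let $X$ be a compact metric space, $T\colon X\to X$ a continuous map, and suppose $(X,T)$ is uniquely ergodic with unique $T$-invariant Borel probability measure $\mu$. Let $a\colon\mathbb{N}\to\mathbb{C}$ be a Besicovitch almost periodic function and denote by $M(a)=\lim_{N\to\infty}\frac1N\sum_{n=1}^N a(n)$ its mean value. Then $$\lim_{N\to\infty}\frac1N\sum_{n=1}^N a(n)\,f\big(T^{\Omega(n)}x\big)=M(a)\left(\int f\,d\mu\right)$$ for every $f\in C(X)$ and every $x\in X$.
   Context: $\mathbb{N}=\{1,2,3,\ldots\}$ and $e(x)=e^{2\pi ix}$. $\Omega(n)$ denotes the number of prime factors of $n$ counted with multiplicities. $C(X)$ is the space of continuous complex-valued functions on $X$. $(X,T)$ is uniquely ergodic if there is exactly one Borel probability measure $\mu$ on $X$ with $\mu(T^{-1}A)=\mu(A)$ for all Borel $A\subset X$. A bounded function $a\colon\mathbb{N}\to\mathbb{C}$ is Besicovitch almost periodic if for every $\varepsilon>0$ there is a trigonometric polynomial $P(n)=c_1e(n\alpha_1)+\ldots+c_Le(n\alpha_L)$, with $c_1,\ldots,c_L\in\mathbb{C}$ and $\alpha_1,\ldots,\alpha_L\in\mathbb{R}$, such that $\limsup_{N\to\infty}\frac1N\sum_{n=1}^N|a(n)-P(n)|\leq\varepsilon$. (The mean value of such a function exists.) *)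

theory Defs
  imports "HOL-Probability.Probability" "HOL-Computational_Algebra.Primes"
begin

definition num_prime_factors :: "nat \<Rightarrow> nat" where
  "num_prime_factors n = size (prime_factorization n)"

definition unit_exp :: "real \<Rightarrow> complex" where
  "unit_exp x = exp (2 * of_real pi * \<i> * of_real x)"

(* Arithmetic functions live on the positive integers. They are modelled as functions on nat
   whose value at 0 is never used: boundedness only concerns n \<ge> 1 and all sums start at 1. *)

definition trig_polynomial :: "(nat \<Rightarrow> complex) \<Rightarrow> bool" where
  "trig_polynomial P \<longleftrightarrow>
     (\<exists>(L::nat) (c::nat \<Rightarrow> complex) (\<alpha>::nat \<Rightarrow> real). 1 \<le> L \<and>
        (\<forall>n. P n = (\<Sum>j=1..L. c j * unit_exp (real n * \<alpha> j))))"

(* The limsup is taken in ereal, a complete lattice, so it is always meaningful. *)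
definition besicovitch_almost_periodic :: "(nat \<Rightarrow> complex) \<Rightarrow> bool" where
  "besicovitch_almost_periodic a \<longleftrightarrow>
     bounded (a ` {1..}) \<and>
     (\<forall>\<epsilon>>0. \<exists>P. trig_polynomial P \<and>
        limsup (\<lambda>N. ereal (1 / real N * (\<Sum>n=1..N. cmod (a n - P n)))) \<le> ereal \<epsilon>)"

definition mean_value :: "(nat \<Rightarrow> complex) \<Rightarrow> complex" where
  "mean_value a = lim (\<lambda>N. 1 / of_nat N * (\<Sum>n=1..N. a n))"

(* The space is a subset X of a metric space with the subspace topology; restrict_space borel X
   is its Borel sigma-algebra, and measures on X have exactly these measurable sets.
   Values of T outside X are irrelevant, hence preimages are taken within X. *)

definition invariant_prob_measure :: "'a::metric_space set \<Rightarrow> ('a \<Rightarrow> 'a) \<Rightarrow> 'a measure \<Rightarrow> bool" where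
  "invariant_prob_measure X T \<mu> \<longleftrightarrow>
     prob_space \<mu> \<and> sets \<mu> = sets (restrict_space borel X) \<and>
     (\<forall>A\<in>sets \<mu>. emeasure \<mu> (T -` A \<inter> X) = emeasure \<mu> A)"

definition uniquely_ergodic :: "'a::metric_space set \<Rightarrow> ('a \<Rightarrow> 'a) \<Rightarrow> bool" where
  "uniquely_ergodic X T \<longleftrightarrow> (\<exists>!\<mu>. invariant_prob_measure X T \<mu>)"

end

theory Submission
  imports Defs "HOL-Number_Theory.Number_Theory" "HOL-Computational_Algebra.Squarefree"
    "HOL-Real_Asymp.Real_Asymp"
begin

text \<open>
  By approximation it suffices to treat \<open>a n = e(n \<alpha>)\<close> and \<open>f\<close> of integral zero, whose Birkhoff averages
  tend to zero uniformly by unique ergodicity. Write \<open>F k = f (T\<^sup>k x)\<close>. The Turan-Kubilius inequality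
  replaces the mean of \<open>a n F(\<Omega> n)\<close> up to \<open>N\<close> by a weighted average over primes \<open>p\<close> of the means of
  \<open>a (p m) F(\<Omega> m + 1)\<close> up to \<open>N / p\<close>. For irrational \<open>\<alpha>\<close>, Cauchy-Schwarz finishes the proof (Katai).
  For rational \<open>\<alpha>\<close> with denominator \<open>s\<close>, use only primes \<open>p \<equiv> 1\<close> modulo \<open>s\<close>, so that \<open>a (p m) = a m\<close>, and
  show that the means of \<open>a n F(\<Omega> n)\<close> and of \<open>a n F(\<Omega> n + 1)\<close> have the same limit behaviour;
  then \<open>F\<close> may be replaced by its Birkhoff averages.

  As functions of \<open>u = ln N\<close> the means are slowly varying and nearly harmonic for the steps \<open>- ln p\<close>.
  A Choquet-Deny argument shows that they are almost invariant under a translation \<open>d\<close> whenever many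
  pairs of primes have \<open>ln q - ln p \<approx> d\<close>. Arbitrarily small such \<open>d\<close>, bounded away from zero, exist since
  the primes \<open>p \<equiv> 1\<close> have logarithmic weight at least \<open>1\<close> in windows of fixed length (Dirichlet's theorem
  in Mertens' form) while short windows have small weight (Selberg's formula). Almost translation
  invariant means \<open>\<Phi>\<close> then satisfy \<open>\<Phi> F u \<approx> \<Phi> (shift F) u\<close> by the harmonicity.
\<close>

section \<open>Divisor sums\<close>

text \<open>For rational \<open>\<alpha>\<close> Cauchy-Schwarz yields nothing, because
  \<open>z ^ (p - q) = 1\<close> for many pairs of primes. The Turan-Kubilius inequality still
  relates means of \<open>F\<close> up to \<open>N\<close> to means of its shift up to
  \<open>N / p\<close>, but it changes sequence and scale together, and slow variation does not
  separate the two: a factor like \<open>N ^ (i t)\<close> with small \<open>t\<close> varies slowly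
  and yet is not invariant under \<open>N -> N / p\<close>. Two primes shift \<open>F\<close>
  equally, once each, and move the scale by different amounts; comparing them isolates a pure
  translation by \<open>d\<close>. The prime number theorem would supply pairs for every
  \<open>d\<close>. Selberg's formula is enough if \<open>d\<close> is not prescribed but only
  confined between \<open>e\<close> and \<open>\<epsilon>\<close>. It is essential that
  \<open>e\<close> does not depend on the precision \<open>\<eta>\<close>: the number of steps of
  length \<open>d\<close> that cover all the \<open>ln p\<close> is then bounded before
  \<open>\<eta>\<close> is chosen. Since every step of the walk replaces \<open>F\<close> by its
  shift, all asymptotic statements are uniform over sequences bounded by 1.\<close>

definition moebius :: "nat \<Rightarrow> real" where
  "moebius n = (if squarefree n then (-1) ^ card (prime_factors n) else 0)"

lemma abs_moebius_le: "\<bar>moebius n\<bar> \<le> 1"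
  by (simp add: moebius_def power_abs)

lemma moebius_1 [simp]: "moebius (Suc 0) = 1"
  by (simp add: moebius_def)

lemma moebius_prime_mult:
  assumes "prime p" "\<not> p dvd d" "d > 0"
  shows "moebius (p * d) = - moebius d"
proof -
  have cop: "coprime p d" using assms by (simp add: prime_imp_coprime)
  have sf: "squarefree (p * d) \<longleftrightarrow> squarefree d"
    using cop assms by (metis squarefree_mult_coprime squarefree_multD(2) squarefree_prime)
  have "prime_factors (p * d) = insert p (prime_factors d)"
    using assms by (subst prime_factors_product) (auto simp: prime_prime_factors)
  moreover have "p \<notin> prime_factors d" using assms by auto
  ultimately have "card (prime_factors (p * d)) = Suc (card (prime_factors d))" by simp
  then show ?thesis using sf by (simp add: moebius_def)
qed

text \<open>For a prime factor \<open>p\<close> of \<open>n\<close>, the squarefree divisors pair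
  off as \<open>d\<close> and \<open>p * d\<close> with opposite signs.\<close>

lemma sum_moebius_divisors:
  assumes "n > 0"
  shows "(\<Sum>d | d dvd n. moebius d) = (if n = 1 then 1 else 0)"
proof (cases "n = 1")
  case True
  have "{d::nat. d dvd 1} = {1}" by auto
  then show ?thesis using True by simp
next
  case False
  obtain p where p: "prime p" "p dvd n" using False prime_factor_nat by blast
  define A where "A = {d. d dvd n \<and> squarefree d \<and> \<not> p dvd d}"
  define B where "B = {d. d dvd n \<and> squarefree d \<and> p dvd d}"
  have fin: "finite {d. d dvd n}" using assms by simp
  then have finAB: "finite A" "finite B"
    by (auto simp: A_def B_def)
  have "(\<Sum>d | d dvd n. moebius d) = (\<Sum>d\<in>A \<union> B. moebius d)"
    using fin by (intro sum.mono_neutral_right) (auto simp: A_def B_def moebius_def)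
  also have "\<dots> = (\<Sum>d\<in>A. moebius d) + (\<Sum>d\<in>B. moebius d)"
    using finAB by (intro sum.union_disjoint) (auto simp: A_def B_def)
  also have "(\<Sum>d\<in>B. moebius d) = (\<Sum>d\<in>A. moebius (p * d))"
  proof (rule sum.reindex_bij_witness[of _ "\<lambda>d. p * d" "\<lambda>d. d div p"])
    fix d assume d: "d \<in> B"
    then obtain e where e: "d = p * e" by (auto simp: B_def elim: dvdE)
    have p0: "p > 0" using p by (simp add: prime_gt_0_nat)
    show "p * (d div p) = d" using e by simp
    have "\<not> p dvd e"
    proof
      assume "p dvd e"
      then have "p ^ 2 dvd d" by (simp add: e power2_eq_square)
      then show False using d p by (auto simp: B_def squarefree_def)
    qed
    moreover have "squarefree e" using d e by (auto simp: B_def dest: squarefree_multD)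
    moreover have "e dvd n" using d e by (auto simp: B_def dest: dvd_mult_right)
    ultimately show "d div p \<in> A" using e p0 by (simp add: A_def)
    show "moebius (p * (d div p)) = moebius d" using e by simp
  next
    fix d assume d: "d \<in> A"
    then have cop: "coprime p d" using p by (simp add: A_def prime_imp_coprime)
    show "p * d div p = d" using p by (simp add: prime_gt_0_nat)
    have "squarefree (p * d)"
      using cop d p by (simp add: A_def squarefree_mult_coprime squarefree_prime)
    moreover have "p * d dvd n" using cop d p by (simp add: A_def divides_mult)
    ultimately show "p * d \<in> B" by (simp add: B_def)
  qed
  also have "\<dots> = (\<Sum>d\<in>A. - moebius d)"
    using p assms by (intro sum.cong refl moebius_prime_mult) (auto simp: A_def intro: dvd_pos_nat)
  finally show ?thesis using False by (simp add: sum_negf)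
qed

lemma sum_divisors_swap:
  fixes h :: "nat \<Rightarrow> nat \<Rightarrow> 'a::comm_monoid_add"
  shows "(\<Sum>k=1..N. \<Sum>d | d dvd k. h d k) = (\<Sum>d=1..N. \<Sum>m=1..N div d. h d (d * m))"
proof -
  have "(\<Sum>k=1..N. \<Sum>d | d dvd k. h d k) = (\<Sum>(k, d)\<in>(SIGMA k:{1..N}. {d. d dvd k}). h d k)"
    by (rule sum.Sigma) auto
  also have "\<dots> = (\<Sum>(d, m)\<in>(SIGMA d:{1..N}. {1..N div d}). h d (d * m))"
  proof (rule sum.reindex_bij_witness[of _ "\<lambda>(d, m). (d * m, d)" "\<lambda>(k, d). (d, k div d)"])
    fix a assume "a \<in> (SIGMA k:{1..N}. {d. d dvd k})"
    then obtain k d where a: "a = (k, d)" "1 \<le> k" "k \<le> N" "d dvd k" by auto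
    then have "d > 0" "d \<le> k" by (auto intro: dvd_pos_nat dvd_imp_le)
    then show "(case a of (k, d) \<Rightarrow> (d, k div d)) \<in> (SIGMA d:{1..N}. {1..N div d})"
      using a by (auto simp: div_le_mono Suc_le_eq div_greater_zero_iff)
  next
    fix b assume "b \<in> (SIGMA d:{1..N}. {1..N div d})"
    then obtain d m where b: "b = (d, m)" "1 \<le> d" "d \<le> N" "1 \<le> m" "m \<le> N div d" by auto
    then have "d * m \<le> N" by (simp add: less_eq_div_iff_mult_less_eq mult.commute)
    then show "(case b of (d, m) \<Rightarrow> (d * m, d)) \<in> (SIGMA k:{1..N}. {d. d dvd k})"
      using b by auto
  qed auto
  also have "\<dots> = (\<Sum>d=1..N. \<Sum>m=1..N div d. h d (d * m))"
    by (rule sum.Sigma[symmetric]) auto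
  finally show ?thesis .
qed

lemma sum_divisors_flip:
  assumes "n > 0"
  shows "(\<Sum>d | d dvd n. h d (n div d)) = (\<Sum>d | d dvd n. h (n div d) (d::nat))"
  using assms
  by (intro sum.reindex_bij_witness[of _ "\<lambda>d. n div d" "\<lambda>d. n div d"])
     (auto elim!: dvdE)

text \<open>Moebius inversion of \<open>ln = 1 * mangoldt\<close> gives the sum with
  \<open>ln (k / d)\<close>. The difference \<open>ln (N / k)\<close> does not depend on
  \<open>d\<close>, so it is multiplied by the full Moebius sum and survives only for
  \<open>k = 1\<close>.\<close>

lemma sum_moebius_ln:
  assumes "k > 0" "N > 0"
  shows "(\<Sum>d | d dvd k. moebius d * ln (real N / real d)) =
           (if k = 1 then ln (real N) else 0) + mangoldt k"
proof -
  have fin: "finite {d. d dvd m}" if "m > 0" for m :: nat using that by simp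
  have "(\<Sum>d | d dvd k. moebius d * ln (real k / real d)) =
          (\<Sum>d | d dvd k. moebius d * (\<Sum>e | e dvd k div d. mangoldt e))"
  proof (rule sum.cong[OF refl])
    fix d assume "d \<in> {d. d dvd k}"
    then have d: "d dvd k" "d > 0" "k div d > 0" "real (k div d) = real k / real d"
      using assms by (auto intro: dvd_pos_nat simp: real_of_nat_div dvd_imp_le div_greater_zero_iff)
    then show "moebius d * ln (real k / real d) = moebius d * (\<Sum>e | e dvd k div d. mangoldt e)"
      using mangoldt_sum[of "k div d", where 'a = real] by simp
  qed
  also have "\<dots> = (\<Sum>d | d dvd k. \<Sum>e | e dvd k div d. moebius d * mangoldt e)"
    by (simp add: sum_distrib_left)
  also have "\<dots> = (\<Sum>(d, e)\<in>(SIGMA d:{d. d dvd k}. {e. e dvd k div d}). moebius d * mangoldt e)"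
    using assms by (intro sum.Sigma)
        (auto simp: div_greater_zero_iff dvd_imp_le intro!: fin dvd_pos_nat[of k])
  also have "\<dots> = (\<Sum>(e, d)\<in>(SIGMA e:{e. e dvd k}. {d. d dvd k div e}). moebius d * mangoldt e)"
    using assms
    by (intro sum.reindex_bij_witness[of _ "\<lambda>(e, d). (d, e)" "\<lambda>(d, e). (e, d)"])
       (auto elim!: dvdE simp: mult.commute mult.left_commute)
  also have "\<dots> = (\<Sum>e | e dvd k. \<Sum>d | d dvd k div e. moebius d * mangoldt e)"
    using assms by (intro sum.Sigma[symmetric])
        (auto simp: div_greater_zero_iff dvd_imp_le intro!: fin dvd_pos_nat[of k])
  also have "\<dots> = (\<Sum>e | e dvd k. if e = k then mangoldt e else 0)"
  proof (rule sum.cong[OF refl])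
    fix e assume "e \<in> {e. e dvd k}"
    then have e: "e dvd k" "k div e > 0" "k div e = 1 \<longleftrightarrow> e = k"
      using assms by (auto elim!: dvdE simp: dvd_imp_le div_greater_zero_iff)
    show "(\<Sum>d | d dvd k div e. moebius d * mangoldt e) = (if e = k then mangoldt e else 0)"
      using sum_moebius_divisors[OF e(2)] e(3) by (simp flip: sum_distrib_right)
  qed
  also have "\<dots> = mangoldt k"
    using assms by (subst sum.delta) auto
  finally have 1: "(\<Sum>d | d dvd k. moebius d * ln (real k / real d)) = mangoldt k" .
  have "(\<Sum>d | d dvd k. moebius d * ln (real N / real d)) =
        (\<Sum>d | d dvd k. moebius d * ln (real k / real d) + moebius d * ln (real N / real k))"
  proof (rule sum.cong[OF refl])
    fix d assume "d \<in> {d. d dvd k}"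
    then have d: "d > 0" using assms by (auto intro: dvd_pos_nat)
    have "ln (real N / real d) = ln (real k / real d) + ln (real N / real k)"
      using d assms by (simp add: ln_div)
    then show "moebius d * ln (real N / real d) =
       moebius d * ln (real k / real d) + moebius d * ln (real N / real k)"
      by (simp add: algebra_simps)
  qed
  also have "\<dots> = mangoldt k + (\<Sum>d | d dvd k. moebius d) * ln (real N / real k)"
    by (simp add: sum.distrib 1 sum_distrib_right)
  finally show ?thesis using sum_moebius_divisors[of k] assms by auto
qed

text \<open>An inversion formula with a logarithmic weight: if all inner sums over multiples of
  \<open>d\<close> are small, the right side is small. It serves twice, for the error term of
  \<open>psi\<close> in Selberg's formula and for \<open>c k / k\<close> with a character whose
  L-value vanishes.\<close>

lemma tatuzawa_iseki:
  fixes f :: "nat \<Rightarrow> 'a::real_vector"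
  assumes "N > 0"
  shows "(\<Sum>d=1..N. (moebius d * ln (real N / real d)) *\<^sub>R (\<Sum>m=1..N div d. f (d * m)))
           = ln (real N) *\<^sub>R f 1 + (\<Sum>k=1..N. mangoldt k *\<^sub>R f k)"
proof -
  have "(\<Sum>d=1..N. (moebius d * ln (real N / real d)) *\<^sub>R (\<Sum>m=1..N div d. f (d * m)))
        = (\<Sum>d=1..N. \<Sum>m=1..N div d. (moebius d * ln (real N / real d)) *\<^sub>R f (d * m))"
    by (simp only: scaleR_sum_right)
  also have "\<dots> = (\<Sum>k=1..N. \<Sum>d | d dvd k. (moebius d * ln (real N / real d)) *\<^sub>R f k)"
    by (rule sum_divisors_swap[symmetric])
  also have "\<dots> = (\<Sum>k=1..N. (if k = 1 then ln (real N) *\<^sub>R f k else 0) + mangoldt k *\<^sub>R f k)"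
  proof (rule sum.cong[OF refl])
    fix k assume "k \<in> {1..N}"
    then have "(\<Sum>d | d dvd k. moebius d * ln (real N / real d))
        = (if k = 1 then ln (real N) else 0) + mangoldt k"
      using assms by (intro sum_moebius_ln) auto
    then show "(\<Sum>d | d dvd k. (moebius d * ln (real N / real d)) *\<^sub>R f k) =
       (if k = 1 then ln (real N) *\<^sub>R f k else 0) + mangoldt k *\<^sub>R f k"
      by (simp add: scaleR_sum_left[symmetric] scaleR_add_left)
  qed
  also have "\<dots> = ln (real N) *\<^sub>R f 1 + (\<Sum>k=1..N. mangoldt k *\<^sub>R f k)"
    using assms by (simp add: sum.distrib sum.delta)
  finally show ?thesis .
qed

section \<open>Chebyshev's function and the factorial\<close>

definition psi :: "nat \<Rightarrow> real" where
  "psi N = (\<Sum>n=1..N. mangoldt n)"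

lemma psi_nonneg: "psi N \<ge> 0"
  by (simp add: psi_def sum_nonneg mangoldt_nonneg)

lemma sum_split_at:
  fixes f :: "nat \<Rightarrow> 'a::comm_monoid_add"
  assumes "M \<le> N"
  shows "(\<Sum>n=1..N. f n) = (\<Sum>n=1..M. f n) + (\<Sum>n\<in>{M<..N}. f n)"
proof -
  have "{1..N} = {1..M} \<union> {M<..N}" using assms by auto
  then have "(\<Sum>n=1..N. f n) = (\<Sum>n\<in>{1..M} \<union> {M<..N}. f n)" by simp
  also have "\<dots> = (\<Sum>n=1..M. f n) + (\<Sum>n\<in>{M<..N}. f n)"
    by (intro sum.union_disjoint) auto
  finally show ?thesis .
qed

lemma psi_diff: "M \<le> N \<Longrightarrow> psi N - psi M = (\<Sum>n\<in>{M<..N}. mangoldt n)"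
  using sum_split_at[of M N "mangoldt :: nat \<Rightarrow> real"] by (simp add: psi_def)

lemma psi_mono: "M \<le> N \<Longrightarrow> psi M \<le> psi N"
  unfolding psi_def by (intro sum_mono2) (auto simp: mangoldt_nonneg)

lemma ln_fact_eq_sum_ln: "ln (fact N :: real) = (\<Sum>k=1..N. ln (real k))"
  by (induction N) (auto simp: ln_mult)

lemma ln_fact_divisors: "ln (fact N :: real) = (\<Sum>k=1..N. \<Sum>d | d dvd k. mangoldt d)"
  unfolding ln_fact_eq_sum_ln
  by (intro sum.cong refl) (use mangoldt_sum[where 'a = real] in auto)

lemma ln_fact_mangoldt: "ln (fact N :: real) = (\<Sum>d=1..N. mangoldt d * real (N div d))"
  unfolding ln_fact_divisors sum_divisors_swap by (simp add: mult.commute)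

lemma ln_fact_psi: "ln (fact N :: real) = (\<Sum>m=1..N. psi (N div m))"
proof -
  have "ln (fact N :: real) = (\<Sum>k=1..N. \<Sum>d | d dvd k. mangoldt (k div d))"
    unfolding ln_fact_divisors by (intro sum.cong refl sum_divisors_flip[where h = "\<lambda>a b. mangoldt a"]) auto
  also have "\<dots> = (\<Sum>d=1..N. \<Sum>m=1..N div d. mangoldt (d * m div d))"
    by (rule sum_divisors_swap)
  also have "\<dots> = (\<Sum>d=1..N. psi (N div d))"
    unfolding psi_def by (intro sum.cong refl) auto
  finally show ?thesis .
qed

section \<open>Estimates of Chebyshev, Mertens and Selberg\<close>

lemma ln_fact_lower:
  assumes "N > 0"
  shows "real N * ln (real N) - real N \<le> ln (fact N :: real)"
  using assms
proof (induction N rule: nat_induct_non_zero)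
  case 1 then show ?case by simp
next
  case (Suc N)
  have "1 + 1 / real N = real (Suc N) / real N" using Suc.hyps by (simp add: field_simps)
  then have "ln (real (Suc N)) - ln (real N) = ln (1 + 1 / real N)"
    using Suc.hyps by (simp add: ln_div)
  also have "\<dots> \<le> 1 / real N" using Suc.hyps by (intro ln_add_one_self_le_self) auto
  finally have "real N * (ln (real (Suc N)) - ln (real N)) \<le> 1"
    using Suc.hyps by (simp add: field_simps)
  moreover have "ln (fact (Suc N) :: real) = ln (real (Suc N)) + ln (fact N)"
    by (simp add: ln_mult)
  ultimately show ?case using Suc.IH by (simp add: algebra_simps)
qed

lemma ln_fact_upper:
  assumes "N > 0"
  shows "ln (fact N :: real) \<le> real N * ln (real N) - real N + ln (real N) + 1"
  using assms
proof (induction N rule: nat_induct_non_zero)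
  case 1 then show ?case by simp
next
  case (Suc N)
  have "1 - 1 / real (Suc N) = real N / real (Suc N)" using Suc.hyps by (simp add: field_simps)
  then have "ln (real N) - ln (real (Suc N)) = ln (1 - 1 / real (Suc N))"
    using Suc.hyps by (simp add: ln_div)
  also have "\<dots> \<le> - (1 / real (Suc N))"
    using Suc.hyps ln_add_one_self_le_self2[of "- (1 / real (Suc N))"] by simp
  finally have "(real N + 1) * (ln (real (Suc N)) - ln (real N)) \<ge> 1"
    using Suc.hyps by (simp add: field_simps)
  moreover have "ln (fact (Suc N) :: real) = ln (real (Suc N)) + ln (fact N)"
    by (simp add: ln_mult)
  ultimately show ?case using Suc.IH by (simp add: algebra_simps)
qed

lemma nat_div_le_real: "real (N div d) \<le> real N / real d"
  by (metis floor_divide_of_nat_eq of_int_floor_le of_int_of_nat_eq)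

lemma real_minus_1_le_nat_div: "real N / real d - 1 \<le> real (N div d)"
  by (metis floor_divide_of_nat_eq of_int_of_nat_eq real_of_int_floor_ge_diff_one)

text \<open>The weight \<open>N div d - 2 * (h div d)\<close> equals 1 for
  \<open>h < d \<le> N\<close> and is never negative. Summed against \<open>mangoldt\<close> it
  gives the logarithm of \<open>N! / (h!)^2\<close>, which for even \<open>N\<close> is a central
  binomial coefficient.\<close>

lemma psi_half:
  assumes "N > 0"
  shows "psi N - psi (N div 2) \<le> 2 * real N"
proof -
  define h where "h = N div 2"
  have ext: "ln (fact h :: real) = (\<Sum>d=1..N. mangoldt d * real (h div d))"
    unfolding ln_fact_mangoldt by (intro sum.mono_neutral_left) (auto simp: h_def)
  have "psi N - psi h = (\<Sum>d\<in>{h<..N}. mangoldt d)" by (intro psi_diff) (simp add: h_def)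
  also have "\<dots> = (\<Sum>d\<in>{h<..N}. mangoldt d * (real (N div d) - 2 * real (h div d)))"
  proof (rule sum.cong[OF refl])
    fix d assume "d \<in> {h<..N}"
    then have "N div d = 1" "h div d = 0"
      by (auto simp: h_def intro!: div_nat_eqI)
    then show "mangoldt d = mangoldt d * (real (N div d) - 2 * real (h div d))" by simp
  qed
  also have "\<dots> \<le> (\<Sum>d=1..N. mangoldt d * (real (N div d) - 2 * real (h div d)))"
  proof (intro sum_mono2)
    fix d assume "d \<in> {1..N} - {h<..N}"
    then have d: "d > 0" by auto
    have "2 * (h div d) * d \<le> 2 * h" by (simp add: div_times_less_eq_dividend)
    also have "\<dots> \<le> N" by (simp add: h_def)
    finally have "2 * (h div d) \<le> N div d" using d by (simp add: less_eq_div_iff_mult_less_eq)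
    then have "2 * real (h div d) \<le> real (N div d)" by linarith
    then show "mangoldt d * (real (N div d) - 2 * real (h div d)) \<ge> 0"
      by (intro mult_nonneg_nonneg mangoldt_nonneg) auto
  qed auto
  also have "\<dots> = ln (fact N) - 2 * ln (fact h)"
    unfolding ln_fact_mangoldt[of N] ext
    by (simp add: right_diff_distrib sum_subtractf sum_distrib_left mult.left_commute)
  also have "\<dots> \<le> 2 * real N"
  proof -
    have "(2 * h) choose h \<le> 2 ^ (2 * h)"
      by (metis binomial_le_pow2)
    then have "real ((2 * h) choose h) \<le> 2 ^ (2 * h)"
      by (metis of_nat_le_iff of_nat_numeral of_nat_power)
    then have "fact (2 * h) / (fact h * fact h) \<le> (2::real) ^ (2 * h)"
      by (simp add: binomial_fact mult_2)
    then have "ln (fact (2 * h) / (fact h * fact h) :: real) \<le> ln (2 ^ (2 * h))"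
      by (subst ln_le_cancel_iff) (auto intro: divide_pos_pos mult_pos_pos)
    then have "ln (fact (2 * h) :: real) - 2 * ln (fact h) \<le> real (2 * h) * ln 2"
      by (simp add: ln_div ln_mult ln_realpow)
    also have "\<dots> \<le> real (2 * h)"
      using ln_2_less_1 by (intro mult_left_le) auto
    finally have b: "ln (fact (2 * h) :: real) - 2 * ln (fact h) \<le> real (2 * h)" .
    show ?thesis
    proof (cases "even N")
      case True
      then have "2 * h = N" by (simp add: h_def)
      then show ?thesis using b by simp
    next
      case False
      \<comment> \<open>For odd \<open>N\<close> the additional factor \<open>N\<close> of the
        factorial costs \<open>ln N \<le> 2 * h\<close>, which the constant 2 of the claim
        absorbs.\<close>
      then have N: "N = Suc (2 * h)" by (simp add: h_def)
      have "ln (fact N :: real) = ln (real N) + ln (fact (2 * h))"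
        unfolding N by (simp add: ln_mult)
      moreover have "ln (real N) \<le> real N - 1" using N by (intro ln_le_minus_one) auto
      ultimately show ?thesis using b N by simp
    qed
  qed
  finally show ?thesis by (simp add: h_def)
qed

lemma psi_le: "psi N \<le> 4 * real N"
proof (induction N rule: less_induct)
  case (less N)
  show ?case
  proof (cases "N = 0")
    case True then show ?thesis by (simp add: psi_def)
  next
    case False
    then have "psi (N div 2) \<le> 4 * real (N div 2)" by (intro less) auto
    moreover have "2 * real (N div 2) \<le> real N" by linarith
    ultimately show ?thesis using psi_half[of N] False by auto
  qed
qed

text \<open>Both bounds compare \<open>N * M\<close> with \<open>ln (fact N)\<close>. Removing the
  integer parts in \<open>ln_fact_mangoldt\<close> changes the sum by at most \<open>psi N\<close>,
  which is linear in \<open>N\<close>.\<close>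

lemma mertens_mangoldt:
  assumes "N > 0"
  shows "\<bar>(\<Sum>d=1..N. mangoldt d / real d) - ln (real N)\<bar> \<le> 4"
proof -
  define M where "M = (\<Sum>d=1..N. mangoldt d / real d :: real)"
  have "ln (fact N) \<le> (\<Sum>d=1..N. mangoldt d * (real N / real d))"
    unfolding ln_fact_mangoldt
    by (intro sum_mono mult_left_mono mangoldt_nonneg nat_div_le_real)
  also have "\<dots> = real N * M" by (simp add: M_def sum_distrib_left mult_ac)
  finally have 1: "ln (fact N) \<le> real N * M" .
  have "real N * M - psi N = (\<Sum>d=1..N. mangoldt d * (real N / real d - 1))"
    by (simp add: M_def psi_def sum_distrib_left right_diff_distrib sum_subtractf mult_ac)
  also have "\<dots> \<le> ln (fact N)"
    unfolding ln_fact_mangoldt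
  proof (intro sum_mono mult_left_mono mangoldt_nonneg)
    fix d show "real N / real d - 1 \<le> real (N div d)"
      using real_minus_1_le_nat_div[of N d] by simp
  qed
  also have "ln (fact N :: real) \<le> real N * ln (real N)"
    unfolding ln_fact_eq_sum_ln using sum_bounded_above[of "{1..N}" "\<lambda>k. ln (real k)" "ln (real N)"] by simp
  finally have "real N * M \<le> real N * (ln (real N) + 4)"
    using psi_le[of N] by (simp add: algebra_simps)
  then have "M \<le> ln (real N) + 4" using assms by simp
  moreover have "real N * (ln (real N) - 1) \<le> real N * M"
    using 1 ln_fact_lower[OF assms] by (simp add: algebra_simps)
  then have "ln (real N) - 1 \<le> M" using assms by simp
  ultimately show ?thesis unfolding M_def by linarith
qed

lemma harm_bounds:
  assumes "n > 0"
  shows "ln (real n) + euler_mascheroni \<le> harm n"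
    and "harm n \<le> ln (real n) + euler_mascheroni + 1 / real n"
proof -
  show "ln (real n) + euler_mascheroni \<le> harm n"
  proof -
    have "euler_mascheroni \<le> harm n - ln (real n)"
      by (rule LIMSEQ_le_const2[OF euler_mascheroni_LIMSEQ])
         (use assms euler_mascheroni_sequence_decreasing in auto)
    then show ?thesis by simp
  qed
  show "harm n \<le> ln (real n) + euler_mascheroni + 1 / real n"
  proof -
    have "harm n - ln (real (n + 1)) \<le> euler_mascheroni - 1 / real (2 * (n + 1))"
      using euler_mascheroni_lower[of "n - 1"] assms by simp
    moreover have "1 / real (2 * (n + 1)) \<ge> 0" by simp
    ultimately have "harm n - ln (real (n + 1)) \<le> euler_mascheroni" by linarith
    moreover have "1 + 1 / real n = real (n + 1) / real n" using assms by (simp add: field_simps)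
    then have "ln (real (n + 1)) - ln (real n) \<le> 1 / real n"
      using assms ln_add_one_self_le_self[of "1 / real n"] by (simp add: ln_div)
    ultimately show ?thesis by simp
  qed
qed

lemma sum_inverse_sqrt_le: "(\<Sum>d=1..N. 1 / sqrt (real d)) \<le> 2 * sqrt (real N)"
proof (induction N)
  case (Suc N)
  have "1 / sqrt (real (Suc N)) \<le> 2 * sqrt (real (Suc N)) - 2 * sqrt (real N)"
  proof -
    have "2 * sqrt (real N) * sqrt (real (Suc N)) \<le> real N + real (Suc N)"
      using sum_squares_bound[of "sqrt (real N)" "sqrt (real (Suc N))"] by simp
    then have "(1 :: real) \<le> (2 * sqrt (real (Suc N)) - 2 * sqrt (real N)) * sqrt (real (Suc N))"
      by (simp add: algebra_simps flip: power2_eq_square)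
    then show ?thesis by (simp add: pos_divide_le_eq)
  qed
  then show ?case using Suc by simp
qed simp

text \<open>In Selberg's formula the error for each \<open>d\<close> is a product of two logarithms
  of \<open>N / d\<close>. Bounding it by a square root keeps the sum over all
  \<open>d \<le> N\<close> linear in \<open>N\<close>, with no logarithm lost.\<close>

lemma ln_mult_ln_le_sqrt:
  assumes "x \<ge> (1::real)"
  shows "ln x * (4 + 2 * ln x) \<le> 32 * sqrt x"
proof -
  define y where "y = sqrt (sqrt x)"
  have y: "y \<ge> 1" "y ^ 2 = sqrt x" "y ^ 4 = x"
    using assms by (auto simp: y_def)
        (metis assms numeral_Bit0 order_trans power2_eq_square power_add real_sqrt_ge_0_iff real_sqrt_pow2 zero_le_one)
  have "ln x = 4 * ln y" using y by (metis ln_realpow of_nat_numeral less_le_trans zero_less_one)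
  moreover have "ln y \<le> y - 1" using y by (intro ln_le_minus_one) auto
  moreover have "ln x \<ge> 0" using assms by simp
  ultimately have "ln x \<le> 4 * y" "4 + 2 * ln x \<le> 8 * y" using y by auto
  then have "ln x * (4 + 2 * ln x) \<le> (4 * y) * (8 * y)"
    using \<open>ln x \<ge> 0\<close> y by (intro mult_mono) auto
  also have "\<dots> = 32 * y ^ 2" by (simp add: power2_eq_square)
  finally show ?thesis using y by simp
qed
text \<open>\<open>1 + euler_mascheroni\<close> is the constant for which the terms linear in \<open>N / d\<close> cancel.\<close>

lemma selberg_inner_bound:
  assumes "1 \<le> d" "d \<le> N"
  shows "\<bar>\<Sum>m=1..N div d. psi (N div (d * m)) - real N / real (d * m) + (1 + euler_mascheroni)\<bar>
           \<le> 4 + 2 * ln (real N / real d)"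
proof -
  define x K where "x = real N / real d" and "K = N div d"
  have K: "K > 0" using assms by (simp add: K_def div_greater_zero_iff)
  have Kx: "real K \<le> x" "x \<le> real K + 1"
    using nat_div_le_real[of N d] real_minus_1_le_nat_div[of N d] by (auto simp: K_def x_def)
  \<comment> \<open>\<open>e1\<close> and \<open>e2\<close> are the errors in Stirling's formula and
    in the asymptotics of the harmonic sum; everything else cancels up to the rounding
    \<open>real K - x\<close>.\<close>
  define e1 where "e1 = ln (fact K) - (real K * ln (real K) - real K)"
  define e2 where "e2 = harm K - (ln (real K) + euler_mascheroni :: real)"
  have e1: "0 \<le> e1" "e1 \<le> ln (real K) + 1"
    using ln_fact_lower[OF K] ln_fact_upper[OF K] by (auto simp: e1_def)
  have e2: "0 \<le> e2" "e2 \<le> 1 / real K"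
    using harm_bounds[OF K] by (auto simp: e2_def)
  have "(\<Sum>m=1..K. psi (N div (d * m)) - real N / real (d * m) + (1 + euler_mascheroni))
      = (\<Sum>m=1..K. psi (K div m) - x * inverse (real m) + (1 + euler_mascheroni))"
    by (intro sum.cong refl) (simp add: div_mult2_eq K_def x_def divide_inverse)
  also have "\<dots> = (\<Sum>m=1..K. psi (K div m)) - x * harm K + real K * (1 + euler_mascheroni)"
    by (simp add: sum.distrib sum_subtractf harm_def sum_distrib_left)
  also have "\<dots> = (real K - x) * ln (real K) + euler_mascheroni * (real K - x) + e1 - x * e2"
    by (simp add: e1_def e2_def ln_fact_psi algebra_simps)
  finally have eq: "(\<Sum>m=1..K. psi (N div (d * m)) - real N / real (d * m) + (1 + euler_mascheroni))
      = (real K - x) * ln (real K) + euler_mascheroni * (real K - x) + e1 - x * e2" .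
  have lnK: "0 \<le> ln (real K)" "ln (real K) \<le> ln x" using K Kx by auto
  have g: "0 < (euler_mascheroni :: real)" "euler_mascheroni < (1::real)"
    using euler_mascheroni_pos euler_mascheroni_less_13_over_22 by auto
  have "\<bar>(real K - x) * ln (real K)\<bar> \<le> 1 * ln (real K)"
    unfolding abs_mult using Kx lnK by (intro mult_mono) auto
  moreover have "\<bar>euler_mascheroni * (real K - x)\<bar> \<le> 1 * 1"
    unfolding abs_mult using Kx g by (intro mult_mono) auto
  moreover have "0 \<le> x * e2" using Kx e2 by simp
  moreover have "x * e2 \<le> (real K + 1) * (1 / real K)"
    using Kx e2 by (intro mult_mono) auto
  moreover have "(real K + 1) * (1 / real K) \<le> 2" using K by (simp add: field_simps)
  ultimately show ?thesis
    unfolding K_def[symmetric] x_def[symmetric] eq using e1 lnK by linarith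
qed

text \<open>The inversion formula is applied to the expected error \<open>f\<close> of
  \<open>psi (N div k)\<close>, whose inner sums are small. On the other side the term
  \<open>N / k\<close> of \<open>f\<close> yields \<open>N * ln N\<close> twice, once through
  \<open>f 1\<close> and once through Mertens' estimate.\<close>

theorem selberg_formula:
  assumes "N > 0"
  shows "\<bar>psi N * ln (real N) + (\<Sum>k=1..N. mangoldt k * psi (N div k)) - 2 * real N * ln (real N)\<bar>
           \<le> 80 * real N"
proof -
  define f where "f k = psi (N div k) - real N / real k + (1 + euler_mascheroni)" for k
  define S where "S = (\<Sum>k=1..N. mangoldt k * psi (N div k))"
  define M where "M = (\<Sum>k=1..N. mangoldt k / real k :: real)"
  have "\<bar>\<Sum>d=1..N. (moebius d * ln (real N / real d)) *\<^sub>R (\<Sum>m=1..N div d. f (d * m))\<bar>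
      \<le> (\<Sum>d=1..N. \<bar>(moebius d * ln (real N / real d)) *\<^sub>R (\<Sum>m=1..N div d. f (d * m))\<bar>)"
    by (rule sum_abs)
  also have "\<dots> \<le> (\<Sum>d=1..N. 32 * sqrt (real N) * (1 / sqrt (real d)))"
  proof (rule sum_mono)
    fix d assume d: "d \<in> {1..N}"
    then have x: "real N / real d \<ge> 1" by simp
    have "\<bar>(moebius d * ln (real N / real d)) *\<^sub>R (\<Sum>m=1..N div d. f (d * m))\<bar>
        = \<bar>moebius d\<bar> * (ln (real N / real d) * \<bar>\<Sum>m=1..N div d. f (d * m)\<bar>)"
      using x by (simp add: abs_mult)
    also have "\<dots> \<le> 1 * (ln (real N / real d) * (4 + 2 * ln (real N / real d)))"
      using selberg_inner_bound[of d N] d x abs_moebius_le unfolding f_def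
      by (intro mult_mono mult_left_mono) auto
    also have "\<dots> \<le> 32 * sqrt (real N / real d)"
      using ln_mult_ln_le_sqrt[OF x] by simp
    finally show "\<bar>(moebius d * ln (real N / real d)) *\<^sub>R (\<Sum>m=1..N div d. f (d * m))\<bar>
        \<le> 32 * sqrt (real N) * (1 / sqrt (real d))" by (simp add: real_sqrt_divide)
  qed
  also have "\<dots> = 32 * sqrt (real N) * (\<Sum>d=1..N. 1 / sqrt (real d))"
    by (simp add: sum_distrib_left)
  also have "\<dots> \<le> 32 * sqrt (real N) * (2 * sqrt (real N))"
    by (intro mult_left_mono sum_inverse_sqrt_le) auto
  also have "\<dots> = 64 * real N" by simp
  finally have 1: "\<bar>ln (real N) * f 1 + (\<Sum>k=1..N. mangoldt k * f k)\<bar> \<le> 64 * real N"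
    unfolding tatuzawa_iseki[OF assms] by simp
  have 2: "(\<Sum>k=1..N. mangoldt k * f k) = S - real N * M + (1 + euler_mascheroni) * psi N"
    unfolding f_def S_def M_def psi_def[of N]
    by (simp add: algebra_simps sum.distrib sum_subtractf sum_distrib_left)
  have M: "\<bar>real N * M - real N * ln (real N)\<bar> \<le> 4 * real N"
  proof -
    have "\<bar>real N * M - real N * ln (real N)\<bar> = real N * \<bar>M - ln (real N)\<bar>"
      by (simp add: abs_mult flip: right_diff_distrib)
    also have "\<dots> \<le> real N * 4"
      using mertens_mangoldt[OF assms] by (intro mult_left_mono) (auto simp: M_def)
    finally show ?thesis by simp
  qed
  have g: "0 < (euler_mascheroni :: real)" "euler_mascheroni < (1::real)"
    using euler_mascheroni_pos euler_mascheroni_less_13_over_22 by auto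
  have "ln (real N) \<le> real N - 1" "ln (real N) \<ge> 0" using assms by (auto intro: ln_le_minus_one)
  then have r: "0 \<le> (1 + euler_mascheroni) * (ln (real N) + psi N)"
    using g psi_nonneg[of N] by simp
  have r': "(1 + euler_mascheroni) * (ln (real N) + psi N) \<le> 2 * (real N + 4 * real N)"
    using g psi_nonneg[of N] psi_le[of N] \<open>ln (real N) \<le> real N - 1\<close> \<open>ln (real N) \<ge> 0\<close>
    by (intro mult_mono) linarith+
  have "ln (real N) * f 1 + (\<Sum>k=1..N. mangoldt k * f k)
      = psi N * ln (real N) + S - real N * ln (real N) - real N * M + (1 + euler_mascheroni)
          * (ln (real N) + psi N)"
    unfolding 2 by (simp add: f_def algebra_simps)
  \<comment> \<open>The contributions are 64 from the inner sums, 4 from Mertens' estimate and 10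
    from the terms with \<open>1 + euler_mascheroni\<close>.\<close>
  moreover have "\<bar>p + S - 2 * real N * ln (real N)\<bar> \<le> 80 * real N"
    if "A = p + S - L - m + r" "\<bar>A\<bar> \<le> 64 * real N" "\<bar>m - L\<bar> \<le> 4 * real N"
      "0 \<le> r" "r \<le> 2 * (real N + 4 * real N)" "L = real N * ln (real N)" for A p L m r :: real
    using that by (simp add: mult.assoc)
  ultimately show ?thesis using 1 M r r' unfolding S_def[symmetric] by blast
qed

lemma psi_short_interval:
  assumes "0 < M" "M \<le> N"
  shows "(psi N - psi M) * ln (real M) \<le> 2 * (real N - real M) * ln (real M)
           + 2 * real N * ln (real N / real M) + 160 * real N"
proof -
  define S where "S N = (\<Sum>k=1..N. mangoldt k * psi (N div k))" for N
  have N: "N > 0" using assms by simp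
  have "S M \<le> S N"
  proof -
    have "S M \<le> (\<Sum>k=1..M. mangoldt k * psi (N div k))"
      unfolding S_def using assms by (intro sum_mono mult_left_mono psi_mono div_le_mono mangoldt_nonneg)
    also have "\<dots> \<le> S N"
      unfolding S_def using assms
      by (intro sum_mono2) (auto simp: mangoldt_nonneg psi_nonneg)
    finally show ?thesis .
  qed
  moreover have "psi N * ln (real M) \<le> psi N * ln (real N)"
    using assms psi_nonneg by (intro mult_left_mono) auto
  moreover have "real N * ln (real N / real M) = real N * ln (real N) - real N * ln (real M)"
    using assms by (simp add: ln_div algebra_simps)
  moreover have "real M \<le> real N" using assms by simp
  ultimately show ?thesis
    using selberg_formula[OF N] selberg_formula[OF assms(1)] unfolding S_def[symmetric]
    by (simp add: algebra_simps abs_le_iff)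
qed

section \<open>Primes in short logarithmic windows\<close>

definition log_window :: "(nat \<Rightarrow> bool) \<Rightarrow> real \<Rightarrow> real \<Rightarrow> nat set" where
  "log_window R u v = {p. prime p \<and> R p \<and> u < ln (real p) \<and> ln (real p) \<le> v}"

lemma finite_log_window [simp]: "finite (log_window R u v)"
proof (rule finite_subset)
  show "log_window R u v \<subseteq> {..nat \<lfloor>exp v\<rfloor>}"
  proof
    fix p assume "p \<in> log_window R u v"
    then have "p > 0" "ln (real p) \<le> v" by (auto simp: log_window_def prime_gt_0_nat)
    then have "exp (ln (real p)) \<le> exp v" by (simp only: exp_le_cancel_iff)
    then have "real p \<le> exp v" using \<open>p > 0\<close> by simp
    then show "p \<in> {..nat \<lfloor>exp v\<rfloor>}" by (simp add: le_nat_floor)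
  qed
qed simp

lemma nat_floor_exp: "real (nat \<lfloor>exp u\<rfloor>) \<le> exp u" "exp u \<le> real (nat \<lfloor>exp u\<rfloor>) + 1"
proof -
  have "real (nat \<lfloor>exp u\<rfloor>) = of_int \<lfloor>exp u\<rfloor>" by simp
  then show "real (nat \<lfloor>exp u\<rfloor>) \<le> exp u" "exp u \<le> real (nat \<lfloor>exp u\<rfloor>) + 1" by linarith+
qed

text \<open>Throughout the window \<open>1 / p\<close> is at most \<open>exp (- u)\<close>, so the
  sum is controlled by an increment of \<open>psi\<close>. As \<open>u\<close> grows the bound tends
  to \<open>2 * (exp \<epsilon> - 1)\<close>, which is proportional to the length of a short
  window.\<close>

lemma sum_log_window_le:
  assumes "\<epsilon> > 0" "u \<ge> 2"
  shows "(\<Sum>p\<in>log_window R u (u + \<epsilon>). ln (real p) / real p) \<le> 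
     2 * (exp \<epsilon> - 1) + 2 * exp (-u) + exp \<epsilon> * (2 * (\<epsilon> + 1) + 160) / (u - 1)"
proof -
  define M N where "M = nat \<lfloor>exp u\<rfloor>" and "N = nat \<lfloor>exp (u + \<epsilon>)\<rfloor>"
  have M: "real M \<le> exp u" "exp u - 1 \<le> real M" and N: "real N \<le> exp (u + \<epsilon>)"
    using nat_floor_exp[of u] nat_floor_exp(1)[of "u + \<epsilon>"] unfolding M_def N_def by linarith+
  have MN: "M \<le> N" unfolding M_def N_def using assms by (intro nat_mono floor_mono) auto
  have e2: "exp u \<ge> 2" using exp_ge_add_one_self[of u] assms by linarith
  have M0: "M > 0" using M e2 by linarith
  have Mh: "real M \<ge> exp u / 2" using M e2 by linarith
  have lnM: "ln (real M) \<ge> u - 1"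
  proof -
    have "exp (u - 1) \<le> exp u / 2"
      using exp_ge_add_one_self[of 1] by (simp add: exp_diff field_simps)
    then have "exp (u - 1) \<le> real M" using Mh by linarith
    then show ?thesis using M0 by (simp add: ln_ge_iff)
  qed
  have NM: "ln (real N / real M) \<le> \<epsilon> + 1"
  proof -
    have "real N / real M \<le> exp (u + \<epsilon>) / (exp u / 2)"
      using N Mh by (intro frac_le) auto
    also have "\<dots> = 2 * exp \<epsilon>" by (simp add: exp_add)
    also have "\<dots> \<le> exp (\<epsilon> + 1)"
      using exp_ge_add_one_self[of 1] by (simp add: exp_add)
    finally have "ln (real N / real M) \<le> ln (exp (\<epsilon> + 1))"
      using M0 MN by (subst ln_le_cancel_iff) auto
    then show ?thesis by simp
  qed
  have "(\<Sum>p\<in>log_window R u (u + \<epsilon>). ln (real p) / real p)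
      \<le> (\<Sum>p\<in>log_window R u (u + \<epsilon>). exp (-u) * mangoldt p)"
  proof (rule sum_mono)
    fix p assume "p \<in> log_window R u (u + \<epsilon>)"
    then have p: "prime p" "u < ln (real p)" "p > 0" by (auto simp: log_window_def prime_gt_0_nat)
    then have "exp u < real p" by (metis exp_ln of_nat_0_less_iff exp_less_mono)
    then have "ln (real p) * (1 / real p) \<le> ln (real p) * (1 / exp u)"
      using p assms by (intro mult_left_mono frac_le) auto
    then show "ln (real p) / real p \<le> exp (-u) * mangoldt p"
      using p by (simp add: exp_minus field_simps)
  qed
  also have "\<dots> \<le> (\<Sum>p\<in>{M<..N}. exp (-u) * mangoldt p)"
  proof (rule sum_mono2)
    show "log_window R u (u + \<epsilon>) \<subseteq> {M<..N}"
    proof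
      fix p assume "p \<in> log_window R u (u + \<epsilon>)"
      then have p: "u < ln (real p)" "ln (real p) \<le> u + \<epsilon>" "p > 0"
        by (auto simp: log_window_def prime_gt_0_nat)
      then have "exp u < exp (ln (real p))" "exp (ln (real p)) \<le> exp (u + \<epsilon>)"
        by (simp_all only: exp_less_cancel_iff exp_le_cancel_iff)
      then have "exp u < real p" "real p \<le> exp (u + \<epsilon>)" using p by simp_all
      then show "p \<in> {M<..N}" using M unfolding N_def by (auto simp: le_nat_floor)
    qed
  qed (auto simp: mangoldt_nonneg)
  also have "\<dots> = exp (-u) * (psi N - psi M)" unfolding psi_diff[OF MN] sum_distrib_left ..
  also have "\<dots> \<le> exp (-u) * (2 * (real N - real M) + (real N * (2 * (\<epsilon> + 1) + 160)) / (u - 1))"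
  proof (rule mult_left_mono)
    have l: "ln (real M) > 0" using lnM assms by linarith
    have "psi N - psi M \<le> (2 * (real N - real M) * ln (real M)
           + 2 * real N * ln (real N / real M) + 160 * real N) / ln (real M)"
      using psi_short_interval[OF M0 MN] l by (subst pos_le_divide_eq) auto
    also have "\<dots> = 2 * (real N - real M) + (real N * (2 * ln (real N / real M) + 160)) / ln (real M)"
      using l by (simp add: field_simps)
    also have "\<dots> \<le> 2 * (real N - real M) + (real N * (2 * (\<epsilon> + 1) + 160)) / (u - 1)"
      using NM lnM assms by (intro add_mono order.refl frac_le mult_left_mono) auto
    finally show "psi N - psi M \<le> 2 * (real N - real M) + (real N * (2 * (\<epsilon> + 1) + 160)) / (u - 1)" .
  qed simp
  also have "\<dots> \<le> exp (-u) * (2 * (exp (u + \<epsilon>) - exp u + 1) + (exp (u + \<epsilon>) * (2 * (\<epsilon> + 1) + 160)) / (u - 1))"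
    using M N assms by (intro mult_left_mono add_mono divide_right_mono mult_right_mono) auto
  also have "\<dots> = 2 * (exp \<epsilon> - 1) + 2 * exp (-u) + exp \<epsilon> * (2 * (\<epsilon> + 1) + 160) / (u - 1)"
    by (simp add: exp_add exp_minus field_simps)
  finally show ?thesis .
qed

lemma sum_log_window_eventually_le:
  assumes "\<epsilon> > 0" "\<delta> > 0"
  shows "\<exists>u0. \<forall>u\<ge>u0. \<forall>R. (\<Sum>p\<in>log_window R u (u + \<epsilon>). ln (real p) / real p) \<le> 2 * (exp \<epsilon> - 1) + \<delta>"
proof -
  have "((\<lambda>u. 2 * exp (-u) + exp \<epsilon> * (2 * (\<epsilon> + 1) + 160) / (u - 1)) \<longlongrightarrow> 0) at_top"
    by real_asymp
  then have "\<forall>\<^sub>F u in at_top. 2 * exp (-u) + exp \<epsilon> * (2 * (\<epsilon> + 1) + 160) / (u - 1) < \<delta>"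
    using assms by (intro order_tendstoD) auto
  then have "\<forall>\<^sub>F u in at_top. u \<ge> 2 \<and> 2 * exp (-u) + exp \<epsilon> * (2 * (\<epsilon> + 1) + 160) / (u - 1) < \<delta>"
    by (intro eventually_conj eventually_ge_at_top)
  then show ?thesis
    unfolding eventually_at_top_linorder
  proof (elim exE, intro exI allI impI)
    fix u0 u :: real and R
    assume *: "\<forall>u\<ge>u0. 2 \<le> u \<and> 2 * exp (-u) + exp \<epsilon> * (2 * (\<epsilon> + 1) + 160) / (u - 1) < \<delta>" "u \<ge> u0"
    then show "(\<Sum>p\<in>log_window R u (u + \<epsilon>). ln (real p) / real p) \<le> 2 * (exp \<epsilon> - 1) + \<delta>"
      using sum_log_window_le[OF assms(1), of u R] by fastforce
  qed
qed

section \<open>Dirichlet characters\<close>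

definition dchars :: "nat \<Rightarrow> (nat \<Rightarrow> complex) set" where
  "dchars s = {ch. ch 1 = 1 \<and> (\<forall>m n. ch (m * n) = ch m * ch n) \<and>
     (\<forall>m n. [m = n] (mod s) \<longrightarrow> ch m = ch n) \<and> (\<forall>n. ch n \<noteq> 0 \<longleftrightarrow> coprime n s)}"

text \<open>A subgroup of the units modulo \<open>s\<close> is represented by the union \<open>H\<close> of its residue classes.\<close>

definition partial_char :: "nat \<Rightarrow> nat set \<Rightarrow> (nat \<Rightarrow> complex) \<Rightarrow> bool" where
  "partial_char s H f \<longleftrightarrow> (\<forall>n\<in>H. coprime n s) \<and> 1 \<in> H \<and> (\<forall>m\<in>H. \<forall>n\<in>H. m * n \<in> H) \<and>
     (\<forall>m\<in>H. \<forall>n. [m = n] (mod s) \<longrightarrow> n \<in> H \<and> f m = f n) \<and> f 1 = 1 \<and>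
     (\<forall>m\<in>H. \<forall>n\<in>H. f (m * n) = f m * f n) \<and> (\<forall>n\<in>H. f n \<noteq> 0)"

lemma partial_charD:
  assumes "partial_char s H f"
  shows "n \<in> H \<Longrightarrow> coprime n s" "1 \<in> H" "m \<in> H \<Longrightarrow> n \<in> H \<Longrightarrow> m * n \<in> H"
    "m \<in> H \<Longrightarrow> [m = n] (mod s) \<Longrightarrow> n \<in> H" "m \<in> H \<Longrightarrow> [m = n] (mod s) \<Longrightarrow> f n = f m" "f 1 = 1"
    "m \<in> H \<Longrightarrow> n \<in> H \<Longrightarrow> f (m * n) = f m * f n" "n \<in> H \<Longrightarrow> f n \<noteq> 0"
proof -
  note * = assms[unfolded partial_char_def]
  show "coprime n s" if "n \<in> H" using that * by simp
  show "1 \<in> H" "f 1 = 1" using * by simp_all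
  show "m * n \<in> H" "f (m * n) = f m * f n" if "m \<in> H" "n \<in> H" using that * by simp_all
  have **: "\<forall>m\<in>H. \<forall>n. [m = n] (mod s) \<longrightarrow> n \<in> H \<and> f m = f n" using * by (elim conjE)
  show "n \<in> H" "f n = f m" if "m \<in> H" "[m = n] (mod s)"
    using bspec[OF ** that(1), THEN spec, THEN mp, OF that(2)] by simp_all
  show "f n \<noteq> 0" if "n \<in> H" using that * by simp
qed

lemma partial_char_power:
  assumes "partial_char s H f" "n \<in> H"
  shows "n ^ k \<in> H \<and> f (n ^ k) = f n ^ k"
proof (induction k)
  case 0
  then show ?case using partial_charD(2,6)[OF assms(1)] by simp
next
  case (Suc k)
  then show ?case using partial_charD(3,7)[OF assms(1) assms(2), of "n ^ k"] by simp
qed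

lemma partial_char_inverse:
  assumes "partial_char s H f" "n \<in> H" "s > 0"
  shows "\<exists>k\<in>H. [n * k = 1] (mod s)"
proof -
  have "[n ^ totient s = 1] (mod s)"
    using partial_charD(1)[OF assms(1,2)] by (rule euler_theorem)
  moreover have "n ^ totient s = n * n ^ (totient s - 1)"
    using assms(3) by (cases "totient s") auto
  ultimately have "[n * n ^ (totient s - 1) = 1] (mod s)" by simp
  then show ?thesis using partial_char_power[OF assms(1,2), of "totient s - 1"] by (intro bexI) auto
qed

text \<open>Adjoining one unit \<open>g\<close> to the subgroup: \<open>g ^ i * h\<close> receives
  the value \<open>\<zeta> ^ i * f h\<close>. Two representations of one class differ by a power of
  \<open>g\<close> lying in \<open>H\<close>, hence by a multiple of \<open>m\<close>, and
  \<open>\<zeta> ^ m = f (g ^ m)\<close> makes the values agree.\<close>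

lemma partial_char_extend:
  assumes pc: "partial_char s H f" and s: "s > 0" and g: "coprime g s"
    and m: "m > 0" "g ^ m \<in> H" "\<And>i. 0 < i \<Longrightarrow> i < m \<Longrightarrow> g ^ i \<notin> H" and \<zeta>: "\<zeta> ^ m = f (g ^ m)"
  shows "\<exists>H' f'. partial_char s H' f' \<and> H \<subseteq> H' \<and> g \<in> H' \<and> f' g = \<zeta> \<and> (\<forall>h\<in>H. f' h = f h)"
proof -
  note D = partial_charD[OF pc]
  have \<zeta>0: "\<zeta> \<noteq> 0" using \<zeta> D(8)[OF m(2)] m(1) by (auto simp: power_0_left)
  \<comment> \<open>The remainder of \<open>i\<close> modulo \<open>m\<close> would otherwise be a
    smaller positive exponent with its power of \<open>g\<close> in \<open>H\<close>.\<close>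
  have pow: "\<exists>q. i = m * q" if "g ^ i \<in> H" for i
  proof -
    have "(g ^ m) ^ (i div m) \<in> H" using partial_char_power[OF pc m(2)] by blast
    then obtain k where k: "k \<in> H" "[(g ^ m) ^ (i div m) * k = 1] (mod s)"
      using partial_char_inverse[OF pc _ s] by blast
    have "g ^ i = (g ^ m) ^ (i div m) * g ^ (i mod m)"
      by (metis mult_div_mod_eq power_add power_mult)
    then have "[k * g ^ i = ((g ^ m) ^ (i div m) * k) * g ^ (i mod m)] (mod s)" by (simp add: mult_ac)
    also have "[((g ^ m) ^ (i div m) * k) * g ^ (i mod m) = 1 * g ^ (i mod m)] (mod s)"
      using k(2) by (rule cong_mult) simp
    finally have "[k * g ^ i = g ^ (i mod m)] (mod s)" by simp
    then have "g ^ (i mod m) \<in> H" using D(3)[OF k(1) that] D(4) by blast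
    then have "i mod m = 0" using m by (metis mod_less_divisor neq0_conv)
    then show ?thesis by auto
  qed
  have wd0: "\<zeta> ^ i * f h = \<zeta> ^ j * f h'"
    if "h \<in> H" "h' \<in> H" "[g ^ i * h = g ^ j * h'] (mod s)" "i \<le> j" for i j h h'
  proof -
    note h' = that(2)
    have "g ^ j = g ^ i * g ^ (j - i)" using that(4) by (simp flip: power_add)
    then have "[g ^ i * h = g ^ i * (g ^ (j - i) * h')] (mod s)" using that(3) by (simp add: mult.assoc)
    then have c: "[h = g ^ (j - i) * h'] (mod s)"
      using g by (subst (asm) cong_mult_lcancel_nat) (auto simp: coprime_commute)
    obtain k where k: "k \<in> H" "[h' * k = 1] (mod s)"
      using partial_char_inverse[OF pc h' s] by blast
    have "[h * k = g ^ (j - i) * h' * k] (mod s)" using c by (intro cong_mult) auto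
    also have "[g ^ (j - i) * h' * k = g ^ (j - i) * 1] (mod s)"
      using k(2) unfolding mult.assoc by (intro cong_mult) auto
    finally have "[h * k = g ^ (j - i)] (mod s)" by simp
    then have gH: "g ^ (j - i) \<in> H" using D(3)[OF that(1) k(1)] D(4) by blast
    then obtain q where q: "j - i = m * q" using pow by blast
    have "f (g ^ (j - i)) = f (g ^ m) ^ q"
      using partial_char_power[OF pc m(2), of q] by (simp add: q power_mult)
    then have "f (g ^ (j - i)) = \<zeta> ^ (j - i)" by (simp add: q power_mult \<zeta>)
    moreover have "f h = f (g ^ (j - i) * h')"
      using D(5)[OF that(1) c] by simp
    ultimately have "f h = \<zeta> ^ (j - i) * f h'" using D(7)[OF gH that(2)] by simp
    then show ?thesis using that(4) by (simp add: mult.assoc[symmetric] flip: power_add)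
  qed
  have wd: "\<zeta> ^ i * f h = \<zeta> ^ j * f h'"
    if "h \<in> H" "h' \<in> H" "[g ^ i * h = g ^ j * h'] (mod s)" for i j h h'
    using wd0[OF that] wd0[OF that(2,1) cong_sym[OF that(3)]] nat_le_linear[of i j] by auto
  \<comment> \<open>\<open>R n i h\<close> records one of possibly many representations of the class
    of \<open>n\<close>. Natural exponents suffice, since the inverse of \<open>g\<close> is itself
    congruent to a power of \<open>g\<close>.\<close>
  define R where "R n i h \<longleftrightarrow> h \<in> H \<and> [n = g ^ i * h] (mod s)" for n i h
  define H' where "H' = {n. \<exists>i h. R n i h}"
  define f' where "f' n = (THE z. \<exists>i h. R n i h \<and> z = \<zeta> ^ i * f h)" for n
  have f': "f' n = \<zeta> ^ i * f h" if "R n i h" for n i h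
    unfolding f'_def
  proof (rule the_equality)
    fix z assume "\<exists>i h. R n i h \<and> z = \<zeta> ^ i * f h"
    then obtain j h' where jh: "R n j h'" "z = \<zeta> ^ j * f h'" by blast
    have c: "h \<in> H" "h' \<in> H" "[g ^ j * h' = n] (mod s)" "[n = g ^ i * h] (mod s)"
      using \<open>R n i h\<close> jh(1) unfolding R_def by (simp_all add: cong_sym)
    show "z = \<zeta> ^ i * f h"
      using wd[OF c(2,1) cong_trans[OF c(3,4)]] jh(2) by simp
  qed (use that in blast)
  have R_mult: "R (n * n') (i + j) (h * h')" if "R n i h" "R n' j h'" for n n' i j h h'
  proof -
    have "[n * n' = (g ^ i * h) * (g ^ j * h')] (mod s)"
        using that unfolding R_def by (intro cong_mult) simp_all
    also have "(g ^ i * h) * (g ^ j * h') = g ^ (i + j) * (h * h')" by (simp add: power_add)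
    finally show ?thesis using D(3)[of h h'] that unfolding R_def by blast
  qed
  have R_H: "R h 0 h" if "h \<in> H" for h using that by (simp add: R_def)
  have R_g: "R g 1 1" using D(2) by (simp add: R_def)
  have H'I: "n \<in> H'" if "R n i h" for n i h using that unfolding H'_def by blast
  have 1: "coprime n s \<and> f' n \<noteq> 0" if n: "n \<in> H'" for n
  proof -
    obtain i h where r: "R n i h" using n unfolding H'_def by blast
    have "coprime (g ^ i * h) s" using r g D(1) by (simp add: R_def)
    moreover have "[g ^ i * h = n] (mod s)" using r unfolding R_def by (simp add: cong_sym)
    ultimately have "coprime n s" using cong_imp_coprime by blast
    moreover have "f' n \<noteq> 0" using f'[OF r] r D(8) \<zeta>0 by (simp add: R_def)
    ultimately show ?thesis by blast
  qed
  have H'E: "\<exists>i h. R n i h" if "n \<in> H'" for n using that unfolding H'_def by simp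
  have 2: "k \<in> H' \<and> f' n = f' k" if n: "n \<in> H'" "[n = k] (mod s)" for n k
  proof -
    obtain i h where r: "R n i h" using H'E[OF n(1)] by (elim exE)
    have rc: "h \<in> H" "[n = g ^ i * h] (mod s)" using r unfolding R_def by simp_all
    have "[k = g ^ i * h] (mod s)" using cong_sym[OF n(2)] rc(2) by (rule cong_trans)
    then have r': "R k i h" using rc unfolding R_def by blast
    show ?thesis using f'[OF r] f'[OF r'] H'I[OF r'] by simp
  qed
  have 3: "n * k \<in> H' \<and> f' (n * k) = f' n * f' k" if n: "n \<in> H'" "k \<in> H'" for n k
  proof -
    obtain i h where r: "R n i h" using H'E[OF n(1)] by (elim exE)
    obtain j h' where r': "R k j h'" using H'E[OF n(2)] by (elim exE)
    have "h \<in> H" "h' \<in> H" using r r' by (simp_all add: R_def)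
    then have "f (h * h') = f h * f h'" by (rule D(7))
    then have "f' (n * k) = f' n * f' k"
      unfolding f'[OF R_mult[OF r r']] f'[OF r] f'[OF r'] by (simp only: power_add mult_ac)
    then show ?thesis using H'I[OF R_mult[OF r r']] by blast
  qed
  have 4: "1 \<in> H'" "f' 1 = 1"
    using H'I[OF R_H[OF D(2)]] f'[OF R_H[OF D(2)]] D(6) by simp_all
  have "partial_char s H' f'"
    unfolding partial_char_def
    by (intro conjI ballI allI impI) (use 1 2 3 4 in simp_all)
  moreover have "H \<subseteq> H'" "g \<in> H'" "f' g = \<zeta>" "\<forall>h\<in>H. f' h = f h"
    using H'I[OF R_H] H'I[OF R_g] f'[OF R_g] D(6) f'[OF R_H] by auto
  ultimately show ?thesis by blast
qed

lemma partial_char_minimal_power: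
  assumes "partial_char s H f" "s > 0" "coprime g s"
  shows "\<exists>m>0. g ^ m \<in> H \<and> (\<forall>i. 0 < i \<longrightarrow> i < m \<longrightarrow> g ^ i \<notin> H)"
proof -
  define P where "P i \<longleftrightarrow> 0 < i \<and> g ^ i \<in> H" for i
  have "g ^ totient s \<in> H"
    using partial_charD(2,4)[OF assms(1)] euler_theorem[OF assms(3)] cong_sym by blast
  then have "P (totient s)" using assms(2) by (simp add: P_def)
  then have "P (LEAST i. P i)" by (rule LeastI)
  moreover have "\<not> P i" if "i < (LEAST i. P i)" for i using that by (rule not_less_Least)
  ultimately show ?thesis unfolding P_def by blast
qed

text \<open>Each extension lowers the number of unit residues outside \<open>H\<close> and keeps the
  value at \<open>a\<close>. Once all units are reached, the function is continued by zero to the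
  residues that are not units.\<close>

lemma partial_char_extend_all:
  assumes "partial_char s H f" "s > 0" "a \<in> H" "f a \<noteq> 1"
  shows "\<exists>ch\<in>dchars s. ch a \<noteq> 1"
  using assms(1,3,4)
proof (induction "card ({n. n < s \<and> coprime n s} - H)" arbitrary: H f rule: less_induct)
  case less
  note D = partial_charD[OF less.prems(1)]
  show ?case
  proof (cases "{n. n < s \<and> coprime n s} \<subseteq> H")
    case True
    have all: "n \<in> H" if "coprime n s" for n
    proof -
      have "n mod s \<in> H" using True that assms(2) by auto
      then show ?thesis by (rule D(4)) (simp add: cong_def)
    qed
    define ch where "ch n = (if coprime n s then f n else 0)" for n
    have "ch \<in> dchars s"
      unfolding dchars_def mem_Collect_eq
    proof (intro conjI allI impI)
      show "ch 1 = 1" using D(6) by (simp add: ch_def)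
      show "ch (m * n) = ch m * ch n" for m n
        using D(7) all by (simp add: ch_def)
      show "(ch n \<noteq> 0) = coprime n s" for n
        using D(8) all by (simp add: ch_def)
      fix m n assume c: "[m = n] (mod s)"
      then have "coprime m s \<longleftrightarrow> coprime n s" by (meson cong_imp_coprime cong_sym)
      then show "ch m = ch n" using D(5)[OF all c] by (auto simp: ch_def)
    qed
    moreover have "ch a \<noteq> 1" using less.prems D(1) by (simp add: ch_def)
    ultimately show ?thesis by blast
  next
    case False
    then obtain g where g: "g < s" "coprime g s" "g \<notin> H" by auto
    obtain m where m: "m > 0" "g ^ m \<in> H" "\<And>i. 0 < i \<Longrightarrow> i < m \<Longrightarrow> g ^ i \<notin> H"
      using partial_char_minimal_power[OF less.prems(1) assms(2) g(2)] by blast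
    obtain \<zeta> where \<zeta>: "\<zeta> ^ m = f (g ^ m)" using m(1) exists_complex_root by (metis neq0_conv)
    obtain H' f' where H': "partial_char s H' f'" "H \<subseteq> H'" "g \<in> H'" "\<forall>h\<in>H. f' h = f h"
      using partial_char_extend[OF less.prems(1) assms(2) g(2) m \<zeta>] by blast
    have "card ({n. n < s \<and> coprime n s} - H') < card ({n. n < s \<and> coprime n s} - H)"
      using H' g by (intro psubset_card_mono) auto
    then show ?thesis
      using less.hyps[OF _ H'(1)] H' less.prems by auto

  qed
qed

section \<open>Orthogonality of characters\<close>

lemma dcharsD:
  assumes "c \<in> dchars s"
  shows "c 1 = 1" "c (m * n) = c m * c n" "[m = n] (mod s) \<Longrightarrow> c m = c n" "c n \<noteq> 0 \<longleftrightarrow> coprime n s"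
  using assms unfolding dchars_def by simp_all

lemma dchars_power: "c \<in> dchars s \<Longrightarrow> c (n ^ k) = c n ^ k"
  using dcharsD(1,2)[of c s] by (induction k) auto

lemma dchars_root_of_unity:
  assumes "c \<in> dchars s" "coprime n s"
  shows "c n ^ totient s = 1"
  using dcharsD(3)[OF assms(1) euler_theorem[OF assms(2)]] dcharsD(1)[OF assms(1)] dchars_power[OF assms(1)]
  by simp

lemma dchars_norm:
  assumes "c \<in> dchars s" "s > 0"
  shows "norm (c n) = (if coprime n s then 1 else 0)"
proof (cases "coprime n s")
  case True
  then have "norm (c n) ^ totient s = 1"
    using dchars_root_of_unity[OF assms(1)] by (metis norm_one norm_power)
  then show ?thesis
    using True assms(2) power_eq_1_iff[of "norm (c n)" "totient s"] by auto
qed (use dcharsD(4)[OF assms(1), of n] in auto)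

lemma dchars_norm_le: "c \<in> dchars s \<Longrightarrow> s > 0 \<Longrightarrow> norm (c n) \<le> 1"
  by (simp add: dchars_norm)

lemma dchars_cnj:
  assumes "c \<in> dchars s"
  shows "(\<lambda>n. cnj (c n)) \<in> dchars s"
proof -
  have "cnj (c m) = cnj (c n)" if "[m = n] (mod s)" for m n
    using dcharsD(3)[OF assms that] by simp
  then show ?thesis
    using dcharsD(1,2,4)[OF assms] unfolding dchars_def by simp
qed

lemma dchars_mult:
  assumes "c \<in> dchars s" "d \<in> dchars s"
  shows "(\<lambda>n. c n * d n) \<in> dchars s"
proof -
  have "c m * d m = c n * d n" if "[m = n] (mod s)" for m n
    using dcharsD(3)[OF assms(1) that] dcharsD(3)[OF assms(2) that] by simp
  then show ?thesis
    using dcharsD(1,2,4)[OF assms(1)] dcharsD(1,2,4)[OF assms(2)] unfolding dchars_def by simp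
qed

definition dchar0 :: "nat \<Rightarrow> nat \<Rightarrow> complex" where
  "dchar0 s n = (if coprime n s then 1 else 0)"

lemma dchar0_in: "dchar0 s \<in> dchars s"
proof -
  have "coprime m s \<longleftrightarrow> coprime n s" if "[m = n] (mod s)" for m n
    using that by (meson cong_imp_coprime cong_sym)
  then show ?thesis unfolding dchars_def dchar0_def by simp
qed

text \<open>A character is determined by its values on the residues below \<open>s\<close>, and each
  of these is 0 or a root of unity of order dividing \<open>totient s\<close>.\<close>

lemma finite_dchars:
  assumes "s > 0"
  shows "finite (dchars s)"
proof -
  define Z where "Z = insert 0 {z::complex. z ^ totient s = 1}"
  have "finite Z" using assms finite_roots_unity[of "totient s"] by (simp add: Z_def Suc_le_eq)
  then have fin: "finite (PiE {..<s} (\<lambda>_. Z))" by (intro finite_PiE) auto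
  have "inj_on (\<lambda>c. restrict c {..<s}) (dchars s)"
  proof (rule inj_onI, rule ext)
    fix c d n assume cd: "c \<in> dchars s" "d \<in> dchars s" "restrict c {..<s} = restrict d {..<s}"
    have "c (n mod s) = d (n mod s)"
      using assms fun_cong[OF cd(3), of "n mod s"] by simp
    moreover have "c (n mod s) = c n" "d (n mod s) = d n"
      using cd(1,2) by (intro dcharsD(3)[of _ s]; simp add: cong_def)+
    ultimately show "c n = d n" by simp
  qed
  moreover have "(\<lambda>c. restrict c {..<s}) ` dchars s \<subseteq> PiE {..<s} (\<lambda>_. Z)"
  proof (intro image_subsetI)
    fix c assume "c \<in> dchars s"
    then have "c n \<in> Z" for n
      using dchars_root_of_unity[of c s n] dcharsD(4)[of c s n] unfolding Z_def by blast
    then show "restrict c {..<s} \<in> PiE {..<s} (\<lambda>_. Z)" by auto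
  qed
  ultimately show ?thesis using fin by (metis finite_imageD finite_subset)
qed

text \<open>The extension starts from the trivial subgroup. There the minimal exponent
  \<open>m\<close> is the order of \<open>a\<close>, which exceeds 1, so a primitive root of unity
  of order \<open>m\<close> may be chosen as the value at \<open>a\<close>.\<close>

lemma dchars_separate:
  assumes "s > 0" "coprime a s" "\<not> [a = 1] (mod s)"
  shows "\<exists>c\<in>dchars s. c a \<noteq> 1"
proof -
  define H where "H = {n. [n = 1] (mod s)}"
  have pc: "partial_char s H (\<lambda>_. 1)"
    unfolding partial_char_def
  proof (intro conjI ballI allI impI)
    fix m assume m: "m \<in> H"
    then show "coprime m s" unfolding H_def using cong_imp_coprime[OF cong_sym, of m 1 s] by simp
    show "m * n \<in> H" if "n \<in> H" for n
      using m that cong_mult[of m 1 s n 1] unfolding H_def by simp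
    show "n \<in> H" if "[m = n] (mod s)" for n
      using m cong_trans[OF cong_sym[OF that]] unfolding H_def by simp
  qed (auto simp: H_def)
  obtain m where m: "m > 0" "a ^ m \<in> H" "\<And>i. 0 < i \<Longrightarrow> i < m \<Longrightarrow> a ^ i \<notin> H"
    using partial_char_minimal_power[OF pc assms(1,2)] by blast
  have "m \<noteq> 1" using m(2) assms(3) by (auto simp: H_def)
  define \<zeta> where "\<zeta> = cis (2 * pi / real m)"
  have "\<zeta> ^ m = cis (real m * (2 * pi / real m))" unfolding \<zeta>_def by (rule Complex.DeMoivre)
  also have "\<dots> = 1" using m(1) by simp
  finally have "\<zeta> ^ m = 1" .
  moreover have "\<zeta> \<noteq> 1"
  proof
    assume "\<zeta> = 1"
    then have "cos (2 * pi / real m) = 1" by (simp add: \<zeta>_def complex_eq_iff)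
    then obtain k :: int where "2 * pi / real m = of_int k * 2 * pi" using cos_one_2pi_int by blast
    then have "of_int (k * int m) = (1::real)" using m(1) by (simp add: field_simps)
    then have "k * int m = 1" by linarith
    then show False using \<open>m \<noteq> 1\<close> m(1) by (auto simp: zmult_eq_1_iff)
  qed
  ultimately obtain H' f' where "partial_char s H' f'" "a \<in> H'" "f' a = \<zeta>"
    using partial_char_extend[OF pc assms(1,2) m] by blast
  then show ?thesis using partial_char_extend_all[of s H' f' a] assms(1) \<open>\<zeta> \<noteq> 1\<close> by blast
qed

text \<open>Multiplication by a character \<open>d\<close> with \<open>d a \<noteq> 1\<close>
  permutes all characters and multiplies the sum by \<open>d a\<close>, so the sum vanishes.\<close>

lemma sum_dchars:
  assumes "s > 0"
  shows "(\<Sum>c\<in>dchars s. c a) = (if [a = 1] (mod s) then of_nat (card (dchars s)) else 0)"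
proof -
  consider "[a = 1] (mod s)" | "\<not> coprime a s" "\<not> [a = 1] (mod s)" | "coprime a s" "\<not> [a = 1] (mod s)"
      by blast
  then show ?thesis
  proof cases
    case 1
    then have "(\<Sum>c\<in>dchars s. c a) = (\<Sum>c\<in>dchars s. 1)"
      by (intro sum.cong refl) (use dcharsD(1,3) in metis)
    then show ?thesis using 1 by simp
  next
    case 2
    then have "(\<Sum>c\<in>dchars s. c a) = (\<Sum>c\<in>dchars s. 0)"
      by (intro sum.cong refl) (use dcharsD(4) in blast)
    then show ?thesis using 2 by simp
  next
    case 3
    then obtain d where d: "d \<in> dchars s" "d a \<noteq> 1" using dchars_separate assms by blast
    define h where "h = (\<lambda>(c::nat\<Rightarrow>complex) n. d n * c n)"
    have inj: "inj_on h (dchars s)"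
    proof (rule inj_onI, rule ext)
      fix c c' n assume c: "c \<in> dchars s" "c' \<in> dchars s" "h c = h c'"
      have "d n * c n = d n * c' n" using fun_cong[OF c(3), of n] by (simp add: h_def)
      then show "c n = c' n"
        using dcharsD(4)[OF d(1), of n] dcharsD(4)[OF c(1), of n] dcharsD(4)[OF c(2), of n] by auto
    qed
    have "h ` dchars s \<subseteq> dchars s" using dchars_mult[OF d(1)] by (auto simp: h_def)
    then have "h ` dchars s = dchars s" using inj finite_dchars[OF assms] by (intro endo_inj_surj) auto
    then have "(\<Sum>c\<in>dchars s. c a) = (\<Sum>c\<in>h ` dchars s. c a)" by simp
    also have "\<dots> = d a * (\<Sum>c\<in>dchars s. c a)"
      using inj by (simp add: sum.reindex h_def sum_distrib_left)
    finally show ?thesis using 3 d by simp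
  qed
qed

text \<open>Dual to the orthogonality over characters: multiplication by a unit \<open>a\<close>
  with \<open>c a \<noteq> 1\<close> permutes the residues and multiplies the sum by
  \<open>c a\<close>.\<close>

lemma dchars_sum_period:
  assumes "s > 0" "c \<in> dchars s" "c \<noteq> dchar0 s"
  shows "(\<Sum>n<s. c n) = 0"
proof -
  obtain a where a: "c a \<noteq> dchar0 s a" using assms(3) by blast
  have cop: "coprime a s"
    using a dcharsD(4)[OF assms(2), of a] unfolding dchar0_def by (metis)
  then have a1: "c a \<noteq> 1" using a by (simp add: dchar0_def)
  have inj: "inj_on (\<lambda>n. a * n mod s) {..<s}"
  proof (rule inj_onI)
    fix m n assume mn: "m \<in> {..<s}" "n \<in> {..<s}" "a * m mod s = a * n mod s"
    then have "[a * m = a * n] (mod s)" by (simp add: cong_def)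
    then have "[m = n] (mod s)" using cop by (simp add: cong_mult_lcancel_nat)
    then show "m = n" using mn by (simp add: cong_def)
  qed
  have "(\<lambda>n. a * n mod s) ` {..<s} = {..<s}"
    using inj assms(1) by (intro endo_inj_surj) auto
  then have "(\<Sum>n<s. c n) = (\<Sum>n\<in>(\<lambda>n. a * n mod s) ` {..<s}. c n)" by simp
  also have "\<dots> = (\<Sum>n<s. c (a * n mod s))" using inj by (simp add: sum.reindex)
  also have "\<dots> = (\<Sum>n<s. c a * c n)"
  proof (rule sum.cong[OF refl])
    fix n have "c (a * n mod s) = c (a * n)" by (rule dcharsD(3)[OF assms(2)]) (simp add: cong_def)
    then show "c (a * n mod s) = c a * c n" using dcharsD(2)[OF assms(2)] by simp
  qed
  also have "\<dots> = c a * (\<Sum>n<s. c n)" by (simp add: sum_distrib_left)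
  finally show ?thesis using a1 by simp
qed

lemma dchars_sum_bound:
  assumes "s > 0" "c \<in> dchars s" "c \<noteq> dchar0 s"
  shows "norm (\<Sum>n=1..N. c n) \<le> 2 * real s"
proof -
  have per: "c (n + k * s) = c n" for n k
    by (rule dcharsD(3)[OF assms(2)]) (simp add: cong_def)
  have blocks: "(\<Sum>n<q * s. c n) = 0" for q
  proof (induction q)
    case (Suc q)
    have "{..<Suc q * s} = {..<q * s} \<union> (\<lambda>n. n + q * s) ` {..<s}"
    proof (intro equalityI subsetI)
      fix x assume x: "x \<in> {..<Suc q * s}"
      show "x \<in> {..<q * s} \<union> (\<lambda>n. n + q * s) ` {..<s}"
      proof (cases "x < q * s")
        case False
        then have "x = (x - q * s) + q * s" "x - q * s < s" using x by auto
        then show ?thesis by blast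
      qed auto
    qed auto
    then have "(\<Sum>n<Suc q * s. c n) = (\<Sum>n\<in>{..<q * s} \<union> (\<lambda>n. n + q * s) ` {..<s}. c n)" by simp
    also have "\<dots> = (\<Sum>n<q * s. c n) + (\<Sum>n\<in>(\<lambda>n. n + q * s) ` {..<s}. c n)"
      by (intro sum.union_disjoint) auto
    also have "(\<Sum>n\<in>(\<lambda>n. n + q * s) ` {..<s}. c n) = (\<Sum>n<s. c n)"
      by (subst sum.reindex) (auto simp: per inj_on_def)
    finally show ?case using Suc dchars_sum_period[OF assms] by simp
  qed simp
  have first: "norm (\<Sum>n<M. c n) \<le> real s" for M
  proof -
    have "{..<M} = {..<(M div s) * s} \<union> {(M div s) * s..<M}"
      using order_less_le_trans[OF _ div_times_less_eq_dividend[of M s]] by auto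
    then have "(\<Sum>n<M. c n) = (\<Sum>n\<in>{..<(M div s) * s} \<union> {(M div s) * s..<M}. c n)" by simp
    also have "\<dots> = (\<Sum>n<(M div s) * s. c n) + (\<Sum>n\<in>{(M div s) * s..<M}. c n)"
      by (intro sum.union_disjoint) auto
    finally have "norm (\<Sum>n<M. c n) = norm (\<Sum>n\<in>{(M div s) * s..<M}. c n)" by (simp add: blocks)
    also have "\<dots> \<le> (\<Sum>n\<in>{(M div s) * s..<M}. norm (c n))" by (rule norm_sum)
    also have "\<dots> \<le> (\<Sum>n\<in>{(M div s) * s..<M}. 1)"
      using dchars_norm_le[OF assms(2,1)] by (intro sum_mono) auto
    also have "\<dots> = real (M mod s)" by (simp add: minus_div_mult_eq_mod)
    also have "\<dots> \<le> real s" using assms(1) by (simp add: less_imp_le)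
    finally show ?thesis .
  qed
  have "{..<Suc N} = insert 0 {1..N}" by auto
  then have "(\<Sum>n<Suc N. c n) = (\<Sum>n\<in>insert 0 {1..N}. c n)" by simp
  also have "\<dots> = c 0 + (\<Sum>n=1..N. c n)" by (subst sum.insert) auto
  finally have "(\<Sum>n=1..N. c n) = (\<Sum>n<Suc N. c n) - c 0" by simp
  then have "norm (\<Sum>n=1..N. c n) \<le> norm (\<Sum>n<Suc N. c n) + norm (c 0)"
    by (metis norm_triangle_ineq4)
  also have "\<dots> \<le> real s + 1" using first[of "Suc N"] dchars_norm_le[OF assms(2,1)] by (intro add_mono) auto
  finally show ?thesis using assms(1) by (simp add: Suc_le_eq)
qed

section \<open>Primes congruent to 1\<close>

text \<open>Abel summation for bounded partial sums. Monotonicity is demanded only beyond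
  \<open>M\<close>, because one of the weights, \<open>ln n / n\<close>, decreases only from 3
  on.\<close>

lemma abel_bound:
  fixes a :: "nat \<Rightarrow> 'a::real_normed_vector" and w :: "nat \<Rightarrow> real"
  assumes A: "\<And>k. norm (\<Sum>n=1..k. a n) \<le> B"
    and w: "\<And>n. n > M \<Longrightarrow> w (Suc n) \<le> w n" "\<And>n. n > M \<Longrightarrow> 0 \<le> w n"
  shows "norm (\<Sum>n\<in>{M<..N}. w n *\<^sub>R a n) \<le> 2 * B * w (Suc M)"
proof -
  define S where "S k = (\<Sum>n=1..k. a n)" for k
  have S: "norm (S k) \<le> B" for k using A by (simp add: S_def)
  have SS: "S (Suc k) = S k + a (Suc k)" for k by (simp add: S_def)
  have B0: "B \<ge> 0" using S[of 0] norm_ge_zero order_trans by blast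
  \<comment> \<open>The induction keeps the boundary term \<open>w N *\<^sub>R S N\<close> apart;
    then each step adds exactly \<open>(w N - w (Suc N)) *\<^sub>R S N\<close>, and the bounds
    telescope.\<close>
  have *: "norm ((\<Sum>n\<in>{M<..N}. w n *\<^sub>R a n) - w N *\<^sub>R S N) \<le> B * (2 * w (Suc M) - w N)" if "N \<ge> Suc M" for N
    using that
  proof (induction N rule: dec_induct)
    case base
    have "{M<..Suc M} = {Suc M}" by auto
    then have "(\<Sum>n\<in>{M<..Suc M}. w n *\<^sub>R a n) - w (Suc M) *\<^sub>R S (Suc M) = - (w (Suc M) *\<^sub>R S M)"
      by (simp add: SS scaleR_add_right)
    then have "norm ((\<Sum>n\<in>{M<..Suc M}. w n *\<^sub>R a n) - w (Suc M) *\<^sub>R S (Suc M)) = w (Suc M) * norm (S M)"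
      using w(2)[of "Suc M"] by simp
    also have "\<dots> \<le> w (Suc M) * B" using w(2)[of "Suc M"] S by (intro mult_left_mono) auto
    finally show ?case by (simp add: algebra_simps)
  next
    case (step N)
    have "{M<..Suc N} = insert (Suc N) {M<..N}" using step by auto
    then have eq: "(\<Sum>n\<in>{M<..Suc N}. w n *\<^sub>R a n) - w (Suc N) *\<^sub>R S (Suc N)
      = ((\<Sum>n\<in>{M<..N}. w n *\<^sub>R a n) - w N *\<^sub>R S N) + (w N - w (Suc N)) *\<^sub>R S N"
      by (simp add: SS algebra_simps)
    have "norm ((w N - w (Suc N)) *\<^sub>R S N) \<le> (w N - w (Suc N)) * B"
      using w(1)[of N] step S by (auto intro!: mult_left_mono)
    then have "norm ((\<Sum>n\<in>{M<..Suc N}. w n *\<^sub>R a n) - w (Suc N) *\<^sub>R S (Suc N))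
      \<le> B * (2 * w (Suc M) - w N) + (w N - w (Suc N)) * B"
      unfolding eq using step.IH by (intro norm_triangle_le add_mono) auto
    then show ?case by (simp add: algebra_simps)
  qed
  show ?thesis
  proof (cases "N \<ge> Suc M")
    case True
    have "norm (\<Sum>n\<in>{M<..N}. w n *\<^sub>R a n) \<le> 
        norm ((\<Sum>n\<in>{M<..N}. w n *\<^sub>R a n) - w N *\<^sub>R S N) + norm (w N *\<^sub>R S N)"
      by (metis diff_add_cancel norm_triangle_ineq)
    also have "norm (w N *\<^sub>R S N) \<le> w N * B"
      using w(2)[of N] True S by (auto intro!: mult_left_mono)
    also have "norm ((\<Sum>n\<in>{M<..N}. w n *\<^sub>R a n) - w N *\<^sub>R S N) + w N * B \<le> B * (2 * w (Suc M) - w N) + w N * B"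
      using *[OF True] by simp
    finally show ?thesis by (simp add: algebra_simps)
  next
    case False
    then show ?thesis using B0 w(2)[of "Suc M"] by simp
  qed
qed

lemma ln_over_self_decreasing:
  assumes "n \<ge> 3"
  shows "ln (real (Suc n)) / real (Suc n) \<le> ln (real n) / real n"
proof -
  have "1 + 1 / real n = real (Suc n) / real n" using assms by (simp add: field_simps)
  then have "ln (real (Suc n)) - ln (real n) = ln (1 + 1 / real n)" using assms by (simp add: ln_div)
  also have "\<dots> \<le> 1 / real n" using assms by (intro ln_add_one_self_le_self) auto
  finally have "real n * (ln (real (Suc n)) - ln (real n)) \<le> 1" using assms by (simp add: field_simps)
  moreover have "1 \<le> ln (real n)"
    using exp_le assms by (subst ln_ge_iff) auto
  ultimately show ?thesis using assms by (simp add: field_simps)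
qed

section \<open>Partial sums of \<open>L(1, c)\<close> and of its logarithmic derivative\<close>

definition lpart :: "(nat \<Rightarrow> complex) \<Rightarrow> nat \<Rightarrow> complex" where
  "lpart c N = (\<Sum>n=1..N. c n / of_nat n)"

text \<open>These are the partial sums of \<open>- L'/L\<close> at 1 for the character
  \<open>c\<close>.\<close>

definition mpart :: "(nat \<Rightarrow> complex) \<Rightarrow> nat \<Rightarrow> complex" where
  "mpart c N = (\<Sum>n=1..N. mangoldt n * c n / of_nat n)"

lemma lpart_diff:
  assumes "s > 0" "c \<in> dchars s" "c \<noteq> dchar0 s" "M \<le> N"
  shows "norm (lpart c N - lpart c M) \<le> 4 * real s / real (Suc M)"
proof -
  have "lpart c N = lpart c M + (\<Sum>n\<in>{M<..N}. c n / of_nat n)"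
    unfolding lpart_def by (rule sum_split_at[OF assms(4)])
  then have "lpart c N - lpart c M = (\<Sum>n\<in>{M<..N}. (1 / real n) *\<^sub>R c n)"
    by (simp add: scaleR_conv_of_real divide_inverse mult.commute)
  also have "norm \<dots> \<le> 2 * (2 * real s) * (1 / real (Suc M))"
    using dchars_sum_bound[OF assms(1-3)] by (intro abel_bound) (auto intro!: divide_left_mono)
  finally show ?thesis by simp
qed

definition lval :: "(nat \<Rightarrow> complex) \<Rightarrow> complex" where
  "lval c = lim (lpart c)"

lemma lpart_tendsto:
  assumes "s > 0" "c \<in> dchars s" "c \<noteq> dchar0 s"
  shows "lpart c \<longlonglongrightarrow> lval c"
proof -
  have "Cauchy (lpart c)"
  proof (rule metric_CauchyI)
    fix e :: real assume e: "e > 0"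
    obtain M where M: "8 * real s / e < real M" using reals_Archimedean2 by blast
    have b: "norm (lpart c N - lpart c M) < e / 2" if "N \<ge> M" for N
    proof -
      have "norm (lpart c N - lpart c M) \<le> 4 * real s / real (Suc M)" by (rule lpart_diff[OF assms that])
      also have "\<dots> < e / 2" using M e by (simp add: field_simps)
      finally show ?thesis .
    qed
    have "dist (lpart c m) (lpart c n) < e" if "m \<ge> M" "n \<ge> M" for m n
    proof -
      have "dist (lpart c m) (lpart c n) \<le> norm (lpart c m - lpart c M) + norm (lpart c n - lpart c M)"
        by (metis dist_norm dist_triangle2)
      then show ?thesis using b[OF that(1)] b[OF that(2)] by linarith
    qed
    then show "\<exists>M. \<forall>m\<ge>M. \<forall>n\<ge>M. dist (lpart c m) (lpart c n) < e" by blast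
  qed
  then show ?thesis unfolding lval_def by (simp add: Cauchy_convergent convergent_LIMSEQ_iff[symmetric])
qed

lemma lval_diff:
  assumes "s > 0" "c \<in> dchars s" "c \<noteq> dchar0 s"
  shows "norm (lpart c M - lval c) \<le> 4 * real s / real (Suc M)"
proof -
  have "(\<lambda>N. norm (lpart c N - lpart c M)) \<longlonglongrightarrow> norm (lval c - lpart c M)"
    by (intro tendsto_intros lpart_tendsto[OF assms])
  then have "norm (lval c - lpart c M) \<le> 4 * real s / real (Suc M)"
    by (rule LIMSEQ_le_const2) (use lpart_diff[OF assms] in blast)
  then show ?thesis by (simp add: norm_minus_commute)
qed

lemma lpart_scaled:
  assumes "c \<in> dchars s"
  shows "(\<Sum>m=1..K. c (d * m) / of_nat (d * m)) = c d / of_nat d * lpart c K"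
  unfolding lpart_def sum_distrib_left
  by (intro sum.cong refl) (simp add: dcharsD(2)[OF assms])

text \<open>The tail beyond \<open>N div d\<close> has size of order \<open>s * d / N\<close>, and
  the factor \<open>1 / d\<close> cancels that \<open>d\<close>. Each of the \<open>N\<close>
  divisors thus contributes the same small amount, so that weighted sums over
  \<open>d \<le> N\<close> remain bounded.\<close>

lemma lpart_div_error:
  assumes "s > 0" "c \<in> dchars s" "c \<noteq> dchar0 s" "1 \<le> d" "d \<le> N"
  shows "norm (c d / of_nat d * (lpart c (N div d) - lval c)) \<le> 4 * real s / real N"
proof -
  have "real N / real d \<le> real (Suc (N div d))"
    using real_minus_1_le_nat_div[of N d] by simp
  then have "4 * real s / real (Suc (N div d)) \<le> 4 * real s / (real N / real d)"
    using assms by (intro divide_left_mono) auto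
  then have "norm (lpart c (N div d) - lval c) \<le> 4 * real s / real N * real d"
    using lval_diff[OF assms(1-3), of "N div d"] by simp
  then have "norm (c d) * (norm (lpart c (N div d) - lval c) / real d) \<le> 1 * (4 * real s / real N)"
    using dchars_norm_le[OF assms(2,1)] assms(4) by (intro mult_mono) (auto simp: field_simps)
  then show ?thesis by (simp add: norm_mult norm_divide)
qed

lemma sum_char_ln_bound:
  assumes "s > 0" "c \<in> dchars s" "c \<noteq> dchar0 s"
  shows "norm (\<Sum>k=1..N. of_real (ln (real k)) * c k / of_nat k) \<le> 6 + 4 * real s * ln 4"
proof -
  define t where "t k = (ln (real k) / real k) *\<^sub>R c k" for k
  have t: "(\<Sum>k=1..N. of_real (ln (real k)) * c k / of_nat k) = (\<Sum>k=1..N. t k)"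
    by (intro sum.cong refl) (simp add: t_def scaleR_conv_of_real)
  \<comment> \<open>\<open>ln k / k\<close> decreases only from 3 on, so the first three terms are
    estimated trivially.\<close>
  have "(\<Sum>k=1..N. t k) = (\<Sum>k\<in>{1..N} \<inter> {1..3}. t k) + (\<Sum>k\<in>{3<..N}. t k)"
    by (subst sum.union_disjoint[symmetric]) (auto intro!: arg_cong[where f = "sum t"])
  moreover have "norm (\<Sum>k\<in>{1..N} \<inter> {1..3}. t k) \<le> 6"
  proof -
    have "norm (\<Sum>k\<in>{1..N} \<inter> {1..3}. t k) \<le> (\<Sum>k\<in>{1..N} \<inter> {1..3}. norm (t k))" by (rule norm_sum)
    also have "\<dots> \<le> (\<Sum>k\<in>{1..N} \<inter> {1..3}. 2)"
    proof (rule sum_mono)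
      fix k assume "k \<in> {1..N} \<inter> {1..3}"
      then have k: "k \<ge> 1" by simp
      then have "ln (real k) \<le> real k" using ln_le_minus_one[of "real k"] by simp
      then have "\<bar>ln (real k) / real k\<bar> \<le> 1" using k by simp
      then have "\<bar>ln (real k) / real k\<bar> * norm (c k) \<le> 1 * 1"
        using dchars_norm_le[OF assms(2,1)] by (intro mult_mono) auto
      then show "norm (t k) \<le> 2" by (simp add: t_def)
    qed
    also have "\<dots> \<le> 2 * 3" using card_mono[of "{1..3::nat}" "{1..N} \<inter> {1..3}"] by auto
    finally show ?thesis by simp
  qed
  moreover have "norm (\<Sum>k\<in>{3<..N}. t k) \<le> 2 * (2 * real s) * (ln (real (Suc 3)) / real (Suc 3))"
    unfolding t_def using dchars_sum_bound[OF assms] ln_over_self_decreasing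
    by (intro abel_bound) auto
  moreover have "2 * (2 * real s) * (ln (real (Suc 3)) / real (Suc 3)) \<le> 4 * real s * ln 4" by simp
  ultimately show ?thesis unfolding t by (simp only:) (intro norm_triangle_le add_mono; linarith)
qed

text \<open>The identity \<open>- L' = L * (- L'/L)\<close> for partial sums, from
  \<open>ln = 1 * mangoldt\<close>. The left side is bounded by Abel summation, and replacing the
  inner partial sums by their limit costs \<open>psi N\<close> times an error of order
  \<open>s / N\<close>.\<close>

lemma mpart_lval_bound:
  assumes "s > 0" "c \<in> dchars s" "c \<noteq> dchar0 s" "N > 0"
  shows "norm (lval c * mpart c N) \<le> 6 + 4 * real s * ln 4 + 16 * real s"
proof -
  define E where "E = (\<Sum>d=1..N. mangoldt d * (c d / of_nat d * (lpart c (N div d) - lval c)))"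
  have "(\<Sum>k=1..N. of_real (ln (real k)) * c k / of_nat k)
      = (\<Sum>k=1..N. \<Sum>d | d dvd k. mangoldt d * (c k / of_nat k))"
    by (intro sum.cong refl) (simp add: mangoldt_sum sum_distrib_right[symmetric] flip: sum_divide_distrib)
  also have "\<dots> = (\<Sum>d=1..N. \<Sum>m=1..N div d. mangoldt d * (c (d * m) / of_nat (d * m)))"
    by (rule sum_divisors_swap)
  also have "\<dots> = (\<Sum>d=1..N. mangoldt d * (c d / of_nat d * lpart c (N div d)))"
    by (simp only: sum_distrib_left[symmetric] lpart_scaled[OF assms(2)])
  also have "\<dots> = E + lval c * mpart c N"
    unfolding E_def mpart_def sum_distrib_left sum.distrib[symmetric]
    by (intro sum.cong refl) (simp add: algebra_simps diff_divide_distrib)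
  finally have eq: "lval c * mpart c N = (\<Sum>k=1..N. of_real (ln (real k)) * c k / of_nat k) - E" by simp
  have "norm E \<le> (\<Sum>d=1..N. norm (mangoldt d * (c d / of_nat d * (lpart c (N div d) - lval c))))"
    unfolding E_def by (rule norm_sum)
  also have "\<dots> \<le> (\<Sum>d=1..N. mangoldt d * (4 * real s / real N))"
  proof (rule sum_mono)
    fix d assume "d \<in> {1..N}"
    then have "mangoldt d * norm (c d / of_nat d * (lpart c (N div d) - lval c))
        \<le> mangoldt d * (4 * real s / real N)"
      using lpart_div_error[OF assms(1-3), of d N] by (intro mult_left_mono mangoldt_nonneg) auto
    then show "norm (mangoldt d * (c d / of_nat d * (lpart c (N div d) - lval c)))
        \<le> mangoldt d * (4 * real s / real N)"
      by (simp only: norm_mult norm_mangoldt)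
  qed
  also have "\<dots> = psi N * (4 * real s / real N)" unfolding psi_def by (rule sum_distrib_right[symmetric])
  also have "\<dots> \<le> (4 * real N) * (4 * real s / real N)" by (intro mult_right_mono psi_le) auto
  also have "\<dots> = 16 * real s" using assms(4) by simp
  finally show ?thesis unfolding eq using sum_char_ln_bound[OF assms(1-3), of N]
    by (intro order_trans[OF norm_triangle_ineq4]) linarith
qed

text \<open>With \<open>lval c = 0\<close> the inner sums of the Tatuzawa-Iseki formula for
  \<open>c k / k\<close> are tails of order \<open>s / N\<close>, and the weights
  \<open>ln (N / d)\<close> sum to at most \<open>N\<close>. So a zero at 1 forces
  \<open>mpart c N\<close> to behave like \<open>- ln N\<close>.\<close>

lemma mpart_lval_zero:
  assumes "s > 0" "c \<in> dchars s" "c \<noteq> dchar0 s" "N > 0" "lval c = 0"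
  shows "norm (of_real (ln (real N)) + mpart c N) \<le> 4 * real s"
proof -
  define f where "f k = c k / of_nat k" for k
  have "of_real (ln (real N)) + mpart c N = ln (real N) *\<^sub>R f 1 + (\<Sum>k=1..N. mangoldt k *\<^sub>R f k)"
    using dcharsD(1)[OF assms(2)] by (simp add: f_def mpart_def scaleR_conv_of_real)
  also have "\<dots> = (\<Sum>d=1..N. (moebius d * ln (real N / real d)) *\<^sub>R (\<Sum>m=1..N div d. f (d * m)))"
    by (rule tatuzawa_iseki[OF assms(4), symmetric])
  also have "norm \<dots> \<le> (\<Sum>d=1..N. norm ((moebius d * ln (real N / real d)) *\<^sub>R (\<Sum>m=1..N div d. f (d * m))))"
    by (rule norm_sum)
  also have "\<dots> \<le> (\<Sum>d=1..N. (1 * ln (real N / real d)) * (4 * real s / real N))"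
  proof (rule sum_mono)
    fix d assume d: "d \<in> {1..N}"
    have "norm ((moebius d * ln (real N / real d)) *\<^sub>R (\<Sum>m=1..N div d. f (d * m)))
        = (\<bar>moebius d\<bar> * ln (real N / real d)) * norm (\<Sum>m=1..N div d. f (d * m))"
      using d by (simp add: abs_mult)
    also have "\<dots> \<le> (1 * ln (real N / real d)) * (4 * real s / real N)"
      unfolding f_def lpart_scaled[OF assms(2)]
      using lpart_div_error[OF assms(1-3), of d N] d abs_moebius_le assms(5)
      by (intro mult_mono) auto
    finally show "norm ((moebius d * ln (real N / real d)) *\<^sub>R (\<Sum>m=1..N div d. f (d * m)))
      \<le> (1 * ln (real N / real d)) * (4 * real s / real N)" .
  qed
  also have "\<dots> = (\<Sum>d=1..N. ln (real N / real d)) * (4 * real s / real N)"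
    unfolding mult_1 by (rule sum_distrib_right[symmetric])
  also have "(\<Sum>d=1..N. ln (real N / real d)) = real N * ln (real N) - ln (fact N)"
    unfolding ln_fact_eq_sum_ln using assms(4) by (simp add: ln_div sum_subtractf)
  also have "(real N * ln (real N) - ln (fact N)) * (4 * real s / real N) \<le> real N * (4 * real s / real N)"
    using ln_fact_lower[OF assms(4)] by (intro mult_right_mono) auto
  finally show ?thesis using assms(4) by simp
qed

section \<open>Nonvanishing for real characters\<close>

lemma sum_divisors_prime_power_mult:
  fixes h :: "nat \<Rightarrow> 'a::comm_monoid_add"
  assumes p: "prime p" and m: "\<not> p dvd m" "m > 0"
  shows "(\<Sum>d | d dvd p ^ k * m. h d) = (\<Sum>i\<le>k. \<Sum>d | d dvd m. h (p ^ i * d))"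
proof -
  define F where "F = (\<lambda>(i, d). p ^ i * d :: nat)"
  have p0: "p > 0" using p by (simp add: prime_gt_0_nat)
  have inj: "inj_on F ({..k} \<times> {d. d dvd m})"
  proof (rule inj_onI)
    have *: "i = j \<and> d = e" if "i \<le> j" "d dvd m" "p ^ i * d = p ^ j * e" for i j d e
    proof -
      have "p ^ j = p ^ i * p ^ (j - i)" using that(1) by (simp flip: power_add)
      then have d: "d = p ^ (j - i) * e" using that(3) p0 by simp
      have "\<not> p dvd d" using that(2) m dvd_trans by blast
      then have "j - i = 0" using d by (cases "j - i") auto
      then show ?thesis using d that(1) by simp
    qed
    fix a b assume ab: "a \<in> {..k} \<times> {d. d dvd m}" "b \<in> {..k} \<times> {d. d dvd m}" "F a = F b"
    obtain i d j e where [simp]: "a = (i, d)" "b = (j, e)" by (cases a, cases b) auto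
    show "a = b"
      using *[of i j d e] *[of j i e d] ab by (cases "i \<le> j") (auto simp: F_def)
  qed
  have "F ` ({..k} \<times> {d. d dvd m}) = {d. d dvd p ^ k * m}"
  proof (intro equalityI subsetI)
    fix d assume "d \<in> {d. d dvd p ^ k * m}"
    then obtain b e where be: "d = b * e" "b dvd p ^ k" "e dvd m"
      using division_decomp[of d "p ^ k" m] by blast
    then obtain i where "i \<le> k" "b = p ^ i" using divides_primepow_nat[OF p] by blast
    then show "d \<in> F ` ({..k} \<times> {d. d dvd m})" using be by (force simp: F_def)
  qed (auto simp: F_def intro!: mult_dvd_mono le_imp_power_dvd)
  then have "(\<Sum>d | d dvd p ^ k * m. h d) = (\<Sum>x\<in>F ` ({..k} \<times> {d. d dvd m}). h x)" by simp
  also have "\<dots> = (\<Sum>(i, d)\<in>{..k} \<times> {d. d dvd m}. h (p ^ i * d))"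
    using inj by (subst sum.reindex) (auto simp: F_def case_prod_unfold)
  also have "\<dots> = (\<Sum>i\<le>k. \<Sum>d | d dvd m. h (p ^ i * d))" by (rule sum.cartesian_product[symmetric])
  finally show ?thesis .
qed

lemma geometric_sum_sign:
  fixes x :: real
  assumes "x = -1 \<or> x = 0 \<or> x = 1"
  shows "(\<Sum>i\<le>k. x ^ i) \<ge> (if even k then 1 else 0)"
proof -
  have "(\<Sum>i\<le>k. (-1::real) ^ i) = (if even k then 1 else 0)" by (induction k) auto
  moreover have "(\<Sum>i\<le>k. (0::real) ^ i) = 1" by (induction k) auto
  ultimately show ?thesis using assms by auto
qed

text \<open>The divisor sum is multiplicative. On a prime power \<open>p ^ k\<close> it is a
  geometric sum of a sign or zero, which is nonnegative, and at least 1 when \<open>k\<close> is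
  even; a square has even exponents only.\<close>

lemma sum_real_char_divisors:
  fixes h :: "nat \<Rightarrow> real"
  assumes h1: "h 1 = 1" and hm: "\<And>m n. h (m * n) = h m * h n"
    and hv: "\<And>n. h n = -1 \<or> h n = 0 \<or> h n = 1" and n: "n > 0"
  shows "(\<Sum>d | d dvd n. h d) \<ge> (if \<exists>q. n = q ^ 2 then 1 else 0)"
  using n
proof (induction n rule: less_induct)
  case (less n)
  show ?case
  proof (cases "n = 1")
    case True
    have "{d::nat. d dvd 1} = {1}" by auto
    then show ?thesis using True h1 by simp
  next
    case False
    then obtain p where p: "prime p" "p dvd n" using prime_factor_nat by blast
    define k where "k = multiplicity p n"
    obtain m where m: "n = p ^ k * m" "\<not> p dvd m"
      using multiplicity_decompose'[of n p] less.prems p unfolding k_def by (metis not_prime_unit neq0_conv)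
    have "k \<noteq> 0" using m p by (cases k) auto
    have m0: "m > 0" using m less.prems by (cases m) auto
    have "1 < p ^ k" using prime_gt_1_nat[OF p(1)] \<open>k \<noteq> 0\<close> by (intro one_less_power) auto
    then have mn: "m < n" using m m0 by simp
    have hp: "h (p ^ i) = h p ^ i" for i by (induction i) (use h1 hm in auto)
    have D: "(\<Sum>d | d dvd n. h d) = (\<Sum>i\<le>k. h p ^ i) * (\<Sum>d | d dvd m. h d)"
      unfolding m(1) sum_divisors_prime_power_mult[OF p(1) m(2) m0]
      unfolding hm hp by (simp only: sum_product)
    have G: "(\<Sum>i\<le>k. h p ^ i) \<ge> (if even k then 1 else 0)" by (rule geometric_sum_sign) (rule hv)
    have IH: "(\<Sum>d | d dvd m. h d) \<ge> (if \<exists>q. m = q ^ 2 then 1 else 0)" by (rule less.IH[OF mn m0])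
    show ?thesis
    proof (cases "\<exists>q. n = q ^ 2")
      case True
      then obtain q where q: "n = q ^ 2" by blast
      have q0: "q \<noteq> 0" using q less.prems by auto
      obtain m' where m': "q = p ^ multiplicity p q * m'"
        using multiplicity_decompose'[of q p] q0 p by (metis not_prime_unit)
      have k: "k = 2 * multiplicity p q"
        unfolding k_def q using p q0 by (simp add: prime_elem_multiplicity_power_distrib)
      have "p ^ k * m = (p ^ multiplicity p q * m') ^ 2" using q m(1) m' by simp
      also have "\<dots> = p ^ k * m' ^ 2"
          by (simp add: k power_mult_distrib power_mult mult.commute flip: power_mult)
      finally have "m = m' ^ 2" using p by (simp add: prime_gt_0_nat)
      then have "(\<Sum>d | d dvd m. h d) \<ge> 1" using IH by auto
      moreover have "(\<Sum>i\<le>k. h p ^ i) \<ge> 1" using G k by auto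
      ultimately have "1 * 1 \<le> (\<Sum>i\<le>k. h p ^ i) * (\<Sum>d | d dvd m. h d)" by (intro mult_mono) auto
      then show ?thesis using D True by simp
    next
      case False
      have "(\<Sum>d | d dvd m. h d) \<ge> 0" "(\<Sum>i\<le>k. h p ^ i) \<ge> 0"
        using IH G by (auto split: if_splits)
      then show ?thesis using D False by simp
    qed
  qed
qed

text \<open>The inequality of arithmetic and geometric means for the terms with exponents
  \<open>i\<close> and \<open>n - i\<close>. It gives the lower bound for
  \<open>1 + t + ... + t ^ n\<close> with \<open>t = s\<^sup>2\<close> that makes the Lambert
  coefficients monotone.\<close>

lemma sum_even_powers_ge:
  fixes s :: real
  assumes "s \<ge> 0"
  shows "(\<Sum>i<Suc n. (s ^ 2) ^ i) \<ge> real (Suc n) * s ^ n"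
proof -
  have "(\<Sum>i<Suc n. (s ^ 2) ^ i) = (\<Sum>i<Suc n. (s ^ 2) ^ (n - i))"
    by (subst sum.nat_diff_reindex[symmetric]) simp
  then have "2 * (\<Sum>i<Suc n. (s ^ 2) ^ i) = (\<Sum>i<Suc n. (s ^ 2) ^ i + (s ^ 2) ^ (n - i))"
    by (simp only: sum.distrib)
  also have "\<dots> \<ge> (\<Sum>i<Suc n. 2 * s ^ n)"
  proof (rule sum_mono)
    fix i assume "i \<in> {..<Suc n}"
    then have "s ^ n = s ^ i * s ^ (n - i)" by (simp flip: power_add)
    then show "2 * s ^ n \<le> (s ^ 2) ^ i + (s ^ 2) ^ (n - i)"
      using sum_squares_bound[of "s ^ i" "s ^ (n - i)"]
      by (simp only: power_mult[symmetric] mult.commute[of 2] mult.assoc)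
  qed
  finally show ?thesis by simp
qed

text \<open>If \<open>L(1, c) = 0\<close>, the pole \<open>1 / (n (1 - t))\<close> of the Lambert kernel contributes nothing, and the
  remaining coefficients decrease in \<open>n\<close>; so the Lambert series of \<open>c\<close> stays bounded as \<open>t\<close> tends
  to \<open>1\<close>, although for a real character it dominates \<open>\<Sum>q. t ^ q\<^sup>2\<close>.\<close>

definition lambert_rest :: "real \<Rightarrow> nat \<Rightarrow> real" where
  "lambert_rest t n = 1 / (real n * (1 - t)) - t ^ n / (1 - t ^ n)"

text \<open>Put \<open>X n = 1 + t + ... + t ^ (n - 1)\<close>. From
  \<open>X (Suc n) = 1 + t * X n\<close> the decrease becomes
  \<open>t ^ n / (X n * X (Suc n)) \<le> 1 / (n * (n + 1))\<close>. The bounds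
  \<open>X n \<ge> n * s ^ (n - 1)\<close> and \<open>X (Suc n) \<ge> (n + 1) * s ^ n\<close> with
  \<open>s = sqrt t\<close> yield this.\<close>

lemma lambert_rest_decreasing:
  assumes t: "0 < t" "t < 1" and n: "n > 0"
  shows "lambert_rest t (Suc n) \<le> lambert_rest t n" "lambert_rest t n \<ge> 0"
proof -
  define s where "s = sqrt t"
  have s: "0 < s" "s < 1" "s ^ 2 = t" using t by (auto simp: s_def)
  define X where "X k = (\<Sum>i<k. t ^ i)" for k
  have X: "1 - t ^ k = (1 - t) * X k" for k unfolding X_def by (rule one_diff_power_eq)
  have Xn: "X n \<ge> real n * s ^ (n - 1)" "X (Suc n) \<ge> real (Suc n) * s ^ n"
    using sum_even_powers_ge[of s "n - 1"] sum_even_powers_ge[of s n] s n by (simp_all add: X_def)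
  have Xpos: "X n > 0" "X (Suc n) > 0"
    using Xn s n by (auto intro: less_le_trans[rotated])
  have XS: "X (Suc n) = 1 + t * X n"
    unfolding X_def by (subst sum.lessThan_Suc_shift) (simp add: sum_distrib_left)
  have r: "lambert_rest t k = (1 / real k - t ^ k / X k) / (1 - t)" for k
    unfolding lambert_rest_def X using t by (simp add: diff_divide_distrib mult.commute)
  have sn: "s ^ n * s ^ n = t ^ n" by (metis power_mult_distrib power2_eq_square s(3))
  have sn1: "s ^ n \<le> s ^ (n - 1)" using s by (intro power_decreasing) auto
  have prod: "X n * X (Suc n) \<ge> real n * real (Suc n) * t ^ n"
  proof -
    have "real n * real (Suc n) * t ^ n = (real n * s ^ n) * (real (Suc n) * s ^ n)"
      by (simp flip: sn)
    also have "\<dots> \<le> (real n * s ^ (n - 1)) * (real (Suc n) * s ^ n)"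
      using sn1 s by (intro mult_right_mono mult_left_mono) auto
    also have "\<dots> \<le> X n * X (Suc n)" using Xn Xpos s by (intro mult_mono) auto
    finally show ?thesis .
  qed
  have "t ^ n / X n - t ^ Suc n / X (Suc n) = t ^ n * (X (Suc n) - t * X n) / (X n * X (Suc n))"
    using Xpos by (simp add: field_simps)
  also have "\<dots> = t ^ n / (X n * X (Suc n))" by (simp add: XS)
  also have "\<dots> \<le> t ^ n / (real n * real (Suc n) * t ^ n)"
    using prod Xpos t n by (intro divide_left_mono mult_pos_pos) auto
  also have "\<dots> = 1 / (real n * real (Suc n))" using t by (subst nonzero_divide_mult_cancel_right) auto
  also have "\<dots> = 1 / real n - 1 / real (Suc n)" using n by (simp add: field_simps)
  finally show "lambert_rest t (Suc n) \<le> lambert_rest t n"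
    unfolding r using t by (intro divide_right_mono) auto
  have "real n * t ^ n \<le> real n * s ^ (n - 1)"
  proof -
    have "t ^ n \<le> s ^ n * 1" unfolding sn[symmetric] using s by (intro mult_left_mono power_le_one) auto
    then show ?thesis using sn1 by (intro mult_left_mono) auto
  qed
  then have "real n * t ^ n \<le> X n" using Xn(1) by linarith
  then have "t ^ n / X n \<le> 1 / real n" using Xpos n by (simp add: field_simps)
  then show "lambert_rest t n \<ge> 0" unfolding r using t by (intro divide_nonneg_pos) auto
qed

text \<open>The error of cutting the geometric series of ratio \<open>t ^ d\<close> at the multiples
  up to \<open>N\<close>. It is bounded uniformly in \<open>d\<close>, so the total over
  \<open>d \<le> N\<close> tends to 0 for fixed \<open>t\<close>.\<close>

lemma lambert_partial_error:
  assumes t: "0 < t" "t < (1::real)" and d: "d \<ge> 1" "N \<ge> 1"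
  shows "\<bar>t ^ d / (1 - t ^ d) - (\<Sum>m=1..N div d. t ^ (d * m))\<bar> \<le> t ^ N / (1 - t)"
proof -
  define y where "y = t ^ d"
  have yt: "y \<le> t" unfolding y_def using t d by (metis less_imp_le power_decreasing power_one_right)
  have y: "0 < y" "y < 1" using t yt by (auto simp: y_def)
  have "(\<Sum>m=1..K. y ^ m) = y / (1 - y) - y ^ Suc K / (1 - y)" for K
  proof (induction K)
    case (Suc K)
    have "(\<Sum>m=1..Suc K. y ^ m) = y / (1 - y) - y ^ Suc K / (1 - y) + y ^ Suc K" using Suc by simp
    also have "\<dots> = y / (1 - y) - (y ^ Suc K - y ^ Suc K * (1 - y)) / (1 - y)"
      using y by (simp add: diff_divide_distrib)
    also have "y ^ Suc K - y ^ Suc K * (1 - y) = y ^ Suc (Suc K)" by (simp add: algebra_simps)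
    finally show ?case .
  qed (use y in simp)
  then have "(\<Sum>m=1..N div d. t ^ (d * m)) = y / (1 - y) - y ^ Suc (N div d) / (1 - y)"
    by (simp add: y_def power_mult)
  then have "\<bar>t ^ d / (1 - t ^ d) - (\<Sum>m=1..N div d. t ^ (d * m))\<bar> = y ^ Suc (N div d) / (1 - y)"
    using y by (simp add: y_def[symmetric])
  also have "\<dots> \<le> t ^ N / (1 - t)"
  proof (rule frac_le)
    have "N \<le> d * Suc (N div d)" using d
      by (metis dividend_less_times_div less_imp_le mult.commute mult_Suc_right zero_less_one less_le_trans)
    then show "y ^ Suc (N div d) \<le> t ^ N"
      unfolding y_def power_mult[symmetric] using t by (intro power_decreasing) auto
  qed (use t y yt in auto)
  finally show ?thesis .
qed

lemma lval_real_nonzero: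
  assumes s: "s > 0" and c: "c \<in> dchars s" "c \<noteq> dchar0 s" and re: "\<And>n. cnj (c n) = c n"
  shows "lval c \<noteq> 0"
proof
  assume L0: "lval c = 0"
  define h where "h n = Re (c n)" for n
  have ch: "c n = of_real (h n)" for n
    using re[of n] by (simp add: h_def complex_eq_iff)
  have h1: "h 1 = 1" using dcharsD(1)[OF c(1)] by (simp add: h_def)
  have hm: "h (m * n) = h m * h n" for m n
    using dcharsD(2)[OF c(1), of m n] unfolding ch by (simp flip: of_real_mult)
  have hv: "h n = -1 \<or> h n = 0 \<or> h n = 1" for n
    using dchars_norm[OF c(1) s, of n] unfolding ch by (auto split: if_splits)
  have hb: "\<bar>h n\<bar> \<le> 1" for n using hv[of n] by auto
  have hs: "norm (\<Sum>n=1..k. h n) \<le> 2 * real s" for k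
    using dchars_sum_bound[OF s c, of k] unfolding ch by (simp flip: of_real_sum)
  \<comment> \<open>By Bernoulli's inequality this \<open>t\<close> satisfies
    \<open>t ^ (K\<^sup>2) \<ge> 1 / 2\<close>. The \<open>K\<close> squares up to
    \<open>K\<^sup>2\<close> then contribute at least \<open>K / 2 = 4 * s + 3\<close>, more than
    the upper bound, which comes arbitrarily close to \<open>4 * s\<close>.\<close>
  define K where "K = 8 * s + 6"
  define t where "t = 1 - 1 / (2 * real (K ^ 2))"
  have K: "K > 0" by (simp add: K_def)
  then have KK: "real (K ^ 2) \<ge> 1" by (simp add: Suc_le_eq)
  have half: "0 < 1 / (2 * R) \<and> 1 / (2 * R) < 1 \<and> R * (- (1 / (2 * R))) = - 1 / 2" if "R \<ge> 1" for R :: real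
    using that by (auto simp: field_simps)
  have t: "0 < t" "t < 1" using half[OF KK] unfolding t_def by linarith+
  have tK: "t ^ (K ^ 2) \<ge> 1 / 2"
  proof -
    have "1 + real (K ^ 2) * (t - 1) \<le> t ^ (K ^ 2)"
      using Bernoulli_inequality[of "t - 1" "K ^ 2"] t by simp
    moreover have "real (K ^ 2) * (t - 1) = - 1 / 2"
      using half[OF KK] unfolding t_def by simp
    ultimately show ?thesis by linarith
  qed
  define F where "F N = (\<Sum>n=1..N. (\<Sum>d | d dvd n. h d) * t ^ n)" for N
  \<comment> \<open>For fixed \<open>t\<close> the first term (partial sum of a vanishing L-value)
    and the third (truncation) tend to 0 with \<open>N\<close>; only the Abel bound for
    \<open>lambert_rest\<close> stays, and it does not depend on \<open>t\<close>.\<close>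
  have upper: "F N \<le> 4 * real s / (real (Suc N) * (1 - t)) + 4 * real s + real N * (t ^ N / (1 - t))"
      if N: "N \<ge> 1" for N
  proof -
    have "F N = (\<Sum>n=1..N. \<Sum>d | d dvd n. h d * t ^ n)"
      unfolding F_def by (simp only: sum_distrib_right)
    also have "\<dots> = (\<Sum>d=1..N. \<Sum>m=1..N div d. h d * t ^ (d * m))"
      by (rule sum_divisors_swap)
    also have "\<dots> = (\<Sum>d=1..N. h d * (\<Sum>m=1..N div d. t ^ (d * m)))"
      by (simp only: sum_distrib_left)
    also have "\<dots> = (\<Sum>d=1..N. h d / real d) / (1 - t) - (\<Sum>d=1..N. lambert_rest t d * h d)
        - (\<Sum>d=1..N. h d * (t ^ d / (1 - t ^ d) - (\<Sum>m=1..N div d. t ^ (d * m))))"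
      unfolding sum_divide_distrib sum_subtractf[symmetric]
      by (intro sum.cong refl) (simp add: lambert_rest_def algebra_simps)
    also have "\<dots> \<le> 4 * real s / real (Suc N) / (1 - t) + 4 * real s + real N * (t ^ N / (1 - t))"
    proof -
      have "lpart c N = of_real (\<Sum>d=1..N. h d / real d)" by (simp add: lpart_def ch)
      then have "\<bar>\<Sum>d=1..N. h d / real d\<bar> = norm (lpart c N - lval c)" by (simp add: L0 del: of_real_sum)
      also have "\<dots> \<le> 4 * real s / real (Suc N)" by (rule lval_diff[OF s c])
      finally have "(\<Sum>d=1..N. h d / real d) \<le> 4 * real s / real (Suc N)" by linarith
      then have 1: "(\<Sum>d=1..N. h d / real d) / (1 - t) \<le> 4 * real s / real (Suc N) / (1 - t)"
        using t by (intro divide_right_mono) auto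
      have "norm (\<Sum>d\<in>{0<..N}. lambert_rest t d *\<^sub>R h d) \<le> 2 * (2 * real s) * lambert_rest t (Suc 0)"
        using lambert_rest_decreasing[OF t] by (intro abel_bound hs) auto
      also have "lambert_rest t (Suc 0) = 1" using t by (simp add: lambert_rest_def flip: diff_divide_distrib)
      also have "{0<..N} = {1..N}" by auto
      finally have 2: "- (\<Sum>d=1..N. lambert_rest t d * h d) \<le> 4 * real s" by simp
      have "\<bar>\<Sum>d=1..N. h d * (t ^ d / (1 - t ^ d) - (\<Sum>m=1..N div d. t ^ (d * m)))\<bar>
         \<le> (\<Sum>d=1..N. \<bar>h d * (t ^ d / (1 - t ^ d) - (\<Sum>m=1..N div d. t ^ (d * m)))\<bar>)" by (rule sum_abs)
      also have "\<dots> \<le> (\<Sum>d=1..N. 1 * (t ^ N / (1 - t)))"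
        unfolding abs_mult using lambert_partial_error[OF t] hb N by (intro sum_mono mult_mono) auto
      finally have 3: "\<bar>\<Sum>d=1..N. h d * (t ^ d / (1 - t ^ d) - (\<Sum>m=1..N div d. t ^ (d * m)))\<bar>
         \<le> real N * (t ^ N / (1 - t))" by simp
      show ?thesis using 1 2 3 by linarith
    qed
    finally show ?thesis by (simp only: divide_divide_eq_left)
  qed
  have lower: "F N \<ge> 4 * real s + 3" if N: "N \<ge> K ^ 2" for N
  proof -
    have r: "(\<Sum>d | d dvd n. h d) \<ge> (if \<exists>q. n = q ^ 2 then 1 else 0)" if "n > 0" for n
      using h1 hm hv that by (rule sum_real_char_divisors)
    have r0: "(\<Sum>d | d dvd n. h d) \<ge> 0" if "n > 0" for n
      using r[OF that] by (auto split: if_splits)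
    have "4 * real s + 3 = real K * (1 / 2)" by (simp add: K_def)
    also have "\<dots> \<le> (\<Sum>q=1..K. t ^ (K ^ 2))" using tK K by simp
    also have "\<dots> \<le> (\<Sum>q=1..K. (\<Sum>d | d dvd q ^ 2. h d) * t ^ (q ^ 2))"
    proof (rule sum_mono)
      fix q assume q: "q \<in> {1..K}"
      have "(\<Sum>d | d dvd q ^ 2. h d) \<ge> 1" using r[of "q ^ 2"] q by auto
      moreover have "t ^ (K ^ 2) \<le> t ^ (q ^ 2)" using q t by (intro power_decreasing power_mono) auto
      ultimately have "1 * t ^ (K ^ 2) \<le> (\<Sum>d | d dvd q ^ 2. h d) * t ^ (q ^ 2)"
        using t by (intro mult_mono) auto
      then show "t ^ (K ^ 2) \<le> (\<Sum>d | d dvd q ^ 2. h d) * t ^ (q ^ 2)" by simp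
    qed
    also have "\<dots> = (\<Sum>n\<in>(\<lambda>q. q ^ 2) ` {1..K}. (\<Sum>d | d dvd n. h d) * t ^ n)"
      by (subst sum.reindex) (auto simp: inj_on_def)
    also have "\<dots> \<le> F N"
      unfolding F_def
    proof (rule sum_mono2)
      show "(\<lambda>q. q ^ 2) ` {1..K} \<subseteq> {1..N}"
        using N by (auto simp: Suc_le_eq intro: order_trans[OF power_mono])
    qed (use r0 t in auto)
    finally show ?thesis .
  qed
  have lim: "(\<lambda>N. 4 * real s / (real (Suc N) * (1 - t)) + real N * (t ^ N / (1 - t))) \<longlonglongrightarrow> 0"
    using t by real_asymp
  then have "\<forall>\<^sub>F N in sequentially. 4 * real s / (real (Suc N) * (1 - t)) + real N * (t ^ N / (1 - t)) < 1"
    by (intro order_tendstoD) auto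
  then have "\<forall>\<^sub>F N in sequentially. 4 * real s / (real (Suc N) * (1 - t)) + real N * (t ^ N / (1 - t)) < 1 \<and>
      N \<ge> max 1 (K ^ 2)"
    by (intro eventually_conj eventually_ge_at_top)
  then obtain N where "4 * real s / (real (Suc N) * (1 - t)) + real N * (t ^ N / (1 - t)) < 1" "N \<ge> 1" "N
      \<ge> K ^ 2"
    by (auto simp: eventually_sequentially)
  then show False using upper[of N] lower[of N] by linarith
qed

lemma lval_cnj:
  assumes "s > 0" "c \<in> dchars s" "c \<noteq> dchar0 s"
  shows "lval (\<lambda>n. cnj (c n)) = cnj (lval c)"
proof -
  have "lpart (\<lambda>n. cnj (c n)) = (\<lambda>N. cnj (lpart c N))" by (simp add: lpart_def fun_eq_iff)
  moreover have "(\<lambda>N. cnj (lpart c N)) \<longlonglongrightarrow> cnj (lval c)"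
    by (intro tendsto_cnj lpart_tendsto[OF assms])
  ultimately show ?thesis unfolding lval_def[of "\<lambda>n. cnj (c n)"] by (simp add: limI)
qed

section \<open>Dirichlet's theorem in Mertens' form\<close>

definition mangoldt_class :: "nat \<Rightarrow> nat \<Rightarrow> real" where
  "mangoldt_class s N = (\<Sum>n | 1 \<le> n \<and> n \<le> N \<and> [n = 1] (mod s). mangoldt n / real n)"

lemma sum_mpart:
  assumes "s > 0"
  shows "(\<Sum>c\<in>dchars s. mpart c N) = of_real (real (card (dchars s)) * mangoldt_class s N)"
proof -
  have "(\<Sum>c\<in>dchars s. mpart c N) = (\<Sum>n=1..N. \<Sum>c\<in>dchars s. mangoldt n * c n / of_nat n)"
    unfolding mpart_def by (rule sum.swap)
  also have "\<dots> = (\<Sum>n=1..N. mangoldt n / of_nat n * (\<Sum>c\<in>dchars s. c n))"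
    by (simp add: sum_distrib_left)
  also have "\<dots> = (\<Sum>n=1..N. if [n
      = 1] (mod s) then of_real (real (card (dchars s)) * (mangoldt n / real n)) else 0)"
    unfolding sum_dchars[OF assms] by (intro sum.cong refl) simp
  also have "\<dots> = (\<Sum>n | n \<in> {1..N} \<and>
      [n = 1] (mod s). of_real (real (card (dchars s)) * (mangoldt n / real n)))"
    by (rule sum.inter_filter[symmetric]) simp
  also have "\<dots> = of_real (real (card (dchars s)) * mangoldt_class s N)"
    unfolding mangoldt_class_def by (simp add: sum_distrib_left conj_assoc)
  finally show ?thesis .
qed

lemma mpart_principal_upper:
  assumes "N > 0"
  shows "Re (mpart (dchar0 s) N) \<le> ln (real N) + 4"
proof -
  have "Re (mpart (dchar0 s) N) = (\<Sum>n=1..N. if coprime n s then mangoldt n / real n else 0)"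
    unfolding mpart_def Re_sum
    by (intro sum.cong refl) (simp add: dchar0_def Re_divide_of_nat)
  also have "\<dots> \<le> (\<Sum>n=1..N. mangoldt n / real n)"
    by (intro sum_mono) (auto simp: mangoldt_nonneg)
  finally show ?thesis using mertens_mangoldt[OF assms] by linarith
qed

lemma mpart_dichotomy:
  assumes "s > 0" "c \<in> dchars s" "c \<noteq> dchar0 s"
  shows "\<exists>K. \<forall>N>0. norm (mpart c N + (if lval c = 0 then of_real (ln (real N)) else 0)) \<le> K"
proof (cases "lval c = 0")
  case True
  then show ?thesis using mpart_lval_zero[OF assms] by (auto simp: add.commute)
next
  case False
  define K where "K = (6 + 4 * real s * ln 4 + 16 * real s) / norm (lval c)"
  have "norm (mpart c N) \<le> K" if "N > 0" for N
    using mpart_lval_bound[OF assms that] False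
    by (simp add: K_def norm_mult pos_le_divide_eq mult.commute)
  then show ?thesis using False by auto
qed

text \<open>Orthogonality expresses the sum over the class of 1 through all
  \<open>mpart c N\<close>. A nonprincipal character contributes a bounded amount, or
  \<open>- ln N\<close> up to a bounded amount if its L-value vanishes; keeping the number of the
  latter in the statement makes it usable before nonvanishing is known.\<close>

lemma sum_nonprincipal_mpart:
  assumes "s > 0"
  shows "\<exists>K. \<forall>N>0. \<bar>real (card (dchars s)) * mangoldt_class s N - Re (mpart (dchar0 s) N)
     + real (card {c \<in> dchars s - {dchar0 s}. lval c = 0}) * ln (real N)\<bar> \<le> K"
proof -
  define D where "D = dchars s - {dchar0 s}"
  have fin: "finite D" using finite_dchars[OF assms] by (simp add: D_def)
  have "\<forall>c\<in>D. \<exists>K. \<forall>N>0. norm (mpart c N + (if lval c = 0 then of_real (ln (real N)) else 0)) \<le> K"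
    using mpart_dichotomy[OF assms] unfolding D_def by blast
  from bchoice[OF this] obtain K where "\<forall>c\<in>D. \<forall>N>0.
      norm (mpart c N + (if lval c = 0 then of_real (ln (real N)) else 0)) \<le> K c" ..
  then have K: "\<And>c N. c \<in> D \<Longrightarrow> N > 0 \<Longrightarrow>
      norm (mpart c N + (if lval c = 0 then of_real (ln (real N)) else 0)) \<le> K c"
    by blast
  have "\<bar>real (card (dchars s)) * mangoldt_class s N - Re (mpart (dchar0 s) N)
     + real (card {c \<in> D. lval c = 0}) * ln (real N)\<bar> \<le> (\<Sum>c\<in>D. K c)" if N: "N > 0" for N
  proof -
    have "(\<Sum>c\<in>D. mpart c N + (if lval c = 0 then of_real (ln (real N)) else 0))
        = (\<Sum>c\<in>D. mpart c N) + (\<Sum>c\<in>D. if lval c = 0 then of_real (ln (real N)) else 0)"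
      by (rule sum.distrib)
    also have "(\<Sum>c\<in>D. mpart c N) = (\<Sum>c\<in>dchars s. mpart c N) - mpart (dchar0 s) N"
      unfolding D_def using finite_dchars[OF assms] dchar0_in by (simp add: sum_diff1)
    also have "(\<Sum>c\<in>D. if lval c = 0 then of_real (ln (real N)) else 0)
        = (\<Sum>c\<in>{c \<in> D. lval c = 0}. of_real (ln (real N)) :: complex)"
      using fin by (rule sum.inter_filter[symmetric])
    finally have eq: "(\<Sum>c\<in>D. mpart c N + (if lval c = 0 then of_real (ln (real N)) else 0))
       = of_real (real (card (dchars s)) * mangoldt_class s N) - mpart (dchar0 s) N
         + of_real (real (card {c \<in> D. lval c = 0}) * ln (real N))"
      by (simp add: sum_mpart[OF assms])
    have "\<bar>real (card (dchars s)) * mangoldt_class s N - Re (mpart (dchar0 s) N)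
     + real (card {c \<in> D. lval c = 0}) * ln (real N)\<bar>
      = \<bar>Re (\<Sum>c\<in>D. mpart c N + (if lval c = 0 then of_real (ln (real N)) else 0))\<bar>"
      unfolding eq by simp
    also have "\<dots> \<le> norm (\<Sum>c\<in>D. mpart c N + (if lval c = 0 then of_real (ln (real N)) else 0))"
      by (rule abs_Re_le_cmod)
    also have "\<dots> \<le> (\<Sum>c\<in>D. K c)"
      using K[OF _ N] by (intro sum_norm_le) auto
    finally show ?thesis .
  qed
  then show ?thesis unfolding D_def by blast
qed

lemma mangoldt_class_nonneg: "mangoldt_class s N \<ge> 0"
  unfolding mangoldt_class_def by (intro sum_nonneg divide_nonneg_nonneg mangoldt_nonneg) auto

text \<open>A character with \<open>L(1, c) = 0\<close> contributes \<open>- ln N\<close> to a nonnegative sum whose principal term is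
  only \<open>ln N\<close>. So there is at most one, and since its conjugate is another one, it is real.\<close>

theorem lval_nonzero:
  assumes "s > 0" "c \<in> dchars s" "c \<noteq> dchar0 s"
  shows "lval c \<noteq> 0"
proof
  assume L0: "lval c = 0"
  define V where "V = {c \<in> dchars s - {dchar0 s}. lval c = 0}"
  define c' where "c' = (\<lambda>n. cnj (c n))"
  have cV: "c \<in> V" using assms L0 by (simp add: V_def)
  have "c' \<noteq> dchar0 s"
  proof
    assume "c' = dchar0 s"
    then have "cnj (c n) = dchar0 s n" for n by (metis c'_def)
    then have "c n = dchar0 s n" for n
      using complex_cnj_cnj[of "c n"] by (simp add: dchar0_def split: if_splits)
    then show False using assms(3) by blast
  qed
  then have c'V: "c' \<in> V"
    using dchars_cnj[OF assms(2)] lval_cnj[OF assms] L0 by (simp add: V_def c'_def)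
  have "c' \<noteq> c"
  proof
    assume "c' = c"
    then have "cnj (c n) = c n" for n by (metis c'_def)
    then show False using lval_real_nonzero[OF assms] L0 by blast
  qed
  then have "card {c, c'} = 2" by simp
  moreover have "finite V" using finite_dchars[OF assms(1)] by (simp add: V_def)
  then have "card {c, c'} \<le> card V" using cV c'V by (intro card_mono) auto
  ultimately have V2: "real (card V) \<ge> 2" by simp
  obtain K where K: "\<And>N. N > 0 \<Longrightarrow> \<bar>real (card (dchars s)) * mangoldt_class s N - Re (mpart (dchar0 s) N)
     + real (card V) * ln (real N)\<bar> \<le> K"
    using sum_nonprincipal_mpart[OF assms(1)] unfolding V_def by blast
  obtain N :: nat where N: "exp (K + 5) < real N" using reals_Archimedean2 by blast
  have "0 < real N" by (rule less_trans[OF exp_gt_zero N])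
  then have N0: "N > 0" by simp
  have "ln (exp (K + 5)) < ln (real N)" using N N0 by (subst ln_less_cancel_iff) auto
  then have lnN: "ln (real N) > K + 5" by simp
  have "real N \<ge> 1" using N0 by simp
  then have ln0: "ln (real N) \<ge> 0" by simp
  have "2 * ln (real N) \<le> real (card V) * ln (real N)" using V2 ln0 by (intro mult_right_mono) auto
  moreover have "0 \<le> real (card (dchars s)) * mangoldt_class s N"
    by (intro mult_nonneg_nonneg mangoldt_class_nonneg) auto
  ultimately show False using K[OF N0] mpart_principal_upper[OF N0, of s] lnN by linarith
qed

text \<open>For each prime the powers from \<open>k0\<close> on form a geometric series with ratio
  at most 1/2, hence at most twice the first term. It is applied with \<open>k0 = 2\<close> to
  proper prime powers and with \<open>k0 = 1\<close> to the primes dividing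
  \<open>s\<close>.\<close>

lemma sum_mangoldt_prime_powers_le:
  assumes P: "finite P" "\<And>p. p \<in> P \<Longrightarrow> prime p"
    and S: "finite S" "\<And>n. n \<in> S \<Longrightarrow> primepow n \<Longrightarrow> \<exists>p\<in>P. \<exists>k\<in>{k0..N}. n = p ^ k"
    and k0: "k0 > 0"
  shows "(\<Sum>n\<in>S. mangoldt n / real n) \<le> (\<Sum>p\<in>P. 2 * ln (real p) / real p ^ k0)"
proof -
  define F where "F = (\<lambda>(p, k). p ^ k :: nat)"
  have nn: "mangoldt n / real n \<ge> 0" for n by (simp add: mangoldt_nonneg)
  have "(\<Sum>n\<in>S. mangoldt n / real n) = (\<Sum>n\<in>{n \<in> S. primepow n}. mangoldt n / real n)"
    using S by (intro sum.mono_neutral_right) (auto simp: mangoldt_def)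
  also have "\<dots> \<le> (\<Sum>n\<in>F ` (P \<times> {k0..N}). mangoldt n / real n)"
  proof (rule sum_mono2)
    show "{n \<in> S. primepow n} \<subseteq> F ` (P \<times> {k0..N})"
    proof
      fix n assume "n \<in> {n \<in> S. primepow n}"
      then have "\<exists>p\<in>P. \<exists>k\<in>{k0..N}. n = p ^ k" using S(2) by simp
      then obtain p k where "p \<in> P" "k \<in> {k0..N}" "n = F (p, k)" unfolding F_def by auto
      then show "n \<in> F ` (P \<times> {k0..N})" by blast
    qed
  qed (use P nn in auto)
  also have "\<dots> \<le> sum ((\<lambda>n. mangoldt n / real n) \<circ> F) (P \<times> {k0..N})"
    using P nn by (intro sum_image_le) auto
  also have "\<dots> = (\<Sum>p\<in>P. \<Sum>k=k0..N. mangoldt (p ^ k) / real (p ^ k))"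
    unfolding sum.cartesian_product by (intro sum.cong refl) (auto simp: F_def)
  also have "\<dots> \<le> (\<Sum>p\<in>P. 2 * ln (real p) / real p ^ k0)"
  proof (rule sum_mono)
    fix p assume p: "p \<in> P"
    then have p2: "real p \<ge> 2" using P(2) prime_ge_2_nat by force
    define x where "x = inverse (real p)"
    have x: "0 < x" "x \<le> 1 / 2" using p2 by (auto simp: x_def field_simps)
    \<comment> \<open>The subtracted term \<open>x ^ M\<close> makes the induction close: since
      \<open>x \<le> 1 / 2\<close>, it pays for the next summand and its own replacement.\<close>
    have geo: "(\<Sum>k=k0..M. x ^ k) \<le> 2 * x ^ k0 - x ^ M" if "M \<ge> k0" for M
      using that
    proof (induction M rule: dec_induct)
      case base
      then show ?case by simp
    next
      case (step M)
      have "x * x ^ M \<le> 1 / 2 * x ^ M" using x by (intro mult_right_mono) auto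
      then show ?case using step by simp
    qed
    have "(\<Sum>k=k0..N. x ^ k) \<le> 2 * x ^ k0"
    proof (cases "N \<ge> k0")
      case True
      then show ?thesis using geo[OF True] zero_less_power[OF x(1), of N] by linarith
    qed (use x in simp)
    then have "ln (real p) * (\<Sum>k=k0..N. x ^ k) \<le> ln (real p) * (2 * x ^ k0)"
      using p2 by (intro mult_left_mono) auto
    moreover have "(\<Sum>k=k0..N. mangoldt (p ^ k) / real (p ^ k)) = ln (real p) * (\<Sum>k=k0..N. x ^ k)"
      unfolding sum_distrib_left
      using P(2)[OF p] k0 by (intro sum.cong refl) (simp add: x_def power_inverse divide_inverse)
    ultimately show "(\<Sum>k=k0..N. mangoldt (p ^ k) / real (p ^ k)) \<le> 2 * ln (real p) / real p ^ k0"
      by (simp add: x_def power_inverse divide_inverse mult_ac)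
  qed
  finally show ?thesis .
qed

lemma ln_le_2_sqrt: "x > 0 \<Longrightarrow> ln x \<le> 2 * sqrt (x::real)"
  using ln_le_minus_one[of "sqrt x"] by (simp add: ln_sqrt)

lemma sum_mangoldt_nonprime_bounded:
  "\<exists>E. \<forall>N. (\<Sum>n | 1 \<le> n \<and> n \<le> N \<and> \<not> prime n. mangoldt n / real n) \<le> E"
proof -
  define w where "w p = real p powr (-3/2)" for p
  have sw: "summable w" unfolding w_def by (subst summable_real_powr_iff) simp
  have "(\<Sum>n | 1 \<le> n \<and> n \<le> N \<and> \<not> prime n. mangoldt n / real n) \<le> 4 * suminf w" for N
  proof -
    have "(\<Sum>n | 1 \<le> n \<and> n \<le> N \<and> \<not> prime n. mangoldt n / real n)
        \<le> (\<Sum>p | p \<le> N \<and> prime p. 2 * ln (real p) / real p ^ 2)"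
    proof (rule sum_mangoldt_prime_powers_le[where N = N])
      fix n assume n: "n \<in> {n. 1 \<le> n \<and> n \<le> N \<and> \<not> prime n}" "primepow n"
      then obtain p k where pk: "prime p" "k > 0" "n = p ^ k" by (auto simp: primepow_def)
      have "k \<noteq> 1" using n pk by auto
      then have k: "k \<ge> 2" using pk by simp
      have "p \<le> p ^ k" using pk by (intro self_le_power prime_ge_1_nat) auto
      moreover have "k \<le> p ^ k" using power_gt_expt[of p k] prime_gt_1_nat[OF pk(1)] by simp
      ultimately show "\<exists>p\<in>{p. p \<le> N \<and> prime p}. \<exists>k\<in>{2..N}. n = p ^ k"
        using n pk k by (intro bexI[of _ p] bexI[of _ k]) auto
    qed auto
    also have "\<dots> \<le> (\<Sum>p | p \<le> N \<and> prime p. 4 * w p)"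
    proof (rule sum_mono)
      fix p assume "p \<in> {p. p \<le> N \<and> prime p}"
      then have p: "real p > 0" by (auto simp: prime_gt_0_nat)
      have "2 * ln (real p) / real p ^ 2 \<le> 2 * (2 * sqrt (real p)) / real p ^ 2"
        using ln_le_2_sqrt[OF p] by (intro divide_right_mono mult_left_mono) auto
      also have "\<dots> = 4 * (real p powr (1/2) / real p powr 2)"
        using p by (simp add: powr_half_sqrt)
      also have "\<dots> = 4 * w p" unfolding w_def powr_diff[symmetric] by simp
      finally show "2 * ln (real p) / real p ^ 2 \<le> 4 * w p" .
    qed
    also have "\<dots> \<le> (\<Sum>p\<in>{..N}. 4 * w p)" by (intro sum_mono2) (auto simp: w_def)
    also have "\<dots> = 4 * (\<Sum>p\<in>{..N}. w p)" by (simp add: sum_distrib_left)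
    also have "\<dots> \<le> 4 * suminf w" by (intro mult_left_mono sum_le_suminf[OF sw]) (auto simp: w_def)
    finally show ?thesis .
  qed
  then show ?thesis by blast
qed

text \<open>Compared with the full Mertens sum only powers of the finitely many primes dividing
  \<open>s\<close> are missing, and their total is bounded.\<close>

lemma mpart_principal_lower:
  assumes "s > 0"
  shows "\<exists>E. \<forall>N>0. ln (real N) - E \<le> Re (mpart (dchar0 s) N)"
proof -
  define E where "E = (\<Sum>p\<in>prime_factors s. 2 * ln (real p) / real p ^ 1)"
  have "ln (real N) - (4 + E) \<le> Re (mpart (dchar0 s) N)" if N: "N > 0" for N
  proof -
    have "(\<Sum>n | n \<in> {1..N} \<and> \<not> coprime n s. mangoldt n / real n) \<le> E"
      unfolding E_def
    proof (rule sum_mangoldt_prime_powers_le[where N = N])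
      fix n assume n: "n \<in> {n. n \<in> {1..N} \<and> \<not> coprime n s}" "primepow n"
      then obtain p k where pk: "prime p" "k > 0" "n = p ^ k" by (auto simp: primepow_def)
      have "\<not> coprime p s" using n pk by auto
      then have "p dvd s" using pk prime_imp_coprime by blast
      then have "p \<in> prime_factors s" using pk assms by (simp add: prime_factors_dvd)
      moreover have "k \<le> p ^ k" using power_gt_expt[of p k] prime_gt_1_nat[OF pk(1)] by simp
      ultimately show "\<exists>p\<in>prime_factors s. \<exists>k\<in>{1..N}. n = p ^ k"
        using n pk by (intro bexI[of _ p] bexI[of _ k]) auto
    qed auto
    moreover have "(\<Sum>n | n \<in> {1..N} \<and> \<not> coprime n s. mangoldt n / real n)
        = (\<Sum>n=1..N. if \<not> coprime n s then mangoldt n / real n else 0)"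
      by (rule sum.inter_filter) simp
    moreover have "Re (mpart (dchar0 s) N) = (\<Sum>n=1..N. if coprime n s then mangoldt n / real n else 0)"
      unfolding mpart_def Re_sum
      by (intro sum.cong refl) (simp add: dchar0_def Re_divide_of_nat)
    moreover have "(\<Sum>n=1..N. if \<not> coprime n s then mangoldt n / real n else 0)
       + (\<Sum>n=1..N. if coprime n s then mangoldt n / real n else 0) = (\<Sum>n=1..N. mangoldt n / real n)"
      unfolding sum.distrib[symmetric] by (intro sum.cong refl) auto
    ultimately show ?thesis using mertens_mangoldt[OF N] by linarith
  qed
  then show ?thesis by blast
qed

definition prime_class_sum :: "nat \<Rightarrow> nat \<Rightarrow> real" where
  "prime_class_sum s N = (\<Sum>p | prime p \<and> p \<le> N \<and> [p = 1] (mod s). ln (real p) / real p)"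

text \<open>With all nonprincipal L-values different from 0, only the principal character
  contributes \<open>ln N\<close>. Division by the number of characters gives \<open>C\<close>, and
  the proper prime powers add a bounded amount.\<close>

theorem prime_class_sum_asymp:
  assumes "s > 0"
  shows "\<exists>C>0. \<exists>K. \<forall>N>0. \<bar>prime_class_sum s N - C * ln (real N)\<bar> \<le> K"
proof -
  define D where "D = real (card (dchars s))"
  have D: "D > 0" using finite_dchars[OF assms] dchar0_in[of s] by (auto simp: D_def card_gt_0_iff)
  have V: "{c \<in> dchars s - {dchar0 s}. lval c = 0} = {}" using lval_nonzero[OF assms] by auto
  obtain K1 where K1: "\<And>N. N > 0 \<Longrightarrow> \<bar>D * mangoldt_class s N - Re (mpart (dchar0 s) N)\<bar> \<le> K1"
    using sum_nonprincipal_mpart[OF assms] unfolding V D_def by auto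
  obtain E1 where E1: "\<And>N. N > 0 \<Longrightarrow> ln (real N) - E1 \<le> Re (mpart (dchar0 s) N)"
    using mpart_principal_lower[OF assms] by blast
  obtain E2 where E2: "\<And>N. (\<Sum>n | 1 \<le> n \<and> n \<le> N \<and> \<not> prime n. mangoldt n / real n) \<le> E2"
    using sum_mangoldt_nonprime_bounded by blast
  define K where "K = (\<bar>K1\<bar> + \<bar>E1\<bar> + 4) / D + E2"
  have "\<bar>prime_class_sum s N - 1 / D * ln (real N)\<bar> \<le> K" if N: "N > 0" for N
  proof -
    define A where "A = {n. 1 \<le> n \<and> n \<le> N \<and> [n = 1] (mod s)}"
    have "mangoldt_class s N = (\<Sum>n\<in>{n \<in> A. prime n}. mangoldt n / real n)
        + (\<Sum>n\<in>{n \<in> A. \<not> prime n}. mangoldt n / real n)"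
      unfolding mangoldt_class_def A_def[symmetric]
      by (subst sum.union_disjoint[symmetric]) (auto simp: A_def intro!: sum.cong)
    also have "(\<Sum>n\<in>{n \<in> A. prime n}. mangoldt n / real n) = prime_class_sum s N"
      unfolding prime_class_sum_def by (intro sum.cong) (auto simp: A_def prime_ge_Suc_0_nat)
    finally have eq: "mangoldt_class s N
        = prime_class_sum s N + (\<Sum>n\<in>{n \<in> A. \<not> prime n}. mangoldt n / real n)" .
    have "(\<Sum>n\<in>{n \<in> A. \<not> prime n}. mangoldt n / real n)
        \<le> (\<Sum>n | 1 \<le> n \<and> n \<le> N \<and> \<not> prime n. mangoldt n / real n)"
      by (intro sum_mono2) (auto simp: A_def mangoldt_nonneg)
    then have up: "(\<Sum>n\<in>{n \<in> A. \<not> prime n}. mangoldt n / real n) \<le> E2" using E2[of N] by linarith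
    have lo: "(\<Sum>n\<in>{n \<in> A. \<not> prime n}. mangoldt n / real n) \<ge> 0"
        by (intro sum_nonneg) (simp add: mangoldt_nonneg)
    have "\<bar>D * mangoldt_class s N - ln (real N)\<bar> \<le> \<bar>K1\<bar> + \<bar>E1\<bar> + 4"
      using K1[OF N] E1[OF N] mpart_principal_upper[OF N, of s] by linarith
    moreover have "D * \<bar>mangoldt_class s N - 1 / D * ln (real N)\<bar> = \<bar>D * mangoldt_class s N - ln (real N)\<bar>"
    proof -
      have "D * (mangoldt_class s N - 1 / D * ln (real N)) = D * mangoldt_class s N - ln (real N)"
        using D by (simp add: right_diff_distrib)
      moreover have "\<bar>D * x\<bar> = D * \<bar>x\<bar>" for x using D by (simp add: abs_mult)
      ultimately show ?thesis by metis
    qed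
    ultimately have "\<bar>mangoldt_class s N - 1 / D * ln (real N)\<bar> \<le> (\<bar>K1\<bar> + \<bar>E1\<bar> + 4) / D"
      using D by (simp add: pos_le_divide_eq mult.commute)
    then show ?thesis using eq up lo unfolding K_def by linarith
  qed
  then show ?thesis using D by (intro exI[of _ "1 / D"] conjI exI[of _ K]) auto
qed

theorem prime_class_window:
  assumes "s > 0"
  shows "\<exists>K>0. \<forall>u\<ge>1. (\<Sum>p\<in>log_window (\<lambda>p. [p = 1] (mod s)) u (u + K). ln (real p) / real p) \<ge> 1"
proof -
  obtain C B where C: "C > 0" and B: "\<And>N. N > 0 \<Longrightarrow> \<bar>prime_class_sum s N - C * ln (real N)\<bar> \<le> B"
    using prime_class_sum_asymp[OF assms] by blast
  have B0: "B \<ge> 0" using B[of 1] by auto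
  \<comment> \<open>The growth \<open>C * (K - 1) = 2 * B + 1\<close> exceeds the two error terms
    \<open>B\<close> by 1. The summand 1 of \<open>K\<close> pays for rounding
    \<open>exp (u + K)\<close> down to an integer.\<close>
  define K where "K = 1 + (2 * B + 1) / C"
  have K: "K > 1" "C * (K - 1) = 2 * B + 1" using C B0 by (auto simp: K_def)
  have "(\<Sum>p\<in>log_window (\<lambda>p. [p = 1] (mod s)) u (u + K). ln (real p) / real p) \<ge> 1" if u: "u \<ge> 1" for u
  proof -
    define M N where "M = nat \<lfloor>exp u\<rfloor>" and "N = nat \<lfloor>exp (u + K)\<rfloor>"
    have "real M = of_int \<lfloor>exp u\<rfloor>" "real N = of_int \<lfloor>exp (u + K)\<rfloor>"
      by (simp_all add: M_def N_def)
    then have M: "real M \<le> exp u" "exp u < real M + 1"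
        and N: "real N \<le> exp (u + K)" "exp (u + K) < real N + 1"
      by linarith+
    have e1: "exp u \<ge> 2" "exp (u + K) \<ge> 2"
      using exp_ge_add_one_self[of u] exp_ge_add_one_self[of "u + K"] u K by linarith+
    have M0: "M > 0" using M e1 by linarith
    have MN: "M \<le> N" unfolding M_def N_def using K by (intro nat_mono floor_mono) auto
    have "ln (real M) \<le> ln (exp u)" using M M0 by (subst ln_le_cancel_iff) auto
    then have lnM: "ln (real M) \<le> u" by simp
    have "exp (u + K - 1) \<le> exp (u + K) / 2"
      using exp_ge_add_one_self[of 1] by (simp add: exp_diff field_simps)
    then have "exp (u + K - 1) \<le> real N" using N e1 by linarith
    then have lnN: "u + K - 1 \<le> ln (real N)" using M0 MN by (subst ln_ge_iff) auto
    define G where "G = (\<lambda>p. prime p \<and> [p = 1] (mod s))"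
    have "prime_class_sum s N = (\<Sum>p\<in>{p. p \<le> M \<and> G p} \<union> {p. M < p \<and> p \<le> N \<and> G p}. ln (real p) / real p)"
      unfolding prime_class_sum_def using MN by (intro sum.cong) (auto simp: G_def)
    also have "\<dots> = (\<Sum>p\<in>{p. p \<le> M \<and> G p}. ln (real p) / real p)
        + (\<Sum>p\<in>{p. M < p \<and> p \<le> N \<and> G p}. ln (real p) / real p)"
      by (intro sum.union_disjoint) auto
    also have "(\<Sum>p\<in>{p. p \<le> M \<and> G p}. ln (real p) / real p) = prime_class_sum s M"
      unfolding prime_class_sum_def by (intro sum.cong) (auto simp: G_def)
    also have "(\<Sum>p\<in>{p. M < p \<and> p \<le> N \<and> G p}. ln (real p) / real p)
       \<le> (\<Sum>p\<in>log_window (\<lambda>p. [p = 1] (mod s)) u (u + K). ln (real p) / real p)"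
    proof (rule sum_mono2)
      show "{p. M < p \<and> p \<le> N \<and> G p} \<subseteq> log_window (\<lambda>p. [p = 1] (mod s)) u (u + K)"
      proof
        fix p assume p: "p \<in> {p. M < p \<and> p \<le> N \<and> G p}"
        then have "exp u < real p" "real p \<le> exp (u + K)" "real p > 0" using M N by auto
        then have "ln (exp u) < ln (real p)" "ln (real p) \<le> ln (exp (u + K))"
          by (simp_all only: ln_less_cancel_iff ln_le_cancel_iff exp_gt_zero)
        then show "p \<in> log_window (\<lambda>p. [p = 1] (mod s)) u (u + K)"
          using p by (simp add: log_window_def G_def)
      qed
      fix p assume "p \<in> log_window (\<lambda>p. [p = 1] (mod s)) u (u + K) - {p. M < p \<and> p \<le> N \<and> G p}"
      then show "0 \<le> ln (real p) / real p" using u by (auto simp: log_window_def)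
    qed simp
    finally have "prime_class_sum s N \<le> prime_class_sum s M
       + (\<Sum>p\<in>log_window (\<lambda>p. [p = 1] (mod s)) u (u + K). ln (real p) / real p)" by simp
    moreover have "C * ln (real N) - C * ln (real M) \<ge> C * (K - 1)"
      unfolding right_diff_distrib[symmetric] using C lnM lnN by (intro mult_left_mono) auto
    ultimately show ?thesis using B[of N] B[of M] M0 MN K(2) by linarith
  qed
  then show ?thesis using K by (intro exI[of _ K]) auto
qed

section \<open>The Turan-Kubilius inequality\<close>

definition recip_sum :: "nat set \<Rightarrow> real" where
  "recip_sum P = (\<Sum>p\<in>P. 1 / real p)"

lemma recip_sum_nonneg: "recip_sum P \<ge> 0"
  by (simp add: recip_sum_def sum_nonneg)

text \<open>Counting with multiplicity makes this true also when \<open>p\<close> divides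
  \<open>m\<close>; it is the source of the shift of \<open>F\<close> in every later step.\<close>

lemma num_prime_factors_prime_mult:
  assumes "prime p" "m > 0"
  shows "num_prime_factors (p * m) = Suc (num_prime_factors m)"
  using assms
  by (simp add: num_prime_factors_def prime_factorization_mult prime_factorization_prime prime_gt_0_nat)

lemma sum_multiples:
  fixes f :: "nat \<Rightarrow> 'a::comm_monoid_add"
  assumes "p > 0"
  shows "(\<Sum>n | n \<in> {1..N} \<and> p dvd n. f n) = (\<Sum>m=1..N div p. f (p * m))"
proof (rule sum.reindex_bij_witness[of _ "\<lambda>m. p * m" "\<lambda>n. n div p"])
  fix n assume "n \<in> {n. n \<in> {1..N} \<and> p dvd n}"
  then have n: "1 \<le> n" "n \<le> N" "p dvd n" by auto
  then show "p * (n div p) = n" "f (p * (n div p)) = f n" by auto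
  have "p \<le> n" using n by (intro dvd_imp_le) auto
  then show "n div p \<in> {1..N div p}"
    using n assms by (auto simp: div_le_mono Suc_le_eq div_greater_zero_iff)
next
  fix m assume m: "m \<in> {1..N div p}"
  then have "m * p \<le> N" using assms by (simp add: less_eq_div_iff_mult_less_eq)
  then show "p * m \<in> {n. n \<in> {1..N} \<and> p dvd n}" using m assms by (simp add: mult.commute Suc_le_eq)
  show "p * m div p = m" using assms by simp
qed

lemma card_multiples: "p > 0 \<Longrightarrow> card {n. n \<in> {1..N} \<and> p dvd n} = N div p"
  using sum_multiples[of p "\<lambda>_. 1 :: nat" N] by simp

text \<open>Expanding the square, distinct primes are simultaneous divisors for at most
  \<open>N / (p * q)\<close> integers, so the terms of order \<open>N * L\<^sup>2\<close> cancel.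
  What is left is the diagonal, of order \<open>N * L\<close>, and the rounding error of the first
  moment.\<close>

lemma turan_kubilius_variance:
  fixes P :: "nat set"
  assumes P: "finite P" "\<And>p. p \<in> P \<Longrightarrow> prime p"
  shows "(\<Sum>n=1..N. (real (card {p \<in> P. p dvd n}) - recip_sum P) ^ 2)
           \<le> real N * recip_sum P + 2 * recip_sum P * real (card P)"
proof -
  define L where "L = recip_sum P"
  define I :: "nat \<Rightarrow> nat \<Rightarrow> real" where "I p n = (if p dvd n then 1 else 0)" for p n
  define W where "W n = (\<Sum>p\<in>P. I p n)" for n
  have W: "real (card {p \<in> P. p dvd n}) = W n" for n
    unfolding W_def I_def using sum.inter_filter[OF P(1), of "\<lambda>_. 1::real" "\<lambda>p. p dvd n"] by simp
  have p0: "p > 0" if "p \<in> P" for p using P(2)[OF that] by (rule prime_gt_0_nat)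
  have L0: "L \<ge> 0" by (simp add: L_def recip_sum_nonneg)
  have sumI: "(\<Sum>n=1..N. I d n) = real (N div d)" if "d > 0" for d
  proof -
    have "(\<Sum>n=1..N. I d n) = (\<Sum>n | n \<in> {1..N} \<and> d dvd n. 1)"
      unfolding I_def by (rule sum.inter_filter[symmetric]) simp
    then show ?thesis using card_multiples[OF that, of N] by simp
  qed
  have "(\<Sum>n=1..N. W n ^ 2) = (\<Sum>n=1..N. \<Sum>p\<in>P. \<Sum>q\<in>P. I p n * I q n)"
    unfolding W_def power2_eq_square by (simp only: sum_product)
  also have "\<dots> = (\<Sum>p\<in>P. \<Sum>n=1..N. \<Sum>q\<in>P. I p n * I q n)" by (rule sum.swap)
  also have "\<dots> = (\<Sum>p\<in>P. \<Sum>q\<in>P. \<Sum>n=1..N. I p n * I q n)" by (intro sum.cong refl sum.swap)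
  also have "\<dots> \<le> (\<Sum>p\<in>P. \<Sum>q\<in>P. real N / real p * (1 / real q) + (if p = q then real N / real p else 0))"
  proof (intro sum_mono)
    fix p q assume pq: "p \<in> P" "q \<in> P"
    show "(\<Sum>n=1..N. I p n * I q n) \<le> real N / real p * (1 / real q) + (if p = q then real N / real p else 0)"
    proof (cases "p = q")
      case True
      have "(\<Sum>n=1..N. I p n * I q n) = (\<Sum>n=1..N. I p n)"
        by (intro sum.cong refl) (simp add: I_def True)
      also have "\<dots> \<le> real N / real p" using sumI[OF p0[OF pq(1)]] nat_div_le_real by simp
      finally show ?thesis using True by (simp add: add_increasing)
    next
      case False
      then have "coprime p q" using pq P(2) by (intro primes_coprime) auto
      then have "I p n * I q n = I (p * q) n" for n
        unfolding I_def by (auto simp: divides_mult dest: dvd_mult_left dvd_mult_right)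
      then have "(\<Sum>n=1..N. I p n * I q n) = real (N div (p * q))"
        using sumI[of "p * q"] p0 pq by simp
      also have "\<dots> \<le> real N / real (p * q)" by (rule nat_div_le_real)
      finally show ?thesis using False by simp
    qed
  qed
  also have "\<dots> = (\<Sum>p\<in>P. real N / real p * L + real N / real p)"
  proof (rule sum.cong[OF refl])
    fix p assume "p \<in> P"
    then show "(\<Sum>q\<in>P. real N / real p * (1 / real q) + (if p = q then real N / real p else 0))
       = real N / real p * L + real N / real p"
      unfolding sum.distrib L_def recip_sum_def sum_distrib_left using P(1) by simp
  qed
  also have "\<dots> = real N * L ^ 2 + real N * L"
  proof -
    have L: "L = (\<Sum>p\<in>P. 1 / real p)" by (simp add: L_def recip_sum_def)
    have "(\<Sum>p\<in>P. real N / real p * c) = L * (real N * c)" for c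
      unfolding L sum_distrib_right by simp
    from this[of L] this[of 1] show ?thesis unfolding sum.distrib by (simp add: power2_eq_square)
  qed
  finally have 1: "(\<Sum>n=1..N. W n ^ 2) \<le> real N * L ^ 2 + real N * L" .
  have "real N * L - real (card P) = (\<Sum>p\<in>P. real N / real p - 1)"
    by (simp add: sum_subtractf L_def recip_sum_def sum_distrib_left)
  also have "\<dots> \<le> (\<Sum>p\<in>P. real (N div p))"
    by (intro sum_mono real_minus_1_le_nat_div)
  also have "\<dots> = (\<Sum>p\<in>P. \<Sum>n=1..N. I p n)" using sumI p0 by simp
  also have "\<dots> = (\<Sum>n=1..N. W n)" unfolding W_def by (rule sum.swap)
  finally have 2: "real N * L - real (card P) \<le> (\<Sum>n=1..N. W n)" .
  have "(\<Sum>n=1..N. (W n - L) ^ 2) = (\<Sum>n=1..N. W n ^ 2) - 2 * L * (\<Sum>n=1..N. W n) + real N * L ^ 2"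
    by (simp add: power2_diff sum.distrib sum_subtractf sum_distrib_left sum_distrib_right mult_ac)
  also have "\<dots> \<le> (real N * L ^ 2 + real N * L) - 2 * L * (real N * L - real (card P)) + real N * L ^ 2"
    using 1 mult_left_mono[OF 2, of "2 * L"] L0 by linarith
  also have "\<dots> = real N * L + 2 * L * real (card P)" by (simp add: algebra_simps power2_eq_square)
  finally show ?thesis by (simp add: W L_def)
qed

lemma sum_cauchy_schwarz_norm:
  fixes a :: "nat \<Rightarrow> complex" and b :: "nat \<Rightarrow> complex"
  assumes "\<And>n. n \<in> {1..N} \<Longrightarrow> norm (a n) \<le> 1" "(\<Sum>n=1..N. norm (b n) ^ 2) \<le> V"
  shows "norm (\<Sum>n=1..N. a n * b n) \<le> sqrt (real N * V)"
proof -
  have "norm (\<Sum>n=1..N. a n * b n) \<le> (\<Sum>n=1..N. norm (a n * b n))" by (rule norm_sum)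
  also have "\<dots> \<le> (\<Sum>n=1..N. 1 * norm (b n))"
    unfolding norm_mult using assms(1) by (intro sum_mono mult_right_mono) auto
  also have "\<dots> \<le> sqrt ((\<Sum>n=1..N. 1 ^ 2) * (\<Sum>n=1..N. norm (b n) ^ 2))"
    by (intro real_le_rsqrt Cauchy_Schwarz_ineq_sum)
  also have "\<dots> \<le> sqrt (real N * V)" using assms(2) by (simp add: mult_left_mono)
  finally show ?thesis .
qed

text \<open>The variance bound turned into a statement on arbitrary bounded weights by
  Cauchy-Schwarz. Against the trivial size \<open>N * recip_sum P\<close> it gains the factor
  \<open>sqrt (recip_sum P)\<close>; \<open>2 * card P \<le> N\<close> absorbs the rounding
  error.\<close>

lemma turan_kubilius:
  fixes P :: "nat set" and a :: "nat \<Rightarrow> complex"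
  assumes P: "finite P" "\<And>p. p \<in> P \<Longrightarrow> prime p" and a: "\<And>n. n \<in> {1..N} \<Longrightarrow> norm (a n) \<le> 1"
    and N: "2 * card P \<le> N"
  shows "norm (of_real (recip_sum P) * (\<Sum>n=1..N. a n) - (\<Sum>p\<in>P. \<Sum>m=1..N div p. a (p * m)))
           \<le> real N * sqrt (2 * recip_sum P)"
proof -
  define L where "L = recip_sum P"
  define W where "W n = real (card {p \<in> P. p dvd n})" for n
  have L0: "L \<ge> 0" by (simp add: L_def recip_sum_nonneg)
  have "(\<Sum>p\<in>P. \<Sum>m=1..N div p. a (p * m)) = (\<Sum>p\<in>P. \<Sum>n | n \<in> {1..N} \<and> p dvd n. a n)"
    using P(2) by (intro sum.cong refl sum_multiples[symmetric] prime_gt_0_nat)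
  also have "\<dots> = (\<Sum>p\<in>P. \<Sum>n=1..N. if p dvd n then a n else 0)"
    by (intro sum.cong refl sum.inter_filter) simp
  also have "\<dots> = (\<Sum>n=1..N. \<Sum>p\<in>P. if p dvd n then a n else 0)" by (rule sum.swap)
  also have "\<dots> = (\<Sum>n=1..N. \<Sum>p | p \<in> P \<and> p dvd n. a n)"
    by (intro sum.cong refl sum.inter_filter[symmetric] P(1))
  also have "\<dots> = (\<Sum>n=1..N. a n * of_real (W n))" by (simp add: W_def mult.commute)
  finally have "of_real L * (\<Sum>n=1..N. a n) - (\<Sum>p\<in>P. \<Sum>m=1..N div p. a (p * m))
      = (\<Sum>n=1..N. a n * of_real (L - W n))"
    by (simp add: sum_distrib_left right_diff_distrib sum_subtractf mult.commute)
  also have "norm \<dots> \<le> sqrt (real N * (real N * (2 * L)))"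
  proof (rule sum_cauchy_schwarz_norm)
    have "(\<Sum>n=1..N. norm (of_real (L - W n) :: complex) ^ 2) = (\<Sum>n=1..N. (W n - L) ^ 2)"
      by (simp add: power2_commute del: of_real_diff)
    also have "\<dots> \<le> real N * L + L * (2 * real (card P))"
      using turan_kubilius_variance[OF P, of N] by (simp add: W_def L_def mult_ac)
    also have "\<dots> \<le> real N * L + L * real N" using N L0 by (intro add_mono mult_left_mono) auto
    also have "\<dots> = real N * (2 * L)" by simp
    finally show "(\<Sum>n=1..N. norm (of_real (L - W n) :: complex) ^ 2) \<le> real N * (2 * L)" .
  qed (use a in auto)
  also have "\<dots> = real N * sqrt (2 * L)" by (simp add: real_sqrt_mult)
  finally show ?thesis by (simp add: L_def)
qed

section \<open>Katai's argument for irrational rotations\<close>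

lemma norm_sum_geometric_le:
  fixes w :: complex
  assumes "norm w = 1" "w \<noteq> 1"
  shows "norm (\<Sum>m=1..M. w ^ m) \<le> 2 / norm (1 - w)"
proof -
  have "(1 - w) * (\<Sum>m=1..M. w ^ m) = w - w ^ Suc M"
  proof (induction M)
    case (Suc M)
    have "(1 - w) * (\<Sum>m=1..Suc M. w ^ m) = (1 - w) * (\<Sum>m=1..M. w ^ m) + (1 - w) * w ^ Suc M"
      by (simp add: distrib_left)
    also have "\<dots> = w - w ^ Suc (Suc M)" unfolding Suc.IH by (simp add: algebra_simps)
    finally show ?case .
  qed simp
  then have "norm (1 - w) * norm (\<Sum>m=1..M. w ^ m) = norm (w - w ^ Suc M)" by (metis norm_mult)
  also have "\<dots> \<le> norm w + norm (w ^ Suc M)" by (rule norm_triangle_ineq4)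
  also have "\<dots> = 2" using assms by (simp add: norm_mult norm_power)
  finally show ?thesis using assms by (simp add: pos_le_divide_eq mult.commute)
qed

text \<open>After expanding the square, a pair \<open>p \<noteq> q\<close> contributes a geometric
  sum in \<open>m\<close> with ratio different from 1, bounded independently of \<open>N\<close>.
  Only the diagonal grows, and it gives \<open>N * recip_sum P\<close>.\<close>

lemma dual_sieve_bound:
  fixes z :: complex
  assumes P: "finite P" "\<And>p. p \<in> P \<Longrightarrow> prime p" and z: "norm z = 1" "\<And>k. k > 0 \<Longrightarrow> z ^ k \<noteq> 1"
  shows "\<exists>K. \<forall>N. (\<Sum>m=1..N. norm (\<Sum>p | p \<in> P \<and> m \<le> N div p. z ^ (p * m)) ^ 2) \<le> real N * recip_sum P + K"
proof -
  define w where "w p q = z ^ p * cnj (z ^ q)" for p q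
  have w1: "norm (w p q) = 1" for p q using z by (simp add: w_def norm_mult norm_power)
  have zz: "z * cnj z = 1" using z(1) by (simp add: complex_norm_square[symmetric])
  have zz': "z ^ k * cnj z ^ k = 1" for k using zz by (simp flip: power_mult_distrib)
  have cz: "cnj z ^ k \<noteq> 1" if "k > 0" for k
    using z(2)[OF that] complex_cnj_cancel_iff[of "z ^ k" 1] by simp
  have wne: "w p q \<noteq> 1" if "p \<noteq> q" for p q
  proof (cases "p < q")
    case True
    then have "w p q = (z ^ p * cnj z ^ p) * cnj z ^ (q - p)"
      by (simp add: w_def mult.assoc flip: power_add)
    then show ?thesis using zz' cz[of "q - p"] True by simp
  next
    case False
    with that have "q < p" by simp
    then have "w p q = z ^ (p - q) * (z ^ q * cnj z ^ q)"
      by (simp add: w_def mult.assoc[symmetric] flip: power_add)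
    then show ?thesis using zz' z(2)[of "p - q"] \<open>q < p\<close> by simp
  qed
  \<comment> \<open>On the diagonal \<open>w p p = 1\<close>, and the summand is
    \<open>2 / 0 = 0\<close>.\<close>
  define K where "K = (\<Sum>p\<in>P. \<Sum>q\<in>P. 2 / norm (1 - w p q))"
  have "(\<Sum>m=1..N. norm (\<Sum>p | p \<in> P \<and> m \<le> N div p. z ^ (p * m)) ^ 2) \<le> real N * recip_sum P + K" for N
  proof -
    define b where "b m = (\<Sum>p\<in>P. if m \<le> N div p then z ^ (p * m) else 0)" for m
    have b: "(\<Sum>p | p \<in> P \<and> m \<le> N div p. z ^ (p * m)) = b m" for m
      unfolding b_def by (rule sum.inter_filter[OF P(1)])
    have term_eq: "(if m \<le> N div p then z ^ (p * m) else 0) * cnj (if m \<le> N div q then z ^ (q * m) else 0)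
        = (if m \<le> min (N div p) (N div q) then w p q ^ m else 0)" for p q m
      by (simp add: w_def power_mult_distrib power_mult)
    have "of_real (\<Sum>m=1..N. norm (b m) ^ 2) = (\<Sum>m=1..N. b m * cnj (b m))"
      by (simp only: of_real_sum complex_norm_square)
    also have "\<dots> = (\<Sum>m=1..N. \<Sum>p\<in>P. \<Sum>q\<in>P. if m \<le> min (N div p) (N div q) then w p q ^ m else 0)"
      unfolding b_def cnj_sum sum_product term_eq ..
    also have "\<dots> = (\<Sum>p\<in>P. \<Sum>m=1..N. \<Sum>q\<in>P. if m \<le> min (N div p) (N div q) then w p q ^ m else 0)"
      by (rule sum.swap)
    also have "\<dots> = (\<Sum>p\<in>P. \<Sum>q\<in>P. \<Sum>m=1..N. if m \<le> min (N div p) (N div q) then w p q ^ m else 0)"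
      by (intro sum.cong refl sum.swap)
    also have "\<dots> = (\<Sum>p\<in>P. \<Sum>q\<in>P. \<Sum>m=1..min (N div p) (N div q). w p q ^ m)"
    proof (rule sum.cong[OF refl], rule sum.cong[OF refl])
      fix p q
      have "min (N div p) (N div q) \<le> N" by (simp add: min.coboundedI1)
      then have "{m. m \<in> {1..N} \<and> m \<le> min (N div p) (N div q)} = {1..min (N div p) (N div q)}" by auto
      then show "(\<Sum>m=1..N. if m \<le> min (N div p) (N div q) then w p q ^ m else 0)
          = (\<Sum>m=1..min (N div p) (N div q). w p q ^ m)"
        by (subst sum.inter_filter[symmetric]) auto
    qed
    finally have eq: "of_real (\<Sum>m=1..N. norm (b m) ^ 2)
        = (\<Sum>p\<in>P. \<Sum>q\<in>P. \<Sum>m=1..min (N div p) (N div q). w p q ^ m)" .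
    have "(\<Sum>m=1..N. norm (b m) ^ 2) = norm (of_real (\<Sum>m=1..N. norm (b m) ^ 2) :: complex)"
      by (simp add: sum_nonneg del: of_real_sum)
    also have "\<dots> \<le> (\<Sum>p\<in>P. \<Sum>q\<in>P. norm (\<Sum>m=1..min (N div p) (N div q). w p q ^ m))"
      unfolding eq by (intro order_trans[OF norm_sum] sum_mono norm_sum)
    also have "\<dots> \<le> (\<Sum>p\<in>P. \<Sum>q\<in>P. (if p = q then real N / real p else 0) + 2 / norm (1 - w p q))"
    proof (intro sum_mono)
      fix p q assume "p \<in> P" "q \<in> P"
      show "norm (\<Sum>m=1..min (N div p) (N div q). w p q ^ m)
          \<le> (if p = q then real N / real p else 0) + 2 / norm (1 - w p q)"
      proof (cases "p = q")
        case True
        have "norm (\<Sum>m=1..N div p. w p q ^ m) \<le> (\<Sum>m=1..N div p. norm (w p q ^ m))" by (rule norm_sum)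
        also have "\<dots> = real (N div p)" by (simp add: norm_power w1)
        also have "\<dots> \<le> real N / real p" by (rule nat_div_le_real)
        finally show ?thesis using True by (simp add: add_increasing2)
      qed (use norm_sum_geometric_le[OF w1 wne] in auto)
    qed
    also have "\<dots> = (\<Sum>p\<in>P. real N / real p) + K"
      using P(1) by (simp add: sum.distrib K_def)
    also have "(\<Sum>p\<in>P. real N / real p) = real N * recip_sum P"
      by (simp add: recip_sum_def sum_distrib_left)
    finally show ?thesis by (simp add: b)
  qed
  then show ?thesis by blast
qed

text \<open>The Turan-Kubilius inequality brings in the factorisation \<open>n = p * m\<close>.
  After exchanging the sums, \<open>F (Suc (num_prime_factors m))\<close> no longer depends on
  \<open>p\<close>, and Cauchy-Schwarz over \<open>m\<close> removes it, leaving the exponential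
  sums over \<open>P\<close>. The threshold is uniform in \<open>F\<close>.\<close>

theorem katai:
  fixes z :: complex
  assumes z: "norm z = 1" "\<And>k. k > 0 \<Longrightarrow> z ^ k \<noteq> 1"
    and div: "\<And>L. \<exists>P. finite P \<and> (\<forall>p\<in>P. prime p) \<and> recip_sum P \<ge> L"
    and \<tau>: "\<tau> > 0"
  shows "\<exists>N0. \<forall>N\<ge>N0. \<forall>F. (\<forall>k. norm (F k) \<le> 1) \<longrightarrow>
           norm (\<Sum>n=1..N. z ^ n * F (num_prime_factors n)) \<le> \<tau> * real N"
proof -
  \<comment> \<open>Two errors of size \<open>N * sqrt (2 * L)\<close> face the main term weighted
    by \<open>L\<close>; the total \<open>4 * N / sqrt L\<close> has to be at most
    \<open>\<tau> * N\<close>.\<close>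
  define L0 where "L0 = 1 + (4 / \<tau>) ^ 2"
  have L0: "L0 \<ge> 1" "sqrt L0 \<ge> 4 / \<tau>" using \<tau> by (auto simp: L0_def intro!: real_le_rsqrt)
  from div[of L0] obtain P where "finite P \<and> (\<forall>p\<in>P. prime p) \<and> recip_sum P \<ge> L0" ..
  then have P: "finite P" "\<And>p. p \<in> P \<Longrightarrow> prime p" "recip_sum P \<ge> L0" by simp_all
  define L where "L = recip_sum P"
  have L: "L \<ge> 1" "sqrt L \<ge> 4 / \<tau>"
    using P(3) L0 real_sqrt_le_mono[OF P(3)] unfolding L_def by linarith+
  obtain K where K: "\<And>N. (\<Sum>m=1..N. norm (\<Sum>p | p \<in> P \<and> m \<le> N div p. z ^ (p * m)) ^ 2) \<le> real N * L + K"
    using dual_sieve_bound[OF P(1,2) z] unfolding L_def by blast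
  define N0 where "N0 = max (2 * card P) (nat \<lceil>\<bar>K\<bar>\<rceil>)"
  have "norm (\<Sum>n=1..N. z ^ n * F (num_prime_factors n)) \<le> \<tau> * real N"
    if N: "N \<ge> N0" and F: "\<forall>k. norm (F k) \<le> 1" for N F
  proof -
    define a where "a n = z ^ n * F (num_prime_factors n)" for n
    have a1: "norm (a n) \<le> 1" for n using z(1) F by (simp add: a_def norm_mult norm_power)
    have KN: "K \<le> real N" using N unfolding N0_def by linarith
    have "norm (of_real L * (\<Sum>n=1..N. a n) - (\<Sum>p\<in>P. \<Sum>m=1..N div p. a (p * m))) \<le> real N * sqrt (2 * L)"
      unfolding L_def using N by (intro turan_kubilius P a1) (auto simp: N0_def)
    moreover have "norm (\<Sum>p\<in>P. \<Sum>m=1..N div p. a (p * m)) \<le> real N * sqrt (2 * L)"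
    proof -
      have "(\<Sum>p\<in>P. \<Sum>m=1..N div p. a (p * m))
         = (\<Sum>p\<in>P. \<Sum>m=1..N. if m \<le> N div p then F (Suc (num_prime_factors m)) * z ^ (p * m) else 0)"
      proof (rule sum.cong[OF refl])
        fix p assume p: "p \<in> P"
        have "{m. m \<in> {1..N} \<and> m \<le> N div p} = {1..N div p}"
          using order_trans[OF _ div_le_dividend[of N p]] by auto
        then have "(\<Sum>m=1..N. if m \<le> N div p then F (Suc (num_prime_factors m)) * z ^ (p * m) else 0)
           = (\<Sum>m=1..N div p. F (Suc (num_prime_factors m)) * z ^ (p * m))"
          by (subst sum.inter_filter[symmetric]) auto
        also have "\<dots> = (\<Sum>m=1..N div p. a (p * m))"
          using P(2)[OF p] by (intro sum.cong refl) (auto simp: a_def num_prime_factors_prime_mult)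
        finally show "(\<Sum>m=1..N div p. a (p * m)) =
           (\<Sum>m=1..N. if m \<le> N div p then F (Suc (num_prime_factors m)) * z ^ (p * m) else 0)" ..
      qed
      also have "\<dots> = (\<Sum>m=1..N. \<Sum>p\<in>P. if m \<le> N div p then F (Suc (num_prime_factors m)) * z ^ (p * m) else 0)"
        by (rule sum.swap)
      also have "\<dots> = (\<Sum>m=1..N. F (Suc (num_prime_factors m)) * (\<Sum>p | p \<in> P \<and> m \<le> N div p. z ^ (p * m)))"
        unfolding sum_distrib_left by (intro sum.cong refl sum.inter_filter[symmetric] P(1))
      also have "norm \<dots> \<le> sqrt (real N * (real N * L + K))"
        using F K[of N] by (intro sum_cauchy_schwarz_norm) blast+
      also have "\<dots> \<le> sqrt (real N * (real N * L + real N * L))"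
      proof -
        have "K \<le> real N * L" using KN mult_left_mono[OF L(1), of "real N"] by simp
        then show ?thesis by (intro real_sqrt_le_mono mult_left_mono add_left_mono) auto
      qed
      also have "\<dots> = sqrt (real N ^ 2 * (2 * L))" by (simp add: power2_eq_square algebra_simps)
      also have "\<dots> = real N * sqrt (2 * L)" by (simp add: real_sqrt_mult)
      finally show ?thesis .
    qed
    ultimately have "norm (of_real L * (\<Sum>n=1..N. a n)) \<le> real N * sqrt (2 * L) + real N * sqrt (2 * L)"
      using norm_triangle_sub[of "of_real L * (\<Sum>n=1..N. a n)" "\<Sum>p\<in>P. \<Sum>m=1..N div p. a (p * m)"]
      by linarith
    also have "\<dots> = (2 * sqrt 2) * (real N * sqrt L)" by (simp add: real_sqrt_mult)
    also have "\<dots> \<le> 4 * (real N * sqrt L)"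
      using sqrt2_less_2 L by (intro mult_right_mono) auto
    finally have "L * norm (\<Sum>n=1..N. a n) \<le> 4 * (real N * sqrt L)" using L by (simp add: norm_mult)
    moreover have "L * norm (\<Sum>n=1..N. a n) = sqrt L * (sqrt L * norm (\<Sum>n=1..N. a n))"
      using L(1) unfolding mult.assoc[symmetric] by simp
    ultimately have "sqrt L * (sqrt L * norm (\<Sum>n=1..N. a n)) \<le> sqrt L * (4 * real N)"
      by (simp only: mult_ac)
    then have "sqrt L * norm (\<Sum>n=1..N. a n) \<le> 4 * real N" using L by simp
    moreover have "4 / \<tau> * norm (\<Sum>n=1..N. a n) \<le> sqrt L * norm (\<Sum>n=1..N. a n)"
      using L(2) by (intro mult_right_mono) auto
    ultimately have "4 / \<tau> * norm (\<Sum>n=1..N. a n) \<le> 4 * real N" by linarith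
    then show ?thesis using \<tau> by (simp add: a_def field_simps)
  qed
  then show ?thesis by blast
qed

section \<open>Pairs of primes with nearly constant ratio\<close>

text \<open>This weight is nearly uniform in the variable \<open>ln p\<close>, which makes windows
  at different heights comparable. On a single window it is proportional to
  \<open>recip_sum\<close>, up to the ratio of the window's end points.\<close>

definition log_weight :: "nat set \<Rightarrow> real" where
  "log_weight S = (\<Sum>p\<in>S. ln (real p) / real p)"

lemma log_weight_mono:
  assumes "S \<subseteq> log_window R u v" "S' \<subseteq> S"
  shows "log_weight S' \<le> log_weight S"
  unfolding log_weight_def
proof (rule sum_mono2)
  show "finite S" using assms finite_subset finite_log_window by blast
  fix p assume "p \<in> S - S'"
  then have "p > 0" using assms by (auto simp: log_window_def prime_gt_0_nat)
  then show "ln (real p) / real p \<ge> 0" by simp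
qed (use assms in auto)

lemma log_weight_UN:
  assumes "finite I" "\<And>i. i \<in> I \<Longrightarrow> finite (C i)" "\<And>i j. i \<in> I \<Longrightarrow> j \<in> I \<Longrightarrow> i \<noteq> j \<Longrightarrow> C i \<inter> C j = {}"
  shows "log_weight (\<Union>i\<in>I. C i) = (\<Sum>i\<in>I. log_weight (C i))"
  unfolding log_weight_def using assms by (intro sum.UNION_disjoint) auto

definition log_cell :: "(nat \<Rightarrow> bool) \<Rightarrow> real \<Rightarrow> real \<Rightarrow> nat \<Rightarrow> nat set" where
  "log_cell R u h i = log_window R (u + real i * h) (u + real (Suc i) * h)"

lemma log_cell_disjoint:
  assumes "h > 0" "i \<noteq> j"
  shows "log_cell R u h i \<inter> log_cell R u h j = {}"
proof -
  have "log_cell R u h i \<inter> log_cell R u h j = {}" if "i < j" for i j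
  proof -
    have "real (Suc i) * h \<le> real j * h" using that assms by (intro mult_right_mono) auto
    then show ?thesis unfolding log_cell_def log_window_def by auto
  qed
  then show ?thesis using assms(2) by (metis inf_commute linorder_neqE_nat)
qed

lemma log_window_subset_cells:
  assumes "h > 0"
  shows "log_window R u (u + real n * h) \<subseteq> (\<Union>i<n. log_cell R u h i)"
proof
  fix p assume p: "p \<in> log_window R u (u + real n * h)"
  define x where "x = (ln (real p) - u) / h"
  have x: "0 < x" "x \<le> real n" using p assms by (auto simp: x_def log_window_def field_simps)
  define i where "i = nat (\<lceil>x\<rceil> - 1)"
  have c: "\<lceil>x\<rceil> \<ge> 1" using x by (simp add: one_le_ceiling)
  then have i: "real i < x" "x \<le> real (Suc i)" unfolding i_def by linarith+
  have "i < n" using i(1) x(2) by linarith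
  moreover have "real i * h < ln (real p) - u" "ln (real p) - u \<le> real (Suc i) * h"
    using i assms unfolding x_def by (simp_all only: pos_less_divide_eq pos_divide_le_eq)
  then have "p \<in> log_cell R u h i" using p by (auto simp: log_cell_def log_window_def)
  ultimately show "p \<in> (\<Union>i<n. log_cell R u h i)" by blast
qed

text \<open>Since a window of bounded length has weight at least \<open>1\<close> while a short one has small weight,
  the weight cannot be concentrated in a single short piece.\<close>

lemma rich_cells:
  fixes R :: "nat \<Rightarrow> bool"
  assumes b: "b > 0" and r: "r > 0" and h: "h > 0" "h \<le> e"
    and total: "log_weight (log_window R u (u + real (b * r) * h)) \<ge> 1"
    and short: "\<And>v. v \<ge> u \<Longrightarrow> log_weight (log_window R v (v + (e + h))) \<le> 1 / (4 * real b)"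
  shows "\<exists>i i'. i < i' \<and> i' < b * r \<and> e \<le> real (i' - i) * h \<and> real (i' - i) * h \<le> real r * h \<and>
     log_weight (log_cell R u h i) \<ge> 1 / (2 * real (b * r)) \<and>
     log_weight (log_cell R u h i') \<ge> 1 / (2 * real (b * r))"
proof -
  define w where "w i = log_weight (log_cell R u h i)" for i
  define \<theta> where "\<theta> = 1 / (2 * real (b * r))"
  have fin: "finite (log_cell R u h i)" for i by (simp add: log_cell_def)
  have "1 \<le> log_weight (\<Union>i<b * r. log_cell R u h i)"
  proof -
    have "(\<Union>i<b * r. log_cell R u h i) \<subseteq> log_window R u (u + real (b * r) * h)"
    proof
      fix p assume "p \<in> (\<Union>i<b * r. log_cell R u h i)"
      then obtain i where i: "i < b * r" "p \<in> log_cell R u h i" by auto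
      have "Suc i \<le> b * r" using i by simp
      then have "real (Suc i) \<le> real (b * r)" by (simp only: of_nat_le_iff)
      then have "real (Suc i) * h \<le> real (b * r) * h" "0 \<le> real i * h"
          using h by (auto intro: mult_right_mono)
      then show "p \<in> log_window R u (u + real (b * r) * h)"
        using i(2) unfolding log_cell_def log_window_def by auto
    qed
    with log_window_subset_cells[OF h(1), of R u "b * r"]
    have "(\<Union>i<b * r. log_cell R u h i) = log_window R u (u + real (b * r) * h)" by (intro equalityI) auto
    then show ?thesis using total by simp
  qed
  also have "\<dots> = (\<Sum>i<b * r. w i)"
    unfolding w_def using fin log_cell_disjoint[OF h(1)] by (intro log_weight_UN) auto
  also have "\<dots> = (\<Sum>\<beta><b. \<Sum>i=\<beta> * r..<\<beta> * r + r. w i)" by (rule sum.nat_group[symmetric])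
  finally have tot: "1 \<le> (\<Sum>\<beta><b. \<Sum>i=\<beta> * r..<\<beta> * r + r. w i)" .
  \<comment> \<open>The cells are grouped into \<open>b\<close> blocks of \<open>r\<close>, and one
    block carries at least the average weight. Staying within this block bounds the distance of the
    cells chosen later by \<open>r * h\<close>.\<close>
  have "\<exists>\<beta><b. (\<Sum>i=\<beta> * r..<\<beta> * r + r. w i) \<ge> 1 / real b"
  proof (rule ccontr)
    assume "\<not> ?thesis"
    then have "(\<Sum>i=\<beta> * r..<\<beta> * r + r. w i) < 1 / real b" if "\<beta> < b" for \<beta> using that not_le by blast
    then have "(\<Sum>\<beta><b. \<Sum>i=\<beta> * r..<\<beta> * r + r. w i) < (\<Sum>\<beta><b. 1 / real b)"
      using b by (intro sum_strict_mono) auto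
    then show False using tot b by simp
  qed
  then obtain \<beta> where \<beta>: "\<beta> < b" "(\<Sum>i=\<beta> * r..<\<beta> * r + r. w i) \<ge> 1 / real b" by blast
  define I where "I = {\<beta> * r..<\<beta> * r + r}"
  \<comment> \<open>Cells lighter than \<open>\<theta>\<close> carry at most
    \<open>r * \<theta> = 1 / (2 * b)\<close>, half of the weight of the block, so the rich cells in
    \<open>G\<close> carry the other half.\<close>
  define G where "G = {i \<in> I. w i \<ge> \<theta>}"
  have Isub: "i < b * r" if "i \<in> I" for i
  proof -
    have "i < \<beta> * r + r" using that by (simp add: I_def)
    also have "\<dots> = Suc \<beta> * r" by simp
    also have "\<dots> \<le> b * r" using \<beta>(1) by (intro mult_right_mono) auto
    finally show ?thesis .
  qed
  have "(\<Sum>i\<in>I. w i) = (\<Sum>i\<in>G. w i) + (\<Sum>i\<in>I - G. w i)"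
    by (subst sum.union_disjoint[symmetric]) (auto simp: G_def I_def intro!: sum.cong)
  moreover have "(\<Sum>i\<in>I - G. w i) \<le> (\<Sum>i\<in>I - G. \<theta>)"
    by (intro sum_mono) (auto simp: G_def)
  moreover have "(\<Sum>i\<in>I - G. \<theta>) \<le> (\<Sum>i\<in>I. \<theta>)" by (intro sum_mono2) (auto simp: I_def \<theta>_def)
  moreover have "(\<Sum>i\<in>I. \<theta>) = 1 / (2 * real b)" using r by (simp add: I_def \<theta>_def)
  moreover have "1 / real b = 1 / (2 * real b) + 1 / (2 * real b)" using b by (simp add: field_simps)
  ultimately have Gw: "(\<Sum>i\<in>G. w i) \<ge> 1 / (2 * real b)" using \<beta>(2) unfolding I_def by linarith
  have Gfin: "finite G" by (simp add: G_def I_def)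
  have Gne: "G \<noteq> {}" using Gw b by auto
  \<comment> \<open>If every rich cell began within \<open>e\<close> of the leftmost one, they would
    all fit into one window of length \<open>e + h\<close>, which is too light.\<close>
  define i where "i = Min G"
  have iG: "i \<in> G" and imin: "\<And>k. k \<in> G \<Longrightarrow> i \<le> k" using Gfin Gne by (auto simp: i_def)
  have "\<exists>k\<in>G. e \<le> real (k - i) * h"
  proof (rule ccontr)
    assume "\<not> ?thesis"
    then have close: "real (k - i) * h < e" if "k \<in> G" for k using that by force
    define v where "v = u + real i * h"
    have "(\<Sum>k\<in>G. w k) = log_weight (\<Union>k\<in>G. log_cell R u h k)"
      unfolding w_def using fin Gfin log_cell_disjoint[OF h(1)] by (intro log_weight_UN[symmetric]) auto
    also have "\<dots> \<le> log_weight (log_window R v (v + (e + h)))"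
    proof (rule log_weight_mono[OF order.refl])
      show "(\<Union>k\<in>G. log_cell R u h k) \<subseteq> log_window R v (v + (e + h))"
      proof
        fix p assume "p \<in> (\<Union>k\<in>G. log_cell R u h k)"
        then obtain k where k: "k \<in> G" "p \<in> log_cell R u h k" by auto
        have "real k = real i + real (k - i)" using imin[OF k(1)] by simp
        then have "real k * h = (real i + real (k - i)) * h" by (rule arg_cong)
        then have "real k * h = real i * h + real (k - i) * h" unfolding distrib_right .
        moreover have "real (k - i) * h \<ge> 0" "real (k - i) * h < e" using h close[OF k(1)] by auto
        moreover have "prime p" "R p" "u + real k * h < ln (real p)" "ln (real p) \<le> u + (real k * h + h)"
          using k(2) by (auto simp: log_cell_def log_window_def algebra_simps)
        ultimately have "v < ln (real p)" "ln (real p) \<le> v + (e + h)" unfolding v_def by linarith+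
        then show "p \<in> log_window R v (v + (e + h))"
          using \<open>prime p\<close> \<open>R p\<close> by (simp add: log_window_def)
      qed
    qed
    also have "\<dots> \<le> 1 / (4 * real b)" using h by (intro short) (auto simp: v_def)
    also have "\<dots> < 1 / (2 * real b)" using b by (simp add: field_simps)
    finally show False using Gw by simp
  qed
  then obtain k where k: "k \<in> G" "e \<le> real (k - i) * h" by blast
  have "k - i \<noteq> 0" using k(2) h by (intro notI) auto
  moreover have "k - i \<le> r" using k(1) iG by (auto simp: G_def I_def)
  then have "real (k - i) * h \<le> real r * h" using h by (intro mult_right_mono) auto
  ultimately show ?thesis
    using k iG Isub unfolding G_def w_def \<theta>_def by (intro exI[of _ i] exI[of _ k]) auto
qed

text \<open>The proportion \<open>c\<close> of \<open>P\<close> that may be discarded must not depend on \<open>L\<close>: the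
  Turan-Kubilius error only becomes small relative to \<open>recip_sum P\<close> as \<open>L\<close> grows.\<close>

definition pair_rich :: "(nat \<Rightarrow> bool) \<Rightarrow> real \<Rightarrow> real \<Rightarrow> bool" where
  "pair_rich R d \<eta> \<longleftrightarrow> (\<exists>c>0. \<forall>L. \<exists>P. finite P \<and> (\<forall>p\<in>P. prime p \<and> R p) \<and> recip_sum P \<ge> L \<and>
     (\<forall>Z\<subseteq>P. recip_sum Z \<le> c * recip_sum P \<longrightarrow>
        (\<exists>p\<in>P - Z. \<exists>q\<in>P - Z. \<bar>ln (real q) - ln (real p) - d\<bar> \<le> \<eta>)))"

lemma recip_sum_disjoint_parts:
  assumes "finite J" "\<And>j. j \<in> J \<Longrightarrow> finite (W j)" "\<And>i j. i \<in> J \<Longrightarrow> j \<in> J \<Longrightarrow> i \<noteq> j \<Longrightarrow> W i \<inter> W j = {}"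
    and "Z \<subseteq> (\<Union>j\<in>J. W j)"
  shows "recip_sum Z = (\<Sum>j\<in>J. recip_sum (Z \<inter> W j))"
proof -
  have "Z = (\<Union>j\<in>J. Z \<inter> W j)" using assms(4) by auto
  then have "recip_sum Z = (\<Sum>p\<in>(\<Union>j\<in>J. Z \<inter> W j). 1 / real p)" by (simp add: recip_sum_def)
  also have "\<dots> = (\<Sum>j\<in>J. recip_sum (Z \<inter> W j))"
    unfolding recip_sum_def
  proof (rule sum.UNION_disjoint[OF assms(1)])
    show "\<forall>i\<in>J. finite (Z \<inter> W i)" using assms(2) by simp
    show "\<forall>i\<in>J. \<forall>j\<in>J. i \<noteq> j \<longrightarrow> Z \<inter> W i \<inter> (Z \<inter> W j) = {}" using assms(3) by blast
  qed
  finally show ?thesis .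
qed

lemma recip_sum_log_window:
  assumes "S \<subseteq> log_window R u v" "u > 0"
  shows "recip_sum S \<ge> log_weight S / v" "recip_sum S \<le> log_weight S / u"
proof -
  have p: "u < ln (real p) \<and> ln (real p) \<le> v \<and> real p > 0" if "p \<in> S" for p
    using that assms by (auto simp: log_window_def prime_gt_0_nat)
  show "recip_sum S \<ge> log_weight S / v"
    unfolding recip_sum_def log_weight_def sum_divide_distrib
  proof (rule sum_mono)
    fix q assume "q \<in> S"
    then have "ln (real q) / v \<le> 1" using p[of q] assms(2) by simp
    then show "ln (real q) / real q / v \<le> 1 / real q"
      using p[OF \<open>q \<in> S\<close>] divide_right_mono[of "ln (real q) / v" 1 "real q"] by (simp add: field_simps)
  qed
  show "recip_sum S \<le> log_weight S / u"
    unfolding recip_sum_def log_weight_def sum_divide_distrib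
  proof (rule sum_mono)
    fix q assume "q \<in> S"
    then have "1 \<le> ln (real q) / u" using p[of q] assms(2) by simp
    then show "1 / real q \<le> ln (real q) / real q / u"
      using p[OF \<open>q \<in> S\<close>] divide_right_mono[of 1 "ln (real q) / u" "real q"] by (simp add: field_simps)
  qed
qed

lemma recip_sum_mono: "finite S \<Longrightarrow> S' \<subseteq> S \<Longrightarrow> recip_sum S' \<le> recip_sum S"
  unfolding recip_sum_def by (intro sum_mono2) auto

text \<open>\<open>P\<close> collects the two rich cells from the windows indexed by
  \<open>J\<close>. A cell of window \<open>j\<close> has reciprocal weight of order
  \<open>1 / j\<close>, so the divergence over \<open>J\<close> makes \<open>recip_sum P\<close>
  large. A set \<open>Z\<close> that leaves no pair must swallow one of the two cells in every
  window, hence a fixed proportion of \<open>P\<close>.\<close>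

lemma pair_rich_from_cells:
  fixes J :: "nat set"
  assumes K: "K > 0" and \<theta>: "\<theta> > 0" and C: "C > 0" and h: "h > 0" "h \<le> \<eta>"
      and ii: "i < i'" "real (Suc i') * h \<le> K"
    and J: "0 \<notin> J" "\<not> summable (\<lambda>j. if j \<in> J then 1 / real j else 0)"
    and rich: "\<And>j. j \<in> J \<Longrightarrow> log_weight (log_cell R (real j * K) h i) \<ge> \<theta>"
      "\<And>j. j \<in> J \<Longrightarrow> log_weight (log_cell R (real j * K) h i') \<ge> \<theta>"
    and upper: "\<And>j. j \<in> J \<Longrightarrow> log_weight (log_window R (real j * K) (real j * K + K)) \<le> C"
  shows "pair_rich R (real (i' - i) * h) \<eta>"
proof -
  define A B W where "A j = log_cell R (real j * K) h i" and "B j = log_cell R (real j * K) h i'"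
    and "W j = log_window R (real j * K) (real j * K + K)" for j
  have AW: "A j \<subseteq> W j" "B j \<subseteq> W j" for j
  proof -
    have cell: "log_cell R (real j * K) h k \<subseteq> W j" if "k \<le> i'" for k
    proof -
      have "real (Suc k) * h \<le> real (Suc i') * h" using that h by (intro mult_right_mono) auto
      moreover have "real k * h \<ge> 0" using h by simp
      ultimately show ?thesis using ii(2) unfolding log_cell_def W_def log_window_def by auto
    qed
    show "A j \<subseteq> W j" "B j \<subseteq> W j" using cell ii by (auto simp: A_def B_def)
  qed
  have finW: "finite (W j)" for j by (simp add: W_def)
  have disj: "W j \<inter> W k = {}" if "j \<noteq> k" for j k
  proof -
    have "W j \<inter> W k = {}" if "j < k" for j k
    proof -
      have "real (Suc j) * K \<le> real k * K" using that K by (intro mult_right_mono) auto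
      then show ?thesis unfolding W_def log_window_def by (auto simp: distrib_right)
    qed
    then show ?thesis using that by (metis inf_commute linorder_neqE_nat)
  qed
  have low: "recip_sum S \<ge> \<theta> / (2 * K) * (1 / real j)" if "j \<in> J" "S \<subseteq> W j" "A j \<subseteq> S \<or> B j \<subseteq> S" for S j
  proof -
    have j: "j > 0" using that(1) J(1) by (cases j) auto
    have "\<theta> \<le> log_weight S"
      using that(3) rich[OF that(1)] log_weight_mono[OF that(2)[unfolded W_def]]
      unfolding A_def B_def by (meson order_trans)
    have "real j * K + K \<le> 2 * (real j * K)" using j K by simp
    then have "\<theta> / (2 * (real j * K)) \<le> log_weight S / (real j * K + K)"
      using \<open>\<theta> \<le> log_weight S\<close> \<theta> K j by (intro frac_le) (auto intro: add_nonneg_pos)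
    also have "\<dots> \<le> recip_sum S"
      using j K by (intro recip_sum_log_window(1)[OF that(2)[unfolded W_def]]) auto
    finally show ?thesis by (simp add: mult_ac)
  qed
  have up: "recip_sum (A j \<union> B j) \<le> C / K * (1 / real j)" if "j \<in> J" for j
  proof -
    have j: "j > 0" using that J(1) by (cases j) auto
    have "recip_sum (A j \<union> B j) \<le> recip_sum (W j)" using AW finW by (intro recip_sum_mono) auto
    also have "\<dots> \<le> log_weight (W j) / (real j * K)"
      using j K unfolding W_def by (intro recip_sum_log_window(2)) auto
    also have "\<dots> \<le> C / (real j * K)"
        using upper[OF that] j K unfolding W_def by (intro divide_right_mono) auto
    finally show ?thesis by (simp add: mult_ac)
  qed
  \<comment> \<open>Half of the ratio between the lower bound \<open>\<theta> / (2 * K)\<close> for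
    one cell and the upper bound \<open>C / K\<close> for both cells, in units of
    \<open>1 / j\<close>; the parameter \<open>L\<close> does not enter.\<close>
  define c where "c = \<theta> / (4 * C)"
  have "\<exists>P. finite P \<and> (\<forall>p\<in>P. prime p \<and> R p) \<and> recip_sum P \<ge> L \<and>
     (\<forall>Z\<subseteq>P. recip_sum Z \<le> c * recip_sum P \<longrightarrow>
        (\<exists>p\<in>P - Z. \<exists>q\<in>P - Z. \<bar>ln (real q) - ln (real p) - real (i' - i) * h\<bar> \<le> \<eta>))" for L
  proof -
    define M where "M = max 1 (2 * K / \<theta> * L)"
    have "\<exists>N. (\<Sum>j\<le>N. if j \<in> J then 1 / real j else 0) > M"
    proof (rule ccontr)
      assume "\<not> ?thesis"
      then have "summable (\<lambda>j. if j \<in> J then 1 / real j else 0)"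
        by (intro bounded_imp_summable[where B = M]) (auto simp: not_less)
      then show False using J(2) by simp
    qed
    then obtain N where N: "(\<Sum>j\<le>N. if j \<in> J then 1 / real j else 0) > M" by blast
    define J' where "J' = {j. j \<in> {..N} \<and> j \<in> J}"
    define H where "H = (\<Sum>j\<in>J'. 1 / real j)"
    have "H = (\<Sum>j\<le>N. if j \<in> J then 1 / real j else 0)"
      unfolding H_def J'_def by (rule sum.inter_filter) simp
    then have H: "H > 1" "H > 2 * K / \<theta> * L" using N by (auto simp: M_def)
    have J': "finite J'" "\<And>j. j \<in> J' \<Longrightarrow> j \<in> J" by (auto simp: J'_def)
    define P where "P = (\<Union>j\<in>J'. A j \<union> B j)"
    have PW: "P \<inter> W j = A j \<union> B j" if "j \<in> J'" for j
    proof (intro equalityI subsetI)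
      fix p assume p: "p \<in> P \<inter> W j"
      then obtain k where k: "k \<in> J'" "p \<in> A k \<union> B k" by (auto simp: P_def)
      then have "p \<in> W k" using AW by blast
      then have "k = j" using disj p by blast
      then show "p \<in> A j \<union> B j" using k by simp
    qed (use that AW in \<open>auto simp: P_def\<close>)
    have PU: "P \<subseteq> (\<Union>j\<in>J'. W j)" using AW unfolding P_def by blast
    have parts: "recip_sum Z = (\<Sum>j\<in>J'. recip_sum (Z \<inter> W j))" if "Z \<subseteq> P" for Z
      using J'(1) finW disj that PU by (intro recip_sum_disjoint_parts) auto
    have "\<theta> / (2 * K) * H \<le> recip_sum P"
      unfolding parts[OF order.refl] H_def sum_distrib_left
      using PW J' AW by (intro sum_mono low) auto
    moreover have "\<theta> / (2 * K) * H \<ge> L" using H(2) \<theta> K by (simp add: field_simps)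
    ultimately have PL: "recip_sum P \<ge> L" by linarith
    have "recip_sum P \<le> C / K * H"
      unfolding parts[OF order.refl] H_def sum_distrib_left
      using PW J' up by (intro sum_mono) auto
    then have cP: "c * recip_sum P \<le> c * (C / K * H)" using \<theta> C by (intro mult_left_mono) (auto simp: c_def)
    have "\<exists>p\<in>P - Z. \<exists>q\<in>P - Z. \<bar>ln (real q) - ln (real p) - real (i' - i) * h\<bar> \<le> \<eta>"
      if Z: "Z \<subseteq> P" "recip_sum Z \<le> c * recip_sum P" for Z
    proof -
      have "\<exists>j\<in>J'. \<not> A j \<subseteq> Z \<and> \<not> B j \<subseteq> Z"
      proof (rule ccontr)
        assume "\<not> ?thesis"
        then have all: "A j \<subseteq> Z \<or> B j \<subseteq> Z" if "j \<in> J'" for j using that by blast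
        have "\<theta> / (2 * K) * H \<le> recip_sum Z"
          unfolding parts[OF Z(1)] H_def sum_distrib_left
        proof (intro sum_mono low)
          fix j assume "j \<in> J'"
          then show "A j \<subseteq> Z \<inter> W j \<or> B j \<subseteq> Z \<inter> W j" using all[of j] AW by blast
        qed (use J' in auto)
        also have "\<dots> \<le> c * (C / K * H)" using Z(2) cP by linarith
        also have "\<dots> = (\<theta> / (2 * K) * H) / 2" using C by (simp add: c_def)
        also have "\<dots> < \<theta> / (2 * K) * H" proof -
          have "\<theta> / (2 * K) * H > 0" using \<theta> K H by (intro mult_pos_pos) auto
          moreover have "x / 2 < x" if "x > 0" for x :: real using that by simp
          ultimately show ?thesis by blast
        qed
        finally show False by simp
      qed
      then obtain j p q where j: "j \<in> J'" and pq: "p \<in> A j" "p \<notin> Z" "q \<in> B j" "q \<notin> Z" by blast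
      have "real i' * h = real i * h + real (i' - i) * h" using ii(1) by (simp add: left_diff_distrib)
      then have "\<bar>ln (real q) - ln (real p) - real (i' - i) * h\<bar> \<le> h"
        using pq(1,3) unfolding A_def B_def log_cell_def log_window_def by (auto simp: distrib_right)
      then show ?thesis using pq j h(2) unfolding P_def by (intro bexI[of _ p] bexI[of _ q]) auto
    qed
    moreover have "finite P"
      using J'(1) finite_subset[OF AW(1) finW] finite_subset[OF AW(2) finW] unfolding P_def by simp
    moreover have "\<forall>p\<in>P. prime p \<and> R p"
      using PU unfolding W_def log_window_def by blast
    ultimately show ?thesis using PL by (intro exI[of _ P]) blast
  qed
  moreover have "c > 0" using \<theta> C by (simp add: c_def)
  ultimately show ?thesis unfolding pair_rich_def by blast
qed

lemma not_summable_reciprocals_from: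
  "\<not> summable (\<lambda>j. if j \<ge> j0 then 1 / real j else 0)"
proof
  assume "summable (\<lambda>j. if j \<ge> j0 then 1 / real j else 0)"
  moreover have "eventually (\<lambda>j. (if j \<ge> j0 then 1 / real j else 0) = real j powr (-1)) sequentially"
    using eventually_ge_at_top[of "max 1 j0"] by eventually_elim (auto simp: powr_minus_divide)
  ultimately have "summable (\<lambda>j. real j powr (-1))" by (subst summable_cong[symmetric])
  then show False unfolding summable_real_powr_iff by simp
qed

text \<open>Every high window contains two rich cells at a distance between \<open>e\<close> and
  \<open>\<epsilon>\<close>, but their positions may vary with the window. There are finitely many
  positions, and the harmonic series diverges, so one position occurs on a set of windows that still
  has divergent reciprocals.\<close>

theorem pair_rich_exists:
  fixes R :: "nat \<Rightarrow> bool"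
  assumes K: "K > 0" and lower: "\<And>u. u \<ge> 1 \<Longrightarrow> (\<Sum>p\<in>log_window R u (u + K). ln (real p) / real p) \<ge> 1"
    and \<epsilon>: "\<epsilon> > 0"
  shows "\<exists>e>0. \<forall>\<eta>>0. \<exists>d. e \<le> d \<and> d \<le> \<epsilon> \<and> pair_rich R d \<eta>"
proof -
  define b where "b = nat \<lceil>K / \<epsilon>\<rceil> + 1"
  have b: "b > 0" "K / real b \<le> \<epsilon>"
  proof -
    have "K / \<epsilon> \<le> real b" unfolding b_def by linarith
    moreover show "b > 0" by (simp add: b_def)
    ultimately show "K / real b \<le> \<epsilon>" using \<epsilon> by (simp add: field_simps)
  qed
  \<comment> \<open>A window of length \<open>t = e + h \<le> 2 * e\<close> has weight at most
    \<open>2 * (exp t - 1) + t \<le> 5 * t\<close>, and \<open>10 * e = 1 / (4 * b)\<close>. Only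
    \<open>K\<close> and \<open>\<epsilon>\<close> enter here, not \<open>\<eta>\<close>.\<close>
  define e where "e = 1 / (40 * real b)"
  have e: "e > 0" "e \<le> 1 / 40" using b by (auto simp: e_def field_simps)
  have "\<exists>d. e \<le> d \<and> d \<le> \<epsilon> \<and> pair_rich R d \<eta>" if \<eta>: "\<eta> > 0" for \<eta>
  proof -
    define m where "m = min \<eta> e"
    have m: "m > 0" using \<eta> e by (simp add: m_def)
    \<comment> \<open>Rounding up makes \<open>b * r\<close> cells of length
      \<open>h \<le> m\<close> fill the window of length \<open>K\<close> exactly, and a block then
      has length \<open>r * h = K / b \<le> \<epsilon>\<close>.\<close>
    define r where "r = nat \<lceil>K / (real b * m)\<rceil> + 1"
    have r: "r > 0" "K / (real b * m) \<le> real r" unfolding r_def by (simp, linarith)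
    define h where "h = K / real (b * r)"
    have h: "h > 0" "h \<le> m" "real (b * r) * h = K" "real r * h \<le> \<epsilon>"
    proof -
      show "h > 0" using K b r by (simp add: h_def)
      show "h \<le> m" using r b m by (simp add: h_def field_simps)
      show "real (b * r) * h = K" using b r by (simp add: h_def)
      show "real r * h \<le> \<epsilon>" using b r by (simp add: h_def)
    qed
    define \<theta> where "\<theta> = 1 / (2 * real (b * r))"
    have \<theta>: "\<theta> > 0" using b r by (simp add: \<theta>_def)
    define C where "C = 2 * (exp K - 1) + 1"
    have "exp K > 1" using K by simp
    then have "2 * exp K > 2" by (simp del: one_less_exp_iff)
    then have C: "C > 0" unfolding C_def right_diff_distrib by linarith
    obtain u1 where u1: "\<And>u. u \<ge> u1 \<Longrightarrow>
        log_weight (log_window R u (u + (e + h))) \<le> 2 * (exp (e + h) - 1) + (e + h)"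
      using sum_log_window_eventually_le[of "e + h" "e + h"] e h
          unfolding log_weight_def by (meson add_pos_pos)
    obtain u2 where u2: "\<And>u. u \<ge> u2 \<Longrightarrow> log_weight (log_window R u (u + K)) \<le> C"
      using sum_log_window_eventually_le[of K 1] K unfolding log_weight_def C_def by (meson zero_less_one)
    have short: "log_weight (log_window R u (u + (e + h))) \<le> 1 / (4 * real b)" if "u \<ge> u1" for u
    proof -
      have eh: "0 \<le> e + h" "e + h \<le> 1" "e + h \<le> 2 * e" using e h by (auto simp: m_def)
      have "exp (e + h) \<le> 1 + (e + h) + (e + h) ^ 2" using eh by (intro exp_bound) auto
      moreover have "(e + h) ^ 2 \<le> (e + h) * 1"
          unfolding power2_eq_square using eh by (intro mult_left_mono) auto
      moreover have "w \<le> 5 * (2 * e)" if "E \<le> 1 + t + s" "s \<le> t * 1" "w \<le> 2 * (E - 1) + t" "t \<le> 2 * e"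
          for w E s t :: real
        using that by simp
      ultimately have "log_weight (log_window R u (u + (e + h))) \<le> 5 * (2 * e)"
        using u1[OF that] eh(3) by blast
      also have "\<dots> = 1 / (4 * real b)" by (simp add: e_def)
      finally show ?thesis .
    qed
    define j0 where "j0 = nat \<lceil>max (max 1 (1 / K)) (max (u1 / K) (u2 / K))\<rceil>"
    have j0: "real j * K \<ge> 1 \<and> real j * K \<ge> u1 \<and> real j * K \<ge> u2 \<and> j \<noteq> 0" if "j \<ge> j0" for j
    proof -
      have "max (max 1 (1 / K)) (max (u1 / K) (u2 / K)) \<le> real j" using that unfolding j0_def by linarith
      then have "1 \<le> real j" "1 / K \<le> real j" "u1 / K \<le> real j" "u2 / K \<le> real j" by simp_all
      then show ?thesis using K by (simp add: pos_divide_le_eq)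
    qed
    have "\<exists>x. fst x < snd x \<and> snd x < b * r \<and> e \<le> real (snd x - fst x) * h \<and>
        real (snd x - fst x) * h \<le> real r * h \<and>
        log_weight (log_cell R (real j * K) h (fst x)) \<ge> \<theta> \<and>
            log_weight (log_cell R (real j * K) h (snd x)) \<ge> \<theta>"
      if "j \<ge> j0" for j
    proof -
      have "\<exists>i i'. i < i' \<and> i' < b * r \<and> e \<le> real (i' - i) * h \<and> real (i' - i) * h \<le> real r * h \<and>
        log_weight (log_cell R (real j * K) h i) \<ge> 1 / (2 * real (b * r)) \<and>
        log_weight (log_cell R (real j * K) h i') \<ge> 1 / (2 * real (b * r))"
      proof (rule rich_cells[OF b(1) r(1) h(1)])
        show "h \<le> e" using h(2) by (simp add: m_def)
        show "1 \<le> log_weight (log_window R (real j * K) (real j * K + real (b * r) * h))"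
          unfolding h(3) log_weight_def using lower j0[OF that] by blast
        show "log_weight (log_window R v (v + (e + h))) \<le> 1 / (4 * real b)" if "real j * K \<le> v" for v
          using j0[OF \<open>j \<ge> j0\<close>] that by (intro short) linarith
      qed
      then show ?thesis unfolding \<theta>_def by auto
    qed
    then obtain f :: "nat \<Rightarrow> nat \<times> nat" where f: "\<And>j. j \<ge> j0 \<Longrightarrow> fst (f j) < snd (f j) \<and> snd (f j) < b * r \<and>
        e \<le> real (snd (f j) - fst (f j)) * h \<and> real (snd (f j) - fst (f j)) * h \<le> real r * h \<and>
        log_weight (log_cell R (real j * K) h (fst (f j))) \<ge> \<theta> \<and>
            log_weight (log_cell R (real j * K) h (snd (f j))) \<ge> \<theta>"
      by metis
    define I where "I = {..<b * r} \<times> {..<b * r}"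
    have fI: "f j \<in> I" if "j \<ge> j0" for j
      using f[OF that] unfolding I_def by (cases "f j") auto
    \<comment> \<open>Otherwise the tail of the harmonic series would be a finite sum of summable
      series.\<close>
    have "\<exists>x\<in>I. \<not> summable (\<lambda>j. if j \<in> {j. j \<ge> j0 \<and> f j = x} then 1 / real j else 0)"
    proof (rule ccontr)
      assume "\<not> ?thesis"
      then have "summable (\<lambda>j. \<Sum>x\<in>I. if j \<in> {j. j \<ge> j0 \<and> f j = x} then 1 / real j else 0)"
        by (intro summable_sum) blast
      moreover have "(\<Sum>x\<in>I. if j \<in> {j. j \<ge> j0 \<and> f j = x} then 1 / real j else 0)
          = (if j \<ge> j0 then 1 / real j else 0)" for j
      proof (cases "j \<ge> j0")
        case True
        then have "(\<Sum>x\<in>I. if j \<in> {j. j \<ge> j0 \<and> f j = x} then 1 / real j else 0)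
            = (\<Sum>x\<in>I. if f j = x then 1 / real j else 0)"
          by simp
        also have "\<dots> = 1 / real j" using fI[OF True] by (simp add: I_def sum.delta')
        finally show ?thesis using True by simp
      qed simp
      ultimately show False using not_summable_reciprocals_from[of j0] by simp
    qed
    then obtain x where x: "\<not> summable (\<lambda>j. if j \<in> {j. j \<ge> j0 \<and> f j = x} then 1 / real j else 0)" by blast
    define J where "J = {j. j \<ge> j0 \<and> f j = x}"
    have "J \<noteq> {}" using x unfolding J_def[symmetric] by auto
    then obtain j1 where j1: "j1 \<ge> j0" "f j1 = x" unfolding J_def by blast
    note fx = f[OF j1(1), unfolded j1(2)]
    have "pair_rich R (real (snd x - fst x) * h) \<eta>"
    proof (rule pair_rich_from_cells[OF K \<theta> C h(1)])
      show "h \<le> \<eta>" using h(2) by (simp add: m_def)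
      show "fst x < snd x" using fx by blast
      have "Suc (snd x) \<le> b * r" using fx by auto
      then have "real (Suc (snd x)) \<le> real (b * r)" by (simp only: of_nat_le_iff)
      then have "real (Suc (snd x)) * h \<le> real (b * r) * h" using h(1) by (intro mult_right_mono) auto
      then show "real (Suc (snd x)) * h \<le> K" unfolding h(3) .
      show "0 \<notin> J" using j0[of 0] unfolding J_def by auto
      show "\<not> summable (\<lambda>j. if j \<in> J then 1 / real j else 0)" using x unfolding J_def .
      fix j assume "j \<in> J"
      then have j: "j \<ge> j0" "f j = x" by (auto simp: J_def)
      show "\<theta> \<le> log_weight (log_cell R (real j * K) h (fst x))" "\<theta>
          \<le> log_weight (log_cell R (real j * K) h (snd x))"
        using f[OF j(1)] j(2) by auto
      show "log_weight (log_window R (real j * K) (real j * K + K)) \<le> C"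
        using j0[OF j(1)] by (intro u2) auto
    qed
    moreover have "e \<le> real (snd x - fst x) * h" "real (snd x - fst x) * h \<le> \<epsilon>"
      using fx h(4) by linarith+
    ultimately show ?thesis by blast
  qed
  then show ?thesis using e by blast
qed

section \<open>Shift invariance\<close>

definition unit_bounded :: "(nat \<Rightarrow> complex) \<Rightarrow> bool" where
  "unit_bounded F \<longleftrightarrow> (\<forall>k. norm (F k) \<le> 1)"

abbreviation shift :: "(nat \<Rightarrow> complex) \<Rightarrow> nat \<Rightarrow> complex" where
  "shift F \<equiv> (\<lambda>k. F (Suc k))"

lemma unit_bounded_shift: "unit_bounded F \<Longrightarrow> unit_bounded (shift F)"
  by (simp add: unit_bounded_def)

lemma recip_sum_UN_le:
  assumes "finite I" "\<And>i. i \<in> I \<Longrightarrow> finite (A i)"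
  shows "recip_sum (\<Union>i\<in>I. A i) \<le> (\<Sum>i\<in>I. recip_sum (A i))"
  using assms
proof (induction I rule: finite_induct)
  case (insert i I)
  define U where "U = (\<Union>i\<in>I. A i)"
  have fin: "finite (A i)" "finite U" using insert by (auto simp: U_def)
  have "A i \<union> U = A i \<union> (U - A i)" by blast
  then have "recip_sum (A i \<union> U) = recip_sum (A i \<union> (U - A i))" by simp
  also have "\<dots> = recip_sum (A i) + recip_sum (U - A i)"
    unfolding recip_sum_def using fin by (intro sum.union_disjoint) auto
  also have "\<dots> \<le> recip_sum (A i) + recip_sum U" using fin by (intro add_left_mono recip_sum_mono) auto
  also have "recip_sum U \<le> (\<Sum>i\<in>I. recip_sum (A i))" unfolding U_def using insert by simp
  finally show ?case using insert by (simp add: U_def)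
qed (simp add: recip_sum_def)

lemma Re_scale: "Re (of_real r * z) = r * Re z"
  by simp

text \<open>\<open>\<Phi> F u\<close> stands for the mean of a periodic weight times \<open>F \<circ> \<Omega>\<close> up to \<open>exp u\<close>. It is nearly
  harmonic for the random walk that shifts \<open>F\<close> and moves \<open>u\<close> by \<open>- ln p\<close>.\<close>

locale harmonic_family =
  fixes \<Phi> :: "(nat \<Rightarrow> complex) \<Rightarrow> real \<Rightarrow> complex" and R :: "nat \<Rightarrow> bool"
  assumes bound: "unit_bounded F \<Longrightarrow> norm (\<Phi> F u) \<le> 1"
    and slow: "unit_bounded F \<Longrightarrow> norm (\<Phi> F u - \<Phi> F v) \<le> 2 * \<bar>u - v\<bar> + exp (- min u v)"
    and harmonic: "finite P \<Longrightarrow> (\<And>p. p \<in> P \<Longrightarrow> prime p \<and> R p) \<Longrightarrow>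
      \<exists>u0. \<forall>u\<ge>u0. \<forall>F. unit_bounded F \<longrightarrow>
        norm (of_real (recip_sum P) * \<Phi> F u - (\<Sum>p\<in>P. of_real (1 / real p) * \<Phi> (shift F) (u - ln (real p))))
          \<le> sqrt (2 * recip_sum P)"
begin

definition diff :: "real \<Rightarrow> (nat \<Rightarrow> complex) \<Rightarrow> real \<Rightarrow> complex" where
  "diff d F u = \<Phi> F u - \<Phi> F (u - d)"

lemma norm_diff_le: "unit_bounded F \<Longrightarrow> norm (diff d F u) \<le> 2"
  unfolding diff_def using bound[of F u] bound[of F "u - d"] norm_triangle_ineq4[of "\<Phi> F u" "\<Phi> F (u - d)"]
      by linarith

lemma diff_slow:
  assumes "unit_bounded F" "d \<ge> 0"
  shows "norm (diff d F u - diff d F v) \<le> 4 * \<bar>u - v\<bar> + 2 * exp (d - min u v)"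
proof -
  have "diff d F u - diff d F v = (\<Phi> F u - \<Phi> F v) - (\<Phi> F (u - d) - \<Phi> F (v - d))" by (simp add: diff_def)
  then have "norm (diff d F u - diff d F v) \<le> norm (\<Phi> F u - \<Phi> F v) + norm (\<Phi> F (u - d) - \<Phi> F (v - d))"
    by (metis norm_triangle_ineq4)
  moreover have "exp (- min u v) \<le> exp (d - min u v)" using assms by simp
  moreover have "- min (u - d) (v - d) = d - min u v" "\<bar>u - d - (v - d)\<bar> = \<bar>u - v\<bar>" by auto
  ultimately show ?thesis
    using slow[OF assms(1), of u v] slow[OF assms(1), of "u - d" "v - d"] by (simp only:)
qed

lemma diff_harmonic:
  assumes "finite P" "\<And>p. p \<in> P \<Longrightarrow> prime p \<and> R p"
  shows "\<exists>u0. \<forall>u\<ge>u0. \<forall>F. unit_bounded F \<longrightarrow>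
     norm (of_real (recip_sum P) * diff d F u
         - (\<Sum>p\<in>P. of_real (1 / real p) * diff d (shift F) (u - ln (real p))))
       \<le> 2 * sqrt (2 * recip_sum P)"
proof -
  define E where "E F u = of_real (recip_sum P) * \<Phi> F u
      - (\<Sum>p\<in>P. of_real (1 / real p) * \<Phi> (shift F) (u - ln (real p)))" for F u
  obtain u0 where u0: "\<And>u F. u \<ge> u0 \<Longrightarrow> unit_bounded F \<Longrightarrow> norm (E F u) \<le> sqrt (2 * recip_sum P)"
    using harmonic[OF assms] unfolding E_def by blast
  have "norm (of_real (recip_sum P) * diff d F u
      - (\<Sum>p\<in>P. of_real (1 / real p) * diff d (shift F) (u - ln (real p))))
       \<le> 2 * sqrt (2 * recip_sum P)" if "u \<ge> max u0 (u0 + d)" "unit_bounded F" for u F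
  proof -
    have "of_real (recip_sum P) * diff d F u
        - (\<Sum>p\<in>P. of_real (1 / real p) * diff d (shift F) (u - ln (real p)))
       = E F u - E F (u - d)"
      unfolding E_def diff_def by (simp add: algebra_simps sum_subtractf)
    also have "norm \<dots> \<le> norm (E F u) + norm (E F (u - d))" by (rule norm_triangle_ineq4)
    also have "\<dots> \<le> sqrt (2 * recip_sum P) + sqrt (2 * recip_sum P)"
      using that by (intro add_mono u0) auto
    finally show ?thesis by simp
  qed
  then show ?thesis by blast
qed

text \<open>The set of eventual bounds that hold for all admissible \<open>F\<close> at once. Its
  infimum \<open>asymp_sup d\<close> is the limit superior, as \<open>u\<close> tends to infinity,
  of the supremum of \<open>norm (diff d F u)\<close> over \<open>F\<close>.\<close>

definition asymp_bounds :: "real \<Rightarrow> real set" where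
  "asymp_bounds d = {t. \<exists>u0. \<forall>u\<ge>u0. \<forall>F. unit_bounded F \<longrightarrow> norm (diff d F u) \<le> t}"

definition asymp_sup :: "real \<Rightarrow> real" where
  "asymp_sup d = Inf (asymp_bounds d)"

lemma asymp_sup_upper:
  assumes "\<delta> > 0"
  shows "\<exists>u0. \<forall>u\<ge>u0. \<forall>F. unit_bounded F \<longrightarrow> norm (diff d F u) \<le> asymp_sup d + \<delta>"
proof -
  have ne: "asymp_bounds d \<noteq> {}" using norm_diff_le unfolding asymp_bounds_def by blast
  then obtain t where "t \<in> asymp_bounds d" "t < asymp_sup d + \<delta>"
    using cInf_lessD[OF ne, of "asymp_sup d + \<delta>"] assms unfolding asymp_sup_def by auto
  then obtain u0 where u0: "\<And>u F. u \<ge> u0 \<Longrightarrow> unit_bounded F \<Longrightarrow> norm (diff d F u) \<le> t"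
    unfolding asymp_bounds_def by blast
  have "norm (diff d F u) \<le> asymp_sup d + \<delta>" if "u \<ge> u0" "unit_bounded F" for u F
    using u0[OF that] \<open>t < asymp_sup d + \<delta>\<close> by linarith
  then show ?thesis by blast
qed

lemma asymp_sup_lower:
  assumes "\<delta> > 0"
  shows "\<exists>u\<ge>u0. \<exists>F. unit_bounded F \<and> norm (diff d F u) > asymp_sup d - \<delta>"
proof (rule ccontr)
  assume "\<not> ?thesis"
  then have "asymp_sup d - \<delta> \<in> asymp_bounds d" unfolding asymp_bounds_def by (auto simp: not_less)
  moreover have "bdd_below (asymp_bounds d)"
  proof (rule bdd_belowI)
    fix t assume "t \<in> asymp_bounds d"
    then obtain u0 where "\<And>u F. u \<ge> u0 \<Longrightarrow> unit_bounded F \<Longrightarrow> norm (diff d F u) \<le> t"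
        unfolding asymp_bounds_def by blast
    from this[of u0 "\<lambda>_. 0"] show "0 \<le> t" by (simp add: unit_bounded_def) (meson norm_ge_zero order_trans)
  qed
  ultimately have "asymp_sup d \<le> asymp_sup d - \<delta>" unfolding asymp_sup_def by (intro cInf_lower) auto
  then show False using assms by simp
qed

text \<open>Markov's inequality: values that never exceed \<open>D + \<delta>0\<close> but average
  at least \<open>D - 2 * \<delta>0\<close> cannot fall below \<open>D - \<delta>\<close> on a large
  proportion of \<open>P\<close>.\<close>

lemma recip_sum_exceptional_le:
  assumes P: "finite P" and L: "recip_sum P > 0" and y: "\<And>p. p \<in> P \<Longrightarrow> y p \<le> D + \<delta>0"
    and avg: "recip_sum P * (D - 2 * \<delta>0) \<le> (\<Sum>p\<in>P. 1 / real p * y p)" and \<delta>: "\<delta> > 0" "\<delta>0 \<ge> 0"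
  shows "recip_sum {p \<in> P. y p < D - \<delta>} \<le> 3 * \<delta>0 / \<delta> * recip_sum P"
proof -
  define Z where "Z = {p \<in> P. y p < D - \<delta>}"
  have "(\<Sum>p\<in>P. 1 / real p * y p) \<le> (\<Sum>p\<in>P. 1 / real p * (D + \<delta>0) - (if p \<in> Z then 1 / real p * \<delta> else 0))"
  proof (rule sum_mono)
    fix p assume p: "p \<in> P"
    show "1 / real p * y p \<le> 1 / real p * (D + \<delta>0) - (if p \<in> Z then 1 / real p * \<delta> else 0)"
    proof (cases "p \<in> Z")
      case True
      then have "y p \<le> D + \<delta>0 - \<delta>" using \<delta> by (simp add: Z_def)
      then have "1 / real p * y p \<le> 1 / real p * (D + \<delta>0 - \<delta>)" by (intro mult_left_mono) auto
      then show ?thesis using True by (simp add: diff_divide_distrib)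
    next
      case False
      then show ?thesis using mult_left_mono[OF y[OF p], of "1 / real p"] by simp
    qed
  qed
  also have "\<dots> = recip_sum P * (D + \<delta>0) - (\<Sum>p\<in>P. if p \<in> Z then 1 / real p * \<delta> else 0)"
    by (simp add: sum_subtractf recip_sum_def sum_distrib_right sum_divide_distrib)
  also have "(\<Sum>p\<in>P. if p \<in> Z then 1 / real p * \<delta> else 0) = (\<Sum>p | p \<in> P \<and> p \<in> Z. 1 / real p * \<delta>)"
    by (rule sum.inter_filter[OF P, symmetric])
  also have "{p. p \<in> P \<and> p \<in> Z} = Z" by (auto simp: Z_def)
  also have "(\<Sum>p\<in>Z. 1 / real p * \<delta>) = recip_sum Z * \<delta>" unfolding recip_sum_def sum_distrib_right ..
  finally have "recip_sum Z * \<delta> \<le> 3 * \<delta>0 * recip_sum P" using avg by (simp add: algebra_simps)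
  then show ?thesis using \<delta> by (simp add: Z_def pos_le_divide_eq)
qed

text \<open>The Choquet-Deny argument: near-extremality survives a step by \<open>ln p\<close> for almost all \<open>p\<close>. In each
  step all points move by the same \<open>ln p\<close>, and a copy of the last one moves by
  \<open>ln q \<approx> ln p + d\<close>; after \<open>i\<close> steps the points approximate a progression with difference \<open>d\<close>.\<close>

lemma extremal_chain:
  assumes rich: "pair_rich R d \<eta>" and d: "d \<ge> 0"
  shows "\<delta> > 0 \<Longrightarrow> \<exists>F \<omega> v x. unit_bounded F \<and> norm \<omega> = 1 \<and> (\<forall>l\<le>i. x l \<ge> u0 \<and>
    \<bar>x l - (v - real l * d)\<bar> \<le> real i * \<eta> \<and> Re (cnj \<omega> * diff d F (x l)) \<ge> asymp_sup d - \<delta>)"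
proof (induction i arbitrary: \<delta> u0)
  case 0
  obtain u F where F: "u \<ge> u0" "unit_bounded F" "norm (diff d F u) > asymp_sup d - \<delta>"
    using asymp_sup_lower[OF 0, of u0 d] by blast
  define z where "z = diff d F u"
  \<comment> \<open>The direction of the extremal value. It stays fixed during all later steps, so
    the values at the end nearly point the same way and cannot cancel when summed.\<close>
  define \<omega> where "\<omega> = (if z = 0 then 1 else sgn z)"
  have "cnj \<omega> * z = of_real (norm z)"
  proof (cases "z = 0")
    case False
    have "cnj (sgn z) * z = (z * cnj z) / of_real (norm z)"
        by (simp add: sgn_div_norm scaleR_conv_of_real field_simps)
    also have "z * cnj z = of_real (norm z) ^ 2"
        by (rule complex_norm_square[symmetric, unfolded of_real_power])
    finally show ?thesis using False by (simp add: \<omega>_def power2_eq_square)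
  qed (simp add: \<omega>_def)
  then have "Re (cnj \<omega> * diff d F u) = norm (diff d F u)" by (simp add: z_def)
  moreover have "norm \<omega> = 1" by (simp add: \<omega>_def norm_sgn)
  ultimately show ?case using F
    by (intro exI[of _ F] exI[of _ \<omega>] exI[of _ u] exI[of _ "\<lambda>_. u"]) auto
next
  case (Suc i)
  define D where "D = asymp_sup d"
  obtain c where c: "c > 0" "\<And>L. \<exists>P. finite P \<and> (\<forall>p\<in>P. prime p \<and> R p) \<and> recip_sum P \<ge> L \<and>
     (\<forall>Z\<subseteq>P. recip_sum Z \<le> c * recip_sum P \<longrightarrow>
        (\<exists>p\<in>P - Z. \<exists>q\<in>P - Z. \<bar>ln (real q) - ln (real p) - d\<bar> \<le> \<eta>))"
    using rich unfolding pair_rich_def by blast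
  \<comment> \<open>Each of the \<open>i + 1\<close> points excludes a proportion
    \<open>3 * \<delta>0 / \<delta>\<close> of the primes; with this choice all exclusions together
    stay within the proportion \<open>c\<close> allowed by \<open>pair_rich\<close>.\<close>
  define \<delta>0 where "\<delta>0 = c * \<delta> / (3 * real (Suc i))"
  have \<delta>0: "\<delta>0 > 0" using c(1) Suc.prems by (simp add: \<delta>0_def)
  from c(2)[of "max 1 (8 / \<delta>0 ^ 2)"] obtain P
      where "finite P \<and> (\<forall>p\<in>P. prime p \<and> R p) \<and> recip_sum P \<ge> max 1 (8 / \<delta>0 ^ 2) \<and>
     (\<forall>Z\<subseteq>P. recip_sum Z \<le> c * recip_sum P \<longrightarrow>
        (\<exists>p\<in>P - Z. \<exists>q\<in>P - Z. \<bar>ln (real q) - ln (real p) - d\<bar> \<le> \<eta>))" ..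
  then have P: "finite P" "\<And>p. p \<in> P \<Longrightarrow> prime p \<and> R p"
      "recip_sum P \<ge> max 1 (8 / \<delta>0 ^ 2)" and
      Z: "\<And>Z. Z \<subseteq> P \<Longrightarrow> recip_sum Z \<le> c * recip_sum P \<Longrightarrow>
        \<exists>p\<in>P - Z. \<exists>q\<in>P - Z. \<bar>ln (real q) - ln (real p) - d\<bar> \<le> \<eta>"
    by blast+
  define L where "L = recip_sum P"
  have L: "L \<ge> 1" "L \<ge> 8 / \<delta>0 ^ 2" using P(3) by (auto simp: L_def)
  have err: "2 * sqrt (2 * L) \<le> \<delta>0 * L"
  proof -
    have "8 \<le> L * \<delta>0 ^ 2" using L(2) \<delta>0 by (simp add: pos_divide_le_eq)
    then have "8 * L \<le> L * \<delta>0 ^ 2 * L" using L(1) by (intro mult_right_mono) auto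
    then have "2 ^ 2 * (2 * L) \<le> (\<delta>0 * L) ^ 2" by (simp add: power2_eq_square mult_ac)
    then have "sqrt (2 ^ 2 * (2 * L)) \<le> \<delta>0 * L" using \<delta>0 L(1) by (intro real_le_lsqrt) auto
    moreover have "sqrt (2 ^ 2 * (2 * L)) = 2 * sqrt (2 * L)"
      by (subst real_sqrt_mult) (simp only: real_sqrt_abs abs_numeral)
    ultimately show ?thesis by simp
  qed
  obtain u1 where u1: "\<And>u F. u \<ge> u1 \<Longrightarrow> unit_bounded F \<Longrightarrow>
     norm (of_real L * diff d F u - (\<Sum>p\<in>P. of_real (1 / real p) * diff d (shift F) (u - ln (real p))))
         \<le> 2 * sqrt (2 * L)"
    using diff_harmonic[OF P(1,2), of d] unfolding L_def by blast
  obtain u2 where u2: "\<And>u F. u \<ge> u2 \<Longrightarrow> unit_bounded F \<Longrightarrow> norm (diff d F u) \<le> D + \<delta>0"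
    using asymp_sup_upper[OF \<delta>0, of d] unfolding D_def by blast
  \<comment> \<open>A bound for a single step. Starting \<open>M\<close> above the thresholds leaves
    the points above them after the step.\<close>
  define M where "M = (\<Sum>p\<in>P. ln (real p))"
  have M: "ln (real p) \<le> M" if "p \<in> P" for p
    unfolding M_def using P that prime_ge_1_nat by (intro member_le_sum) force+
  obtain F \<omega> v x where F: "unit_bounded F" and \<omega>: "norm \<omega> = 1"
      and x: "\<And>l. l \<le> i \<Longrightarrow> x l \<ge> max u1 (M + max u0 u2) \<and>
    \<bar>x l - (v - real l * d)\<bar> \<le> real i * \<eta> \<and> Re (cnj \<omega> * diff d F (x l)) \<ge> D - \<delta>0"
    using Suc.IH[OF \<delta>0, of "max u1 (M + max u0 u2)"] unfolding D_def by blast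
  define y where "y l p = Re (cnj \<omega> * diff d (shift F) (x l - ln (real p)))" for l p
  have big: "x l - ln (real p) \<ge> u0" "x l - ln (real p) \<ge> u2" if "l \<le> i" "p \<in> P" for l p
    using x[OF that(1)] M[OF that(2)] by linarith+
  have bad: "recip_sum {p \<in> P. y l p < D - \<delta>} \<le> 3 * \<delta>0 / \<delta> * L" if l: "l \<le> i" for l
    unfolding L_def
  proof (rule recip_sum_exceptional_le)
    fix p assume p: "p \<in> P"
    have "y l p \<le> norm (cnj \<omega> * diff d (shift F) (x l - ln (real p)))"
        unfolding y_def by (rule complex_Re_le_cmod)
    also have "\<dots> \<le> D + \<delta>0" using u2[OF big(2)[OF l p] unit_bounded_shift[OF F]] \<omega> by (simp add: norm_mult)
    finally show "y l p \<le> D + \<delta>0" .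
  next
    define T where "T = of_real L * diff d F (x l)
        - (\<Sum>p\<in>P. of_real (1 / real p) * diff d (shift F) (x l - ln (real p)))"
    have T: "norm T \<le> \<delta>0 * L" using u1[of "x l" F] x[OF l] F err unfolding T_def by auto
    have "Re (cnj \<omega> * T) \<le> norm (cnj \<omega> * T)" by (rule complex_Re_le_cmod)
    also have "\<dots> \<le> \<delta>0 * L" using T \<omega> by (simp add: norm_mult)
    finally have 1: "Re (cnj \<omega> * T) \<le> \<delta>0 * L" .
    have "cnj \<omega> * T = of_real L * (cnj \<omega> * diff d F (x l))
        - (\<Sum>p\<in>P. of_real (1 / real p) * (cnj \<omega> * diff d (shift F) (x l - ln (real p))))"
      unfolding T_def right_diff_distrib sum_distrib_left by (simp only: mult.left_commute)
    then have "Re (cnj \<omega> * T) = L * Re (cnj \<omega> * diff d F (x l)) - (\<Sum>p\<in>P. 1 / real p * y l p)"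
      by (simp only: minus_complex.sel Re_sum y_def Re_scale)
    moreover have "L * (D - \<delta>0) \<le> L * Re (cnj \<omega> * diff d F (x l))"
        using x[OF l] L(1) by (intro mult_left_mono) auto
    ultimately show "recip_sum P * (D - 2 * \<delta>0) \<le> (\<Sum>p\<in>P. 1 / real p * y l p)"
      using 1 unfolding L_def by (simp add: algebra_simps)
  qed (use P(1) L(1) Suc.prems \<delta>0 in \<open>auto simp: L_def\<close>)
  define Z' where "Z' = (\<Union>l\<in>{..i}. {p \<in> P. y l p < D - \<delta>})"
  have "recip_sum Z' \<le> (\<Sum>l\<in>{..i}. recip_sum {p \<in> P. y l p < D - \<delta>})"
    unfolding Z'_def recip_sum_def using P(1) by (intro recip_sum_UN_le[unfolded recip_sum_def]) auto
  also have "\<dots> \<le> (\<Sum>l\<in>{..i}. 3 * \<delta>0 / \<delta> * L)" by (intro sum_mono bad) auto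
  also have "\<dots> = (3 * \<delta>0 * real (Suc i)) / \<delta> * L" by simp
  also have "3 * \<delta>0 * real (Suc i) = c * \<delta>" unfolding \<delta>0_def by (simp del: of_nat_Suc)
  also have "c * \<delta> / \<delta> * L = c * L" using Suc.prems by simp
  finally obtain p q where pq: "p \<in> P - Z'" "q \<in> P - Z'" "\<bar>ln (real q) - ln (real p) - d\<bar> \<le> \<eta>"
    using Z[of Z'] unfolding L_def Z'_def by blast
  have good: "y l p \<ge> D - \<delta>" "y l q \<ge> D - \<delta>" if "l \<le> i" for l
    using pq(1,2) that unfolding Z'_def by force+
  \<comment> \<open>All existing points move by \<open>ln p\<close>; the new point is the last old
    one moved by \<open>ln q\<close> instead. Both use the same shift of \<open>F\<close>, and the
    gap errs by at most one further \<open>\<eta>\<close>.\<close>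
  define x' where "x' l = (if l \<le> i then x l - ln (real p) else x i - ln (real q))" for l
  have "x' l \<ge> u0 \<and> \<bar>x' l - (v - ln (real p) - real l * d)\<bar> \<le> real (Suc i) * \<eta> \<and>
      Re (cnj \<omega> * diff d (shift F) (x' l)) \<ge> D - \<delta>"
    if l: "l \<le> Suc i" for l
  proof (cases "l \<le> i")
    case True
    have "\<eta> \<ge> 0" using pq(3) by linarith
    then show ?thesis
      using True x[OF True] big(1)[OF True] pq(1) good(1)[OF True]
          unfolding x'_def y_def by (auto simp: algebra_simps)
  next
    case False
    then have l: "l = Suc i" using that by simp
    have "x' l - (v - ln (real p) - real l * d) = (x i - (v - real i * d)) - (ln (real q) - ln (real p) - d)"
      by (simp add: x'_def l algebra_simps)
    moreover have "\<bar>x i - (v - real i * d)\<bar> \<le> real i * \<eta>" using x[of i] by simp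
    ultimately have "\<bar>x' l - (v - ln (real p) - real l * d)\<bar> \<le> real (Suc i) * \<eta>"
      using pq(3) by (simp add: algebra_simps)
    then show ?thesis using big(1)[of i q] pq(2) good(2)[of i] l unfolding x'_def y_def by auto
  qed
  then show ?case using unit_bounded_shift[OF F] \<omega> unfolding D_def by blast
qed

text \<open>Along the chain \<open>k + 1\<close> nearly extremal differences point in the same
  direction, while their sum telescopes to a difference of two values of \<open>\<Phi>\<close>, of
  norm at most 2. So the extremal value is at most \<open>2 / (k + 1)\<close> up to the
  errors.\<close>

lemma translation_invariant:
  assumes rich: "pair_rich R d \<eta>" and d: "d \<ge> 0" and \<eta>: "\<eta> \<ge> 0"
    and \<tau>: "\<tau> > 0" "2 / real (Suc k) + 4 * (real k * \<eta>) \<le> \<tau> / 2"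
  shows "\<exists>u0. \<forall>u\<ge>u0. \<forall>F. unit_bounded F \<longrightarrow> norm (diff d F u) \<le> \<tau>"
proof -
  define D where "D = asymp_sup d"
  \<comment> \<open>Beyond height \<open>s\<close> the exponential term in the slow variation is at
    most \<open>\<tau> / 16\<close>.\<close>
  define s where "s = ln (16 / \<tau>)"
  have s: "exp (- s) = \<tau> / 16" using \<tau>(1) by (simp add: s_def exp_minus)
  obtain F \<omega> v x where F: "unit_bounded F" and \<omega>: "norm \<omega> = 1" and x: "\<And>l. l \<le> k \<Longrightarrow> x l \<ge> s + d + real k * \<eta> \<and>
    \<bar>x l - (v - real l * d)\<bar> \<le> real k * \<eta> \<and> Re (cnj \<omega> * diff d F (x l)) \<ge> D - \<tau> / 8"
    using extremal_chain[OF rich d, of "\<tau> / 8" k "s + d + real k * \<eta>"] \<tau>(1) unfolding D_def by auto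
  have "D - \<tau> / 4 - 4 * (real k * \<eta>) \<le> Re (cnj \<omega> * diff d F (v - real l * d))" if l: "l \<le> k" for l
  proof -
    define y where "y = v - real l * d"
    have xl: "x l \<ge> s + d + real k * \<eta>" "\<bar>x l - y\<bar> \<le> real k * \<eta>" "Re (cnj \<omega> * diff d F (x l)) \<ge> D - \<tau> / 8"
      using x[OF l] by (auto simp: y_def)
    have "d - min (x l) y \<le> - s" using xl(1,2) \<eta> by (auto simp: min_def)
    then have "exp (d - min (x l) y) \<le> \<tau> / 16" unfolding s[symmetric] by simp
    then have "4 * \<bar>x l - y\<bar> + 2 * exp (d - min (x l) y) \<le> 4 * (real k * \<eta>) + 2 * (\<tau> / 16)"
      using xl(2) by (intro add_mono mult_left_mono) auto
    then have "norm (diff d F (x l) - diff d F y) \<le> 4 * (real k * \<eta>) + \<tau> / 8"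
      using diff_slow[OF F d, of "x l" y] by simp
    moreover have "Re (cnj \<omega> * (diff d F (x l) - diff d F y)) \<le> norm (cnj \<omega> * (diff d F (x l) - diff d F y))"
      by (rule complex_Re_le_cmod)
    ultimately have "Re (cnj \<omega> * (diff d F (x l) - diff d F y)) \<le> 4 * (real k * \<eta>) + \<tau> / 8"
      using \<omega> by (simp add: norm_mult)
    then show ?thesis using xl(3) unfolding y_def[symmetric] right_diff_distrib minus_complex.sel by simp
  qed
  then have "(\<Sum>l<Suc k. D - \<tau> / 4 - 4 * (real k * \<eta>)) \<le> (\<Sum>l<Suc k. Re (cnj \<omega> * diff d F (v - real l * d)))"
    by (intro sum_mono) auto
  also have "\<dots> = Re (cnj \<omega> * (\<Sum>l<Suc k. diff d F (v - real l * d)))"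
    by (simp only: Re_sum sum_distrib_left)
  also have "(\<Sum>l<Suc k. diff d F (v - real l * d)) = \<Phi> F v - \<Phi> F (v - real (Suc k) * d)"
  proof (induction k)
    case (Suc k)
    show ?case unfolding sum.lessThan_Suc[of _ "Suc k"] Suc by (simp add: diff_def algebra_simps)
  qed (simp add: diff_def)
  also have "Re (cnj \<omega> * (\<Phi> F v - \<Phi> F (v - real (Suc k) * d)))
      \<le> norm (cnj \<omega> * (\<Phi> F v - \<Phi> F (v - real (Suc k) * d)))"
    by (rule complex_Re_le_cmod)
  also have "\<dots> = norm (\<Phi> F v - \<Phi> F (v - real (Suc k) * d))" using \<omega> by (simp add: norm_mult)
  also have "\<dots> \<le> norm (\<Phi> F v) + norm (\<Phi> F (v - real (Suc k) * d))" by (rule norm_triangle_ineq4)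
  also have "\<dots> \<le> 1 + 1" by (intro add_mono bound F)
  finally have "real (Suc k) * (D - \<tau> / 4 - 4 * (real k * \<eta>)) \<le> 2" by simp
  then have "D - \<tau> / 4 - 4 * (real k * \<eta>) \<le> 2 / real (Suc k)" by (simp add: pos_le_divide_eq mult.commute)
  then have D: "D + \<tau> / 4 \<le> \<tau>" using \<tau>(2) by linarith
  obtain u0 where u0: "\<And>u F. u \<ge> u0 \<Longrightarrow> unit_bounded F \<Longrightarrow> norm (diff d F u) \<le> D + \<tau> / 4"
    using asymp_sup_upper[of "\<tau> / 4" d] \<tau>(1) unfolding D_def by auto
  have "norm (diff d F u) \<le> \<tau>" if "u \<ge> u0" "unit_bounded F" for u F
    using u0[OF that] D by linarith
  then show ?thesis by blast
qed

lemma translation_iterate: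
  assumes "\<And>u. u \<ge> u0 \<Longrightarrow> norm (diff d F u) \<le> \<tau>" and d: "d \<ge> 0" and "u - real m * d \<ge> u0"
  shows "norm (\<Phi> F u - \<Phi> F (u - real m * d)) \<le> real m * \<tau>"
  using assms(3)
proof (induction m)
  case (Suc m)
  have le: "u - real m * d \<ge> u0" using Suc.prems d by (simp add: distrib_right)
  have "\<Phi> F u - \<Phi> F (u - real (Suc m) * d) = (\<Phi> F u - \<Phi> F (u - real m * d)) + diff d F (u - real m * d)"
    by (simp add: diff_def algebra_simps)
  also have "norm \<dots> \<le> real m * \<tau> + \<tau>"
    using Suc.IH[OF le] assms(1)[OF le] by (intro norm_triangle_le add_mono)
  finally show ?case by (simp add: distrib_right)
qed simp

text \<open>For one fixed finite \<open>P\<close>, harmonicity compares \<open>\<Phi> F u\<close>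
  with the average of \<open>\<Phi> (shift F)\<close> at \<open>u - ln p\<close>. Each translation
  by \<open>ln p\<close> is nearly a multiple of an almost-period \<open>d\<close>, so it can be
  undone and only the shift remains.\<close>

theorem shift_invariant:
  assumes rich: "\<And>\<epsilon>. \<epsilon> > 0 \<Longrightarrow> \<exists>e>0. \<forall>\<eta>>0. \<exists>d. e \<le> d \<and> d \<le> \<epsilon> \<and> pair_rich R d \<eta>"
    and \<tau>: "\<tau> > 0"
  shows "\<exists>u0. \<forall>u\<ge>u0. \<forall>F. unit_bounded F \<longrightarrow> norm (\<Phi> F u - \<Phi> (shift F) u) \<le> \<tau>"
proof -
  \<comment> \<open>Here \<open>pair_rich\<close> only serves as a source of admissible
    \<open>P\<close> with large \<open>recip_sum\<close>.\<close>
  obtain d0 :: real where "pair_rich R d0 1" using rich[of 1] by (meson zero_less_one)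
  then obtain P where P: "finite P" "\<And>p. p \<in> P \<Longrightarrow> prime p \<and> R p" "recip_sum P \<ge> max 1 (32 / \<tau> ^ 2)"
    unfolding pair_rich_def by meson
  define L where "L = recip_sum P"
  have L: "L \<ge> 1" "L \<ge> 32 / \<tau> ^ 2" using P(3) by (auto simp: L_def)
  have err: "sqrt (2 * L) \<le> \<tau> / 4 * L"
  proof -
    have "32 \<le> L * \<tau> ^ 2" using L(2) \<tau> by (simp add: pos_divide_le_eq)
    then have "32 * L \<le> L * \<tau> ^ 2 * L" using L(1) by (intro mult_right_mono) auto
    then have "2 * L \<le> (\<tau> / 4 * L) ^ 2" by (simp add: power2_eq_square field_simps)
    then show ?thesis using \<tau> L(1) by (intro real_le_lsqrt) auto
  qed
  define M where "M = (\<Sum>p\<in>P. ln (real p))"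
  have ln0: "ln (real p) \<ge> 0" if "p \<in> P" for p
    using P(2)[OF that] prime_ge_1_nat[of p] by simp
  have M: "ln (real p) \<le> M" "ln (real p) \<ge> 0" if "p \<in> P" for p
    using member_le_sum[of p P "\<lambda>p. ln (real p)"] P(1) ln0 that unfolding M_def by auto
  obtain e where e: "e > 0" "\<And>\<eta>. \<eta> > 0 \<Longrightarrow> \<exists>d. e \<le> d \<and> d \<le> \<tau> / 16 \<and> pair_rich R d \<eta>"
    using rich[of "\<tau> / 16"] \<tau> by auto
  \<comment> \<open>At most \<open>n0\<close> steps of length at least \<open>e\<close> are needed
    to cover any \<open>ln p\<close>. This number is fixed before \<open>\<tau>'\<close>,
    \<open>\<eta>\<close> and finally \<open>d\<close>, so the accumulated error can be kept below
    \<open>\<tau> / 4\<close>.\<close>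
  define n0 where "n0 = nat \<lceil>M / e\<rceil>"
  have n0: "M / e \<le> real n0" unfolding n0_def by linarith
  define \<tau>' where "\<tau>' = \<tau> / (4 * (real n0 + 1))"
  have \<tau>': "\<tau>' > 0" using \<tau> by (simp add: \<tau>'_def)
  define k where "k = nat \<lceil>8 / \<tau>'\<rceil>"
  have "8 / \<tau>' \<le> real (Suc k)" unfolding k_def by linarith
  then have k: "2 / real (Suc k) \<le> \<tau>' / 4" using \<tau>' by (simp add: field_simps)
  define \<eta> where "\<eta> = \<tau>' / (16 * real (Suc k))"
  have \<eta>: "\<eta> > 0" using \<tau>' by (simp add: \<eta>_def)
  have "4 * (real k * \<eta>) \<le> \<tau>' / 4"
  proof -
    have "real k * \<eta> \<le> real (Suc k) * \<eta>" using \<eta> by (intro mult_right_mono) auto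
    also have "\<dots> = \<tau>' / 16" unfolding \<eta>_def by (simp del: of_nat_Suc)
    finally show ?thesis by simp
  qed
  with k have k\<eta>: "2 / real (Suc k) + 4 * (real k * \<eta>) \<le> \<tau>' / 2" by linarith
  obtain d where d: "e \<le> d" "d \<le> \<tau> / 16" "pair_rich R d \<eta>" using e(2)[OF \<eta>] by blast
  have d0: "d > 0" using d e by linarith
  obtain u1 where u1: "\<And>u F. u \<ge> u1 \<Longrightarrow> unit_bounded F \<Longrightarrow> norm (diff d F u) \<le> \<tau>'"
    using translation_invariant[OF d(3) _ _ \<tau>' k\<eta>] d0 \<eta> by auto
  obtain u2 where u2: "\<And>u F. u \<ge> u2 \<Longrightarrow> unit_bounded F \<Longrightarrow>
      norm (of_real L * \<Phi> F u - (\<Sum>p\<in>P. of_real (1 / real p) * \<Phi> (shift F) (u - ln (real p)))) \<le> sqrt (2 * L)"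
    using harmonic[OF P(1,2)] unfolding L_def by blast
  define s where "s = ln (16 / \<tau>)"
  have s: "exp (- s) = \<tau> / 16" using \<tau> by (simp add: s_def exp_minus)
  have near: "norm (\<Phi> F u - \<Phi> F (u - t)) \<le> \<tau> / 2"
    if F: "unit_bounded F" and t: "0 \<le> t" "t \<le> M" and u: "u \<ge> max u1 s + M" for F u t
  proof -
    \<comment> \<open>The remainder of \<open>t\<close> is less than
      \<open>d \<le> \<tau> / 16\<close> and is left to the slow variation.\<close>
    define m where "m = nat \<lfloor>t / d\<rfloor>"
    have "real m = of_int \<lfloor>t / d\<rfloor>" using t d0 by (simp add: m_def)
    then have "real m \<le> t / d" "t / d < real m + 1" by linarith+
    then have m: "real m * d \<le> t" "t \<le> real m * d + d" using d0 by (simp_all add: field_simps)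
    have "t / d \<le> M / e" using t d e d0 by (intro frac_le) auto
    then have "real m \<le> real n0" using n0 \<open>real m \<le> t / d\<close> by linarith
    then have "real m * \<tau>' \<le> (real n0 + 1) * \<tau>'" using \<tau>' by (intro mult_right_mono) auto
    also have "\<dots> = \<tau> / 4"
    proof -
      have "real n0 + 1 \<noteq> 0" by linarith
      moreover have "c * (\<tau> / (4 * c)) = \<tau> / 4" if "c \<noteq> 0" for c using that by simp
      ultimately show ?thesis unfolding \<tau>'_def by blast
    qed
    finally have m\<tau>: "real m * \<tau>' \<le> \<tau> / 4" .
    have "norm (\<Phi> F u - \<Phi> F (u - real m * d)) \<le> real m * \<tau>'"
    proof (rule translation_iterate)
      show "norm (diff d F w) \<le> \<tau>'" if "w \<ge> u1" for w using u1[OF that F] .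
    qed (use d0 m t u in auto)
    moreover have "norm (\<Phi> F (u - real m * d) - \<Phi> F (u - t)) \<le> 2 * (\<tau> / 16) + \<tau> / 16"
    proof -
      have "min (u - real m * d) (u - t) \<ge> s" using m t u by auto
      then have "exp (- min (u - real m * d) (u - t)) \<le> \<tau> / 16" unfolding s[symmetric] by simp
      moreover have "\<bar>(u - real m * d) - (u - t)\<bar> \<le> \<tau> / 16" using m d(2) by linarith
      ultimately have "2 * \<bar>(u - real m * d) - (u - t)\<bar> + exp (- min (u - real m * d) (u - t))
          \<le> 2 * (\<tau> / 16) + \<tau> / 16"
        by (intro add_mono mult_left_mono) auto
      then show ?thesis using slow[OF F, of "u - real m * d" "u - t"] by (rule order_trans[rotated])
    qed
    moreover have "norm (\<Phi> F u - \<Phi> F (u - t))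
        \<le> norm (\<Phi> F u - \<Phi> F (u - real m * d)) + norm (\<Phi> F (u - real m * d) - \<Phi> F (u - t))"
      using norm_triangle_ineq[of "\<Phi> F u - \<Phi> F (u - real m * d)" "\<Phi> F (u - real m * d) - \<Phi> F (u - t)"] by simp
    ultimately show ?thesis using m\<tau> \<tau> by linarith
  qed
  have "norm (\<Phi> F u - \<Phi> (shift F) u) \<le> \<tau>" if u: "u \<ge> max u2 (max u1 s + M)" and F: "unit_bounded F" for u F
  proof -
    define S where "S = (\<Sum>p\<in>P. of_real (1 / real p) * \<Phi> (shift F) (u - ln (real p)))"
    have "of_real L * \<Phi> (shift F) u - S
        = (\<Sum>p\<in>P. of_real (1 / real p) * (\<Phi> (shift F) u - \<Phi> (shift F) (u - ln (real p))))"
      unfolding S_def L_def recip_sum_def by (simp add: sum_distrib_right sum_subtractf right_diff_distrib)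
    also have "norm \<dots> \<le> (\<Sum>p\<in>P. 1 / real p * (\<tau> / 2))"
    proof (rule sum_norm_le)
      fix p assume p: "p \<in> P"
      have "norm (\<Phi> (shift F) u - \<Phi> (shift F) (u - ln (real p))) \<le> \<tau> / 2"
        using u M[OF p] by (intro near unit_bounded_shift F) auto
      then have "1 / real p * norm (\<Phi> (shift F) u - \<Phi> (shift F) (u - ln (real p))) \<le> 1 / real p * (\<tau> / 2)"
        by (intro mult_left_mono) auto
      then show "norm (of_real (1 / real p) * (\<Phi> (shift F) u - \<Phi> (shift F) (u - ln (real p))))
          \<le> 1 / real p * (\<tau> / 2)"
        by (simp add: norm_mult norm_divide)
    qed
    also have "\<dots> = L * (\<tau> / 2)" unfolding L_def recip_sum_def sum_distrib_right ..
    finally have 1: "norm (of_real L * \<Phi> (shift F) u - S) \<le> L * (\<tau> / 2)" .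
    have 2: "norm (of_real L * \<Phi> F u - S) \<le> \<tau> / 4 * L"
      using u2[of u F] u F err unfolding S_def by auto
    have "of_real L * (\<Phi> F u - \<Phi> (shift F) u) = (of_real L * \<Phi> F u - S) - (of_real L * \<Phi> (shift F) u - S)"
      by (simp add: algebra_simps)
    then have "norm (of_real L * (\<Phi> F u - \<Phi> (shift F) u))
        \<le> norm (of_real L * \<Phi> F u - S) + norm (of_real L * \<Phi> (shift F) u - S)"
      by (metis norm_triangle_ineq4)
    moreover have "norm (of_real L * (\<Phi> F u - \<Phi> (shift F) u)) = L * norm (\<Phi> F u - \<Phi> (shift F) u)"
      using L by (simp add: norm_mult)
    ultimately have "L * norm (\<Phi> F u - \<Phi> (shift F) u) \<le> \<tau> / 4 * L + L * (\<tau> / 2)"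
      using add_mono[OF 2 1] by linarith
    also have "\<dots> \<le> L * \<tau>" using L \<tau> by (simp add: algebra_simps)
    finally show ?thesis using L by simp
  qed
  then show ?thesis by blast
qed

end

section \<open>Averages with periodic weights as a harmonic family\<close>

definition log_avg :: "(nat \<Rightarrow> complex) \<Rightarrow> (nat \<Rightarrow> complex) \<Rightarrow> real \<Rightarrow> complex" where
  "log_avg g F u = of_real (exp (- u)) * (\<Sum>n=1..nat \<lfloor>exp u\<rfloor>. g n * F (num_prime_factors n))"

lemma nat_floor_exp_diff:
  assumes "p > 0"
  shows "nat \<lfloor>exp (u - ln (real p))\<rfloor> = nat \<lfloor>exp u\<rfloor> div p"
proof -
  have "exp (u - ln (real p)) = exp u / of_int (int p)" using assms by (simp add: exp_diff)
  then have "\<lfloor>exp (u - ln (real p))\<rfloor> = \<lfloor>exp u\<rfloor> div int p"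
    using floor_divide_real_eq_div[of "int p" "exp u"] by simp
  then show ?thesis by (simp add: nat_div_distrib)
qed

text \<open>Harmonicity is the Turan-Kubilius inequality times \<open>exp (- u)\<close>, with
  \<open>g (p * m) = g m\<close> for \<open>p\<close> congruent to 1. Normalising by
  \<open>exp (- u)\<close> instead of the number of terms makes the passage from \<open>u\<close> to
  \<open>u - ln p\<close> an exact factor \<open>p\<close>.\<close>

lemma harmonic_family_log_avg:
  assumes per: "\<And>m n. [m = n] (mod s) \<Longrightarrow> g m = g n" and g: "\<And>n. norm (g n) \<le> 1"
  shows "harmonic_family (log_avg g) (\<lambda>p. [p = 1] (mod s))"
proof
  have term1: "norm (g n * F (num_prime_factors n)) \<le> 1" if "unit_bounded F" for F n
    using that g[of n] unfolding unit_bounded_def by (simp add: norm_mult mult_le_one)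
  have sum_le: "norm (\<Sum>n\<in>A. g n * F (num_prime_factors n)) \<le> real (card A)" if "unit_bounded F"
      for F and A :: "nat set"
    using sum_norm_bound[of A "\<lambda>n. g n * F (num_prime_factors n)" 1] term1[OF that] by simp
  have sum_le1: "norm (\<Sum>n=1..M. g n * F (num_prime_factors n)) \<le> real M" if "unit_bounded F" for F M
    using sum_le[OF that, of "{1..M}"] by simp
  have sum_le2: "norm (\<Sum>n\<in>{M<..N}. g n * F (num_prime_factors n)) \<le> real N - real M"
      if "unit_bounded F" "M \<le> N" for F M N
    using sum_le[OF that(1), of "{M<..N}"] that(2) by (simp add: of_nat_diff)
  note fl = nat_floor_exp
  show b: "norm (log_avg g F u) \<le> 1" if F: "unit_bounded F" for F u
  proof -
    have "norm (log_avg g F u) = exp (- u) * norm (\<Sum>n=1..nat \<lfloor>exp u\<rfloor>. g n * F (num_prime_factors n))"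
      by (simp add: log_avg_def norm_mult)
    also have "\<dots> \<le> exp (- u) * exp u"
      by (rule mult_left_mono[OF order_trans[OF sum_le1[OF F] fl(1)]]) simp
    finally show ?thesis by (simp flip: exp_add)
  qed
  have slow: "norm (log_avg g F u - log_avg g F v) \<le> 2 * (u - v) + exp (- v)"
      if F: "unit_bounded F" and uv: "v \<le> u" for F u v
  proof -
    define M N where "M = nat \<lfloor>exp v\<rfloor>" and "N = nat \<lfloor>exp u\<rfloor>"
    define S where "S A = (\<Sum>n\<in>A. g n * F (num_prime_factors n))" for A
    have MN: "M \<le> N" using uv unfolding M_def N_def by (intro nat_mono floor_mono) auto
    have SN: "S {1..N} = S {1..M} + S {M<..N}" unfolding S_def by (rule sum_split_at[OF MN])
    have "log_avg g F u - log_avg g F v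
        = of_real (exp (- u)) * S {M<..N} - of_real (exp (- v) - exp (- u)) * S {1..M}"
      unfolding log_avg_def M_def[symmetric] N_def[symmetric] S_def[symmetric] SN by (simp add: algebra_simps)
    also have "norm \<dots> \<le> norm (of_real (exp (- u)) * S {M<..N})
        + norm (of_real (exp (- v) - exp (- u)) * S {1..M})"
      by (rule norm_triangle_ineq4)
    also have "\<dots> = exp (- u) * norm (S {M<..N}) + (exp (- v) - exp (- u)) * norm (S {1..M})"
      using uv by (simp only: norm_mult norm_of_real) simp
    also have "\<dots> \<le> exp (- u) * (exp u - exp v + 1) + (exp (- v) - exp (- u)) * exp v"
    proof (intro add_mono mult_left_mono)
      show "norm (S {M<..N}) \<le> exp u - exp v + 1"
        using sum_le2[OF F MN] fl(1)[of u] fl(2)[of v]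
            unfolding S_def M_def[symmetric] N_def[symmetric] by linarith
      show "norm (S {1..M}) \<le> exp v"
        unfolding S_def M_def by (rule order_trans[OF sum_le1[OF F] fl(1)])
    qed (use uv in auto)
    also have "\<dots> = 2 * (1 - exp (v - u)) + exp (- u)"
    proof -
      have "exp (- u) * exp u = 1" "exp (- v) * exp v = 1" "exp (- u) * exp v = exp (v - u)"
        by (simp_all flip: exp_add)
      then show ?thesis by (simp add: algebra_simps)
    qed
    also have "\<dots> \<le> 2 * (u - v) + exp (- v)"
    proof -
      have "1 - exp (v - u) \<le> u - v" using exp_ge_add_one_self[of "v - u"] by linarith
      then show ?thesis using uv by (intro add_mono mult_left_mono) auto
    qed
    finally show ?thesis .
  qed
  show "norm (log_avg g F u - log_avg g F v) \<le> 2 * \<bar>u - v\<bar> + exp (- min u v)" if F: "unit_bounded F" for F u v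
  proof (cases "v \<le> u")
    case True
    then show ?thesis using slow[OF F True] by simp
  next
    case False
    then show ?thesis using slow[OF F, of u v] by (simp add: norm_minus_commute min_def)
  qed
  fix P :: "nat set" assume P: "finite P" and pR: "\<And>p. p \<in> P \<Longrightarrow> prime p \<and> [p = 1] (mod s)"
  have "norm (of_real (recip_sum P) * log_avg g F u
      - (\<Sum>p\<in>P. of_real (1 / real p) * log_avg g (\<lambda>k. F (Suc k)) (u - ln (real p))))
     \<le> sqrt (2 * recip_sum P)" if u: "u \<ge> real (2 * card P + 1)" and F: "unit_bounded F" for u F
  proof -
    define N where "N = nat \<lfloor>exp u\<rfloor>"
    define a where "a n = g n * F (num_prime_factors n)" for n
    have "real (2 * card P) \<le> real N"
      using u exp_ge_add_one_self[of u] fl(2)[of u] unfolding N_def by linarith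
    then have N: "2 * card P \<le> N" by simp
    have t: "of_real (1 / real p) * log_avg g (\<lambda>k. F (Suc k)) (u - ln (real p))
        = of_real (exp (- u)) * (\<Sum>m=1..N div p. a (p * m))"
      if p: "p \<in> P" for p
    proof -
      have p0: "prime p" "p > 0" using pR[OF p] by (auto simp: prime_gt_0_nat)
      have "1 / real p * exp (- (u - ln (real p))) = exp (- u)"
        using p0 by (simp add: exp_diff exp_minus divide_inverse)
      then have "of_real (1 / real p) * log_avg g (\<lambda>k. F (Suc k)) (u - ln (real p))
          = of_real (exp (- u)) * (\<Sum>m=1..N div p. g m * F (Suc (num_prime_factors m)))"
        unfolding log_avg_def nat_floor_exp_diff[OF p0(2)] N_def[symmetric]
        by (simp only: mult.assoc[symmetric] of_real_mult[symmetric])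
      also have "(\<Sum>m=1..N div p. g m * F (Suc (num_prime_factors m))) = (\<Sum>m=1..N div p. a (p * m))"
      proof (rule sum.cong[OF refl])
        fix m assume m: "m \<in> {1..N div p}"
        have "[p * m = 1 * m] (mod s)" using pR[OF p] by (intro cong_mult) auto
        then have "g (p * m) = g m" using per by simp
        then show "g m * F (Suc (num_prime_factors m)) = a (p * m)"
          using num_prime_factors_prime_mult[OF p0(1), of m] m by (simp add: a_def)
      qed
      finally show ?thesis .
    qed
    have "of_real (recip_sum P) * log_avg g F u
        - (\<Sum>p\<in>P. of_real (1 / real p) * log_avg g (\<lambda>k. F (Suc k)) (u - ln (real p)))
       = of_real (exp (- u)) * (of_real (recip_sum P) * (\<Sum>n=1..N. a n) - (\<Sum>p\<in>P. \<Sum>m=1..N div p. a (p * m)))"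
      unfolding right_diff_distrib sum_distrib_left[of "of_real (exp (- u))" _ P]
      by (intro arg_cong2[where f = minus] sum.cong refl t) (simp add: log_avg_def N_def a_def)
    also have "norm \<dots> \<le> exp (- u) * (real N * sqrt (2 * recip_sum P))"
      unfolding norm_mult
      using turan_kubilius[OF P, of N a] pR N term1[OF F] by (simp add: a_def)
    also have "\<dots> \<le> exp (- u) * (exp u * sqrt (2 * recip_sum P))"
      using fl(1)[of u] recip_sum_nonneg unfolding N_def by (intro mult_left_mono mult_right_mono) auto
    also have "\<dots> = sqrt (2 * recip_sum P)" by (simp add: mult.assoc[symmetric] flip: exp_add)
    finally show ?thesis .
  qed
  then show "\<exists>u0. \<forall>u\<ge>u0. \<forall>F. unit_bounded F \<longrightarrow>
    norm (of_real (recip_sum P) * log_avg g F u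
        - (\<Sum>p\<in>P. of_real (1 / real p) * log_avg g (\<lambda>k. F (Suc k)) (u - ln (real p))))
     \<le> sqrt (2 * recip_sum P)" by blast
qed

lemma pair_rich_prime_class:
  assumes "s > 0" "\<epsilon> > 0"
  shows "\<exists>e>0. \<forall>\<eta>>0. \<exists>d. e \<le> d \<and> d \<le> \<epsilon> \<and> pair_rich (\<lambda>p. [p = 1] (mod s)) d \<eta>"
proof -
  obtain K where K: "K > 0" "\<And>u. u \<ge> 1 \<Longrightarrow>
      (\<Sum>p\<in>log_window (\<lambda>p. [p = 1] (mod s)) u (u + K). ln (real p) / real p) \<ge> 1"
    using prime_class_window[OF assms(1)] by blast
  show ?thesis by (rule pair_rich_exists[OF K assms(2)])
qed

theorem periodic_shift_invariant:
  assumes s: "s > 0" and per: "\<And>m n. [m = n] (mod s) \<Longrightarrow> g m = g n" and g: "\<And>n. norm (g n) \<le> 1"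
    and \<tau>: "\<tau> > 0"
  shows "\<exists>N0. \<forall>N\<ge>N0. \<forall>F. unit_bounded F \<longrightarrow>
    norm ((\<Sum>n=1..N. g n * F (num_prime_factors n)) - (\<Sum>n=1..N. g n * F (Suc (num_prime_factors n))))
        \<le> \<tau> * real N"
proof -
  interpret harmonic_family "log_avg g" "\<lambda>p. [p = 1] (mod s)"
    by (rule harmonic_family_log_avg[OF per g])
  obtain u0 where u0: "\<And>u F. u \<ge> u0 \<Longrightarrow> unit_bounded F \<Longrightarrow> norm (log_avg g F u - log_avg g (\<lambda>k. F (Suc k)) u) \<le> \<tau>"
    using shift_invariant[OF pair_rich_prime_class[OF s] \<tau>] by blast
  have "norm ((\<Sum>n=1..N. g n * F (num_prime_factors n)) - (\<Sum>n=1..N. g n * F (Suc (num_prime_factors n))))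
      \<le> \<tau> * real N"
    if N: "N \<ge> max 1 (nat \<lceil>exp u0\<rceil>)" and F: "unit_bounded F" for N F
  proof -
    define D where "D = (\<Sum>n=1..N. g n * F (num_prime_factors n))
        - (\<Sum>n=1..N. g n * F (Suc (num_prime_factors n)))"
    have N0: "real N > 0" and "exp u0 \<le> real N" using N by linarith+
    then have "u0 \<le> ln (real N)" by (simp add: ln_ge_iff)
    then have "norm (log_avg g F (ln (real N)) - log_avg g (\<lambda>k. F (Suc k)) (ln (real N))) \<le> \<tau>"
      by (rule u0[OF _ F])
    moreover have "log_avg g F (ln (real N)) - log_avg g (\<lambda>k. F (Suc k)) (ln (real N))
        = of_real (1 / real N) * D"
      using N0 unfolding log_avg_def D_def right_diff_distrib by (simp add: exp_minus divide_inverse)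
    ultimately have "1 / real N * norm D \<le> \<tau>" by (simp add: norm_mult norm_divide)
    then show ?thesis using N0 unfolding D_def[symmetric] by (simp add: pos_divide_le_eq)
  qed
  then show ?thesis by blast
qed

text \<open>Modulo 1 every prime is congruent to 1, and \<open>pair_rich\<close> contains the
  existence of finite sets with arbitrarily large \<open>recip_sum\<close>.\<close>

lemma recip_sum_primes_unbounded: "\<exists>P. finite P \<and> (\<forall>p\<in>P. prime p) \<and> recip_sum P \<ge> L"
proof -
  obtain e :: real where "\<forall>\<eta>>0. \<exists>d. e \<le> d \<and> d \<le> 1 \<and> pair_rich (\<lambda>p. [p = 1] (mod 1)) d \<eta>"
    using pair_rich_prime_class[OF zero_less_one zero_less_one] by (elim exE conjE)
  from this[rule_format, OF zero_less_one] obtain d where "pair_rich (\<lambda>p. [p = 1] (mod 1)) d 1"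
      by (elim exE conjE)
  then obtain c where "\<forall>L. \<exists>P. finite P \<and> (\<forall>p\<in>P. prime p \<and> [p = 1] (mod 1)) \<and> recip_sum P \<ge> L \<and>
     (\<forall>Z\<subseteq>P. recip_sum Z \<le> c * recip_sum P \<longrightarrow>
        (\<exists>p\<in>P - Z. \<exists>q\<in>P - Z. \<bar>ln (real q) - ln (real p) - d\<bar> \<le> 1))"
    unfolding pair_rich_def by (elim exE conjE)
  from spec[OF this, of L] obtain P where "finite P" "\<forall>p\<in>P. prime p \<and> [p = 1] (mod 1)" "recip_sum P \<ge> L"
      by (elim exE conjE)
  then show ?thesis by (intro exI[of _ P]) simp
qed

section \<open>Means along a single exponential\<close>

lemma unit_exp_power: "unit_exp (real n * \<alpha>) = unit_exp \<alpha> ^ n"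
  unfolding unit_exp_def exp_of_nat_mult[symmetric] by (simp add: mult_ac)

lemma norm_unit_exp [simp]: "norm (unit_exp \<alpha>) = 1"
proof -
  have "unit_exp \<alpha> = exp (\<i> * of_real (2 * pi * \<alpha>))" by (simp add: unit_exp_def mult_ac)
  then show ?thesis by (simp only: norm_exp_i_times)
qed

text \<open>If \<open>unit_exp \<alpha>\<close> is a root of unity, its powers are periodic and the
  mean with \<open>F\<close> almost equals the mean with each of its first \<open>H\<close> shifts.
  Averaging over these shifts puts a block average of \<open>F\<close> starting at
  \<open>num_prime_factors n\<close> into every term, and this is small by
  \<open>mean\<close>.\<close>

theorem exponential_average_zero:
  fixes F :: "nat \<Rightarrow> complex"
  assumes F: "unit_bounded F"
    and mean: "\<And>\<epsilon>. \<epsilon> > 0 \<Longrightarrow> \<exists>H>0. \<forall>k. norm (\<Sum>h<H. F (k + h)) \<le> \<epsilon> * real H"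
  shows "(\<lambda>N. 1 / of_nat N * (\<Sum>n=1..N. unit_exp (real n * \<alpha>) * F (num_prime_factors n))) \<longlonglongrightarrow> 0"
proof -
  define z where "z = unit_exp \<alpha>"
  have z: "norm z = 1" by (simp add: z_def)
  have "\<exists>N0. \<forall>N\<ge>N0. norm (\<Sum>n=1..N. z ^ n * F (num_prime_factors n)) \<le> \<tau> * real N" if \<tau>: "\<tau> > 0" for \<tau>
  proof (cases "\<exists>s>0. z ^ s = 1")
    case False
    then show ?thesis
      using katai[OF z _ recip_sum_primes_unbounded \<tau>] F unfolding unit_bounded_def by blast
  next
    case True
    then obtain s where s: "s > 0" "z ^ s = 1" by blast
    have zmod: "z ^ n = z ^ (n mod s)" for n
    proof -
      have "z ^ n = z ^ (s * (n div s) + n mod s)" by simp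
      also have "\<dots> = z ^ (n mod s)" by (simp only: power_add power_mult s(2) power_one mult_1)
      finally show ?thesis .
    qed
    have per: "z ^ m = z ^ n" if "[m = n] (mod s)" for m n
      using zmod[of m] zmod[of n] that by (simp add: cong_def)
    have g: "norm (z ^ n) \<le> 1" for n by (simp add: norm_power z)
    obtain H where H: "H > 0" "\<And>k. norm (\<Sum>h<H. F (k + h)) \<le> \<tau> / 2 * real H"
      using mean[of "\<tau> / 2"] \<tau> by auto
    \<comment> \<open>Up to \<open>H\<close> successive shifts are made, so together they cost at
      most \<open>\<tau> / 2\<close>; the block averages take the other half.\<close>
    define \<tau>' where "\<tau>' = \<tau> / (2 * real H)"
    have \<tau>': "\<tau>' > 0" using \<tau> H by (simp add: \<tau>'_def)
    obtain N0 where N0: "\<And>N F. N \<ge> N0 \<Longrightarrow> unit_bounded F \<Longrightarrow>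
      norm ((\<Sum>n=1..N. z ^ n * F (num_prime_factors n)) - (\<Sum>n=1..N. z ^ n * F (Suc (num_prime_factors n))))
          \<le> \<tau>' * real N"
      using periodic_shift_invariant[where g = "\<lambda>n. z ^ n", OF s(1) per g \<tau>'] by blast
    have "norm (\<Sum>n=1..N. z ^ n * F (num_prime_factors n)) \<le> \<tau> * real N" if N: "N \<ge> N0" for N
    proof -
      define S where "S h = (\<Sum>n=1..N. z ^ n * F (num_prime_factors n + h))" for h
      have step: "norm (S h - S (Suc h)) \<le> \<tau>' * real N" for h
        using N0[OF N, of "\<lambda>k. F (k + h)"] F unfolding S_def unit_bounded_def by simp
      have "norm (S 0 - S h) \<le> real h * (\<tau>' * real N)" for h
      proof (induction h)
        case (Suc h)
        have "S 0 - S (Suc h) = (S 0 - S h) + (S h - S (Suc h))" by simp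
        also have "norm \<dots> \<le> real h * (\<tau>' * real N) + \<tau>' * real N"
          using Suc step by (intro norm_triangle_le add_mono)
        finally show ?case by (simp add: distrib_right)
      qed simp
      note far = this
      have near: "norm (S 0 - S h) \<le> real H * (\<tau>' * real N)" if "h < H" for h
      proof (rule order_trans[OF far])
        show "real h * (\<tau>' * real N) \<le> real H * (\<tau>' * real N)"
          using that \<tau>' by (intro mult_right_mono) auto
      qed
      have "of_nat H * S 0 = (\<Sum>h<H. S 0 - S h) + (\<Sum>h<H. S h)" by (simp add: sum_subtractf)
      moreover have "norm (\<Sum>h<H. S 0 - S h) \<le> real H * (real H * (\<tau>' * real N))"
        using sum_norm_bound[of "{..<H}" "\<lambda>h. S 0 - S h" "real H * (\<tau>' * real N)"] near by simp
      moreover have "norm (\<Sum>h<H. S h) \<le> real N * (\<tau> / 2 * real H)"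
      proof -
        have "(\<Sum>h<H. S h) = (\<Sum>n=1..N. \<Sum>h<H. z ^ n * F (num_prime_factors n + h))"
          unfolding S_def by (rule sum.swap)
        also have "\<dots> = (\<Sum>n=1..N. z ^ n * (\<Sum>h<H. F (num_prime_factors n + h)))"
            by (simp only: sum_distrib_left)
        also have "norm \<dots> \<le> (\<Sum>n=1..N. \<tau> / 2 * real H)"
          using H(2) by (intro sum_norm_le) (simp add: norm_mult norm_power z)
        finally show ?thesis by simp
      qed
      ultimately have "norm (of_nat H * S 0) \<le> real H * (real H * (\<tau>' * real N)) + real N * (\<tau> / 2 * real H)"
        by (simp only:) (intro norm_triangle_le add_mono)
      also have "real H * (real H * (\<tau>' * real N)) = real N * (\<tau> / 2 * real H)"
        using H(1) by (simp add: \<tau>'_def)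
      finally have "real H * norm (S 0) \<le> real H * (\<tau> * real N)" by (simp add: norm_mult algebra_simps)
      then show ?thesis using H(1) by (simp add: S_def)
    qed
    then show ?thesis by blast
  qed
  note key = this
  show ?thesis
  proof (rule LIMSEQ_I)
    fix r :: real assume r: "r > 0"
    obtain N0 where N0: "\<And>N. N \<ge> N0 \<Longrightarrow> norm (\<Sum>n=1..N. z ^ n * F (num_prime_factors n)) \<le> r / 2 * real N"
      using key[of "r / 2"] r by auto
    have "norm (1 / of_nat N * (\<Sum>n=1..N. unit_exp (real n * \<alpha>) * F (num_prime_factors n)) - 0) < r"
        if N: "N \<ge> max 1 N0" for N
    proof -
      have "norm (1 / of_nat N * (\<Sum>n=1..N. z ^ n * F (num_prime_factors n))) \<le> 1 / real N * (r / 2 * real N)"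
        unfolding norm_mult using N0[of N] N by (intro mult_mono) (auto simp: norm_divide)
      also have "\<dots> = r / 2" using N by simp
      also have "\<dots> < r" using r by simp
      finally show ?thesis by (simp only: unit_exp_power z_def diff_zero)
    qed
    then show "\<exists>no. \<forall>N\<ge>no. norm (1 / of_nat N * (\<Sum>n=1..N. unit_exp (real n * \<alpha>) * F (num_prime_factors n))
        - 0) < r"
      by blast
  qed
qed

section \<open>Unique ergodicity\<close>

definition ternary_code :: "(nat \<Rightarrow> bool) \<Rightarrow> real" where
  "ternary_code a = (\<Sum>i. (if a i then 2 else 0) * (1 / 3) ^ Suc i)"

lemma summable_ternary: "summable (\<lambda>i. (if a i then 2 else 0) * (1 / 3 :: real) ^ Suc i)"
proof (rule summable_comparison_test[OF _ summable_mult[of "\<lambda>i. (1 / 3 :: real) ^ Suc i" 2]])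
  show "summable (\<lambda>i. (1 / 3 :: real) ^ Suc i)" by (subst summable_Suc_iff) (simp add: summable_geometric)
qed (auto intro!: exI[of _ 0])

lemma suminf_third: "(\<Sum>i. 2 * (1 / 3 :: real) ^ Suc (i + n)) = (1 / 3) ^ n"
proof -
  have "(\<Sum>i. 2 * (1 / 3 :: real) ^ Suc (i + n)) = (\<Sum>i. 2 * (1 / 3) ^ Suc n * (1 / 3) ^ i)"
    by (simp add: power_add mult_ac)
  also have "\<dots> = 2 * (1 / 3) ^ Suc n * (\<Sum>i. (1 / 3) ^ i)" by (rule suminf_mult) (simp add: summable_geometric)
  also have "(\<Sum>i. (1 / 3 :: real) ^ i) = 3 / 2" by (subst suminf_geometric) auto
  finally show ?thesis by simp
qed

lemma summable_third: "summable (\<lambda>i. 2 * (1 / 3 :: real) ^ Suc (i + n))"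
  using summable_ignore_initial_segment[OF summable_ternary[of "\<lambda>_. True"], of n] by simp

lemma ternary_code_bounds: "0 \<le> ternary_code a" "ternary_code a \<le> 1"
proof -
  show "0 \<le> ternary_code a" unfolding ternary_code_def by (intro suminf_nonneg summable_ternary) auto
  have "ternary_code a \<le> (\<Sum>i. 2 * (1 / 3) ^ Suc (i + 0))"
    unfolding ternary_code_def by (intro suminf_le summable_ternary summable_third) auto
  then show "ternary_code a \<le> 1" unfolding suminf_third by simp
qed

text \<open>The first differing digit \<open>j\<close> contributes \<open>2 / 3 ^ (j + 1)\<close>
  and the tail at most half of that. With the digits 0 and 2 in base 3 close codes therefore share
  their initial digits; in base 2 this fails at dyadic rationals.\<close>

lemma ternary_code_separates:
  assumes "\<bar>ternary_code a - ternary_code b\<bar> < (1 / 3) ^ Suc n" "i \<le> n"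
  shows "a i = b i"
proof (rule ccontr)
  assume ne: "a i \<noteq> b i"
  define j where "j = (LEAST j. a j \<noteq> b j)"
  have j: "a j \<noteq> b j" unfolding j_def using ne by (rule LeastI)
  have ji: "j \<le> i" unfolding j_def using ne by (rule Least_le)
  have eq: "a k = b k" if "k < j" for k using not_less_Least[of k "\<lambda>j. a j \<noteq> b j"] that by (simp add: j_def)
  define d where "d k = ((if a k then 2 else 0) - (if b k then 2 else 0)) * (1 / 3 :: real) ^ Suc k" for k
  have sd: "summable d"
    unfolding d_def left_diff_distrib by (intro summable_diff summable_ternary)
  have "ternary_code a - ternary_code b = suminf d"
    unfolding ternary_code_def d_def left_diff_distrib by (rule suminf_diff) (rule summable_ternary)+
  also have "\<dots> = (\<Sum>k. d (k + Suc j)) + (\<Sum>k<Suc j. d k)" by (rule suminf_split_initial_segment[OF sd])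
  also have "(\<Sum>k<Suc j. d k) = d j" using eq by (simp add: d_def)
  finally have split: "ternary_code a - ternary_code b = (\<Sum>k. d (k + Suc j)) + d j" .
  have dn: "norm (d (k + Suc j)) \<le> 2 * (1 / 3) ^ Suc (k + Suc j)" for k
    unfolding d_def by (auto simp: abs_mult)
  have "norm (\<Sum>k. d (k + Suc j)) \<le> (\<Sum>k. 2 * (1 / 3) ^ Suc (k + Suc j))"
    using dn by (intro norm_suminf_le summable_third)
  then have tail: "\<bar>\<Sum>k. d (k + Suc j)\<bar> \<le> (1 / 3) ^ Suc j" unfolding suminf_third by simp
  have "\<bar>d j\<bar> = 2 * (1 / 3) ^ Suc j" using j by (auto simp: d_def abs_mult)
  then have "\<bar>ternary_code a - ternary_code b\<bar> \<ge> (1 / 3) ^ Suc j" using tail split by linarith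
  moreover have "(1 / 3 :: real) ^ Suc n \<le> (1 / 3) ^ Suc j" using ji assms(2) by (intro power_decreasing) auto
  ultimately show False using assms(1) by linarith
qed

text \<open>Membership in the balls of a sequence of finite covers, coded in base 3.\<close>

lemma compact_real_code:
  fixes X :: "'a::metric_space set"
  assumes "compact X" "X \<noteq> {}"
  shows "\<exists>\<kappa>. (\<forall>x. 0 \<le> \<kappa> x \<and> \<kappa> x \<le> (1::real)) \<and>
     (\<forall>\<epsilon>>0. \<exists>\<delta>>0. \<forall>x\<in>X. \<forall>y\<in>X. \<bar>\<kappa> x - \<kappa> y\<bar> < \<delta> \<longrightarrow> dist x y < \<epsilon>)"
proof -
  have "\<exists>C. finite C \<and> X \<subseteq> (\<Union>c\<in>C. ball c (1 / real (Suc n)))" for n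
    using assms(1)[unfolded compact_eq_totally_bounded]
        by (metis of_nat_0_less_iff zero_less_Suc zero_less_divide_1_iff)
  then obtain C where C: "\<And>n. finite (C n)" "\<And>n. X \<subseteq> (\<Union>c\<in>C n. ball c (1 / real (Suc n)))" by metis
  define B where "B = (\<Union>n. (\<lambda>c. (c, n)) ` C n)"
  have cB: "countable B" unfolding B_def
      using C(1) by (intro countable_UN countable_image) (auto intro: countable_finite)
  have "C 0 \<noteq> {}" using C(2)[of 0] assms(2) by auto
  then have neB: "B \<noteq> {}" by (auto simp: B_def)
  define e where "e = from_nat_into B"
  define digit where "digit x i \<longleftrightarrow> dist (fst (e i)) x < 1 / real (Suc (snd (e i)))" for x i
  define \<kappa> where "\<kappa> x = ternary_code (digit x)" for x
  have "\<exists>\<delta>>0. \<forall>x\<in>X. \<forall>y\<in>X. \<bar>\<kappa> x - \<kappa> y\<bar> < \<delta> \<longrightarrow> dist x y < \<epsilon>" if \<epsilon>: "\<epsilon> > 0" for \<epsilon>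
  proof -
    obtain n where n: "2 / \<epsilon> < real n" using reals_Archimedean2 by blast
    then have n2: "2 / real (Suc n) < \<epsilon>" using \<epsilon> by (simp add: field_simps)
    have "\<exists>i. e i = (c, n)" if "c \<in> C n" for c
      using from_nat_into_surj[OF cB, of "(c, n)"] that unfolding e_def B_def by auto
    then obtain j where j: "\<And>c. c \<in> C n \<Longrightarrow> e (j c) = (c, n)" by metis
    \<comment> \<open>The finitely many balls of radius \<open>1 / (n + 1)\<close> are all coded
      among the digits up to \<open>m\<close>, so codes closer than \<open>(1 / 3) ^ Suc m\<close>
      agree about them.\<close>
    define m where "m = Max (insert 0 (j ` C n))"
    have jm: "j c \<le> m" if "c \<in> C n" for c unfolding m_def using C(1) that by (intro Max_ge) auto
    have "dist x y < \<epsilon>" if xy: "x \<in> X" "y \<in> X" "\<bar>\<kappa> x - \<kappa> y\<bar> < (1 / 3) ^ Suc m" for x y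
    proof -
      obtain c where c: "c \<in> C n" "dist c x < 1 / real (Suc n)"
          using C(2)[of n] xy(1) by (auto simp: subset_iff)
      have "digit x (j c)" using c j[OF c(1)] by (simp add: digit_def)
      then have "digit y (j c)" using ternary_code_separates[OF xy(3)[unfolded \<kappa>_def] jm[OF c(1)]] by simp
      then have "dist c y < 1 / real (Suc n)" using j[OF c(1)] by (simp add: digit_def)
      then have "dist x y < 1 / real (Suc n) + 1 / real (Suc n)"
        using c(2) dist_triangle3[of x y c] by linarith
      also have "\<dots> = 2 / real (Suc n)" by simp
      finally show ?thesis using n2 by linarith
    qed
    then show ?thesis by (intro exI[of _ "(1 / 3) ^ Suc m"]) auto
  qed
  moreover have "0 \<le> \<kappa> x \<and> \<kappa> x \<le> 1" for x using ternary_code_bounds by (simp add: \<kappa>_def)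
  ultimately show ?thesis by blast
qed

text \<open>The code \<open>\<kappa>\<close> need not be continuous, but its inverse is uniformly
  continuous and therefore extends to the closure of the set of codes, with values in
  \<open>X\<close> by compactness.\<close>

lemma compact_image_of_real_compact:
  fixes X :: "'a::metric_space set"
  assumes X: "compact X" "X \<noteq> {}"
  shows "\<exists>(K::real set) \<pi> \<kappa>. closed K \<and> K \<subseteq> {0..1} \<and> continuous_on K \<pi> \<and> \<pi> ` K \<subseteq> X \<and>
      (\<forall>x\<in>X. \<kappa> x \<in> K \<and> \<pi> (\<kappa> x) = x)"
proof -
  obtain \<kappa> :: "'a \<Rightarrow> real" where \<kappa>: "\<And>x. 0 \<le> \<kappa> x \<and> \<kappa> x \<le> 1"
    and inv: "\<And>\<epsilon>. \<epsilon> > 0 \<Longrightarrow> \<exists>\<delta>>0. \<forall>x\<in>X. \<forall>y\<in>X. \<bar>\<kappa> x - \<kappa> y\<bar> < \<delta> \<longrightarrow> dist x y < \<epsilon>"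
    using compact_real_code[OF X] by metis
  define K where "K = closure (\<kappa> ` X)"
  \<comment> \<open>The closure of the graph of the inverse of \<open>\<kappa>\<close>. The estimate
    \<open>near\<close> below shows that it is single-valued and that the resulting function is
    continuous.\<close>
  define A where "A t l \<longleftrightarrow> l \<in> X \<and> (\<exists>y. (\<forall>n. y n \<in> X) \<and> (\<lambda>n. \<kappa> (y n)) \<longlonglongrightarrow> t \<and> y \<longlonglongrightarrow> l)" for t :: real and l
  have ex: "\<exists>l. A t l" if t: "t \<in> K" for t
  proof -
    obtain u where u: "\<And>n. u n \<in> \<kappa> ` X" "u \<longlonglongrightarrow> t" using t unfolding K_def closure_sequential by blast
    from u(1) have "\<forall>n. \<exists>x. x \<in> X \<and> u n = \<kappa> x" by blast
    then obtain y where y: "\<And>n. y n \<in> X" "\<And>n. u n = \<kappa> (y n)" by metis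
    obtain l r where l: "l \<in> X" "strict_mono r" "(y \<circ> r) \<longlonglongrightarrow> l"
      using X(1)[unfolded compact_def] y(1) by blast
    have "(u \<circ> r) \<longlonglongrightarrow> t" using LIMSEQ_subseq_LIMSEQ[OF u(2) l(2)] .
    then have "(\<lambda>n. \<kappa> ((y \<circ> r) n)) \<longlonglongrightarrow> t" using y(2) by (simp add: o_def)
    then show ?thesis using l y(1) unfolding A_def by (intro exI[of _ l]) (auto intro!: exI[of _ "y \<circ> r"])
  qed
  have near: "\<exists>\<delta>>0. \<forall>t t' l l'. A t l \<longrightarrow> A t' l' \<longrightarrow> \<bar>t - t'\<bar> < \<delta> \<longrightarrow> dist l l' \<le> \<epsilon>" if \<epsilon>: "\<epsilon> > 0" for \<epsilon>
  proof -
    obtain \<delta> where \<delta>: "\<delta> > 0" "\<And>x y. x \<in> X \<Longrightarrow> y \<in> X \<Longrightarrow> \<bar>\<kappa> x - \<kappa> y\<bar> < \<delta> \<Longrightarrow> dist x y < \<epsilon>"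
      using inv[OF \<epsilon>] by blast
    have "dist l l' \<le> \<epsilon>" if A: "A t l" "A t' l'" and tt: "\<bar>t - t'\<bar> < \<delta>" for t t' l l'
    proof -
      obtain y where y: "\<And>n. y n \<in> X" "(\<lambda>n. \<kappa> (y n)) \<longlonglongrightarrow> t" "y \<longlonglongrightarrow> l" using A(1) unfolding A_def by blast
      obtain y' where y': "\<And>n. y' n \<in> X" "(\<lambda>n. \<kappa> (y' n)) \<longlonglongrightarrow> t'" "y' \<longlonglongrightarrow> l'" using A(2) unfolding A_def by blast
      have "(\<lambda>n. \<bar>\<kappa> (y n) - \<kappa> (y' n)\<bar>) \<longlonglongrightarrow> \<bar>t - t'\<bar>" by (intro tendsto_intros y y')
      then have "eventually (\<lambda>n. \<bar>\<kappa> (y n) - \<kappa> (y' n)\<bar> < \<delta>) sequentially" using tt by (rule order_tendstoD)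
      then have "eventually (\<lambda>n. dist (y n) (y' n) \<le> \<epsilon>) sequentially"
        by eventually_elim (use \<delta>(2) y(1) y'(1) in \<open>auto intro: less_imp_le\<close>)
      moreover have "(\<lambda>n. dist (y n) (y' n)) \<longlonglongrightarrow> dist l l'" by (intro tendsto_dist y y')
      ultimately show ?thesis by (intro tendsto_upperbound[of _ _ sequentially]) auto
    qed
    then show ?thesis using \<delta>(1) by blast
  qed
  define \<pi> where "\<pi> t = (SOME l. A t l)" for t
  have \<pi>: "A t (\<pi> t)" if "t \<in> K" for t unfolding \<pi>_def using ex[OF that] by (rule someI_ex)
  have "closed K" by (simp add: K_def)
  moreover have "K \<subseteq> {0..1}" unfolding K_def using \<kappa> by (intro closure_minimal) auto
  moreover have "continuous_on K \<pi>"
    unfolding continuous_on_iff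
  proof (intro ballI allI impI)
    fix t e assume t: "t \<in> K" and e: "e > (0::real)"
    obtain \<delta> where \<delta>: "\<delta> > 0" "\<And>t t' l l'. A t l \<Longrightarrow> A t' l' \<Longrightarrow> \<bar>t - t'\<bar> < \<delta> \<Longrightarrow> dist l l' \<le> e / 2"
      using near[of "e / 2"] e by auto
    have "dist (\<pi> t') (\<pi> t) < e" if "t' \<in> K" "dist t' t < \<delta>" for t'
      using \<delta>(2)[OF \<pi>[OF that(1)] \<pi>[OF t]] that(2) e by (auto simp: dist_real_def)
    then show "\<exists>d>0. \<forall>x'\<in>K. dist x' t < d \<longrightarrow> dist (\<pi> x') (\<pi> t) < e" using \<delta>(1) by blast
  qed
  moreover have "\<pi> ` K \<subseteq> X" using \<pi> unfolding A_def by auto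
  moreover have "\<kappa> x \<in> K \<and> \<pi> (\<kappa> x) = x" if x: "x \<in> X" for x
  proof
    show K: "\<kappa> x \<in> K" unfolding K_def using x by (intro subsetD[OF closure_subset] imageI)
    have A: "A (\<kappa> x) x" unfolding A_def using x by (intro conjI exI[of _ "\<lambda>_. x"]) auto
    have "dist (\<pi> (\<kappa> x)) x \<le> e" if "e > 0" for e
    proof -
      obtain \<delta> where "\<delta> > 0" "\<And>t t' l l'. A t l \<Longrightarrow> A t' l' \<Longrightarrow> \<bar>t - t'\<bar> < \<delta> \<Longrightarrow> dist l l' \<le> e"
        using near[OF \<open>e > 0\<close>] by blast
      then show ?thesis using \<pi>[OF K] A by auto
    qed
    then show "\<pi> (\<kappa> x) = x" by (metis dense_ge dist_le_zero_iff)
  qed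
  ultimately show ?thesis by blast
qed

section \<open>Weak limits and invariant measures\<close>

lemma measurable_restrict_borel_continuous:
  "continuous_on X f \<Longrightarrow> f \<in> borel_measurable (restrict_space borel X)"
  by (rule borel_measurable_continuous_on_restrict)

lemma sets_restrict_borel_closed:
  assumes "closed X"
  shows "sets (restrict_space borel X) = sigma_sets X {C \<inter> X |C. closed C}"
proof -
  have b: "sets borel = sigma_sets UNIV (Collect closed)" by (simp add: borel_eq_closed)
  have "X \<in> sigma_sets UNIV (Collect closed)" using assms by (intro sigma_sets.Basic) simp
  then have "(\<inter>) X ` sigma_sets UNIV (Collect closed) = sigma_sets X ((\<inter>) X ` Collect closed)"
    by (rule sigma_sets_Int) simp
  moreover have "(\<inter>) X ` Collect closed = {C \<inter> X |C. closed C}" by auto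
  ultimately show ?thesis unfolding sets_restrict_space b by simp
qed

text \<open>The indicator of a closed set is the limit of continuous functions of the distance to
  it, and the closed subsets of \<open>X\<close> form a generator stable under intersection.\<close>

lemma prob_measure_eqI_continuous:
  fixes X :: "'a::metric_space set"
  assumes X: "compact X" and M: "prob_space M" "sets M = sets (restrict_space borel X)"
    and N: "prob_space N" "sets N = sets (restrict_space borel X)"
    and eq: "\<And>f :: 'a \<Rightarrow> real. continuous_on X f \<Longrightarrow> (\<integral>x. f x \<partial>M) = (\<integral>x. f x \<partial>N)"
  shows "M = N"
proof -
  have sp: "space M = X" "space N = X"
    using sets_eq_imp_space_eq[OF M(2)] sets_eq_imp_space_eq[OF N(2)] by (simp_all add: space_restrict_space)
  have lim: "(\<lambda>n. \<integral>x. max 0 (1 - real n * infdist x A) \<partial>L) \<longlonglongrightarrow> measure L A"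
    if L: "prob_space L" "sets L = sets (restrict_space borel X)" "space L = X"
      and A: "closed A" "A \<noteq> {}" "A \<in> sets L" for L :: "'a measure" and A
  proof -
    interpret L: prob_space L by (rule L)
    have "(\<lambda>n. \<integral>x. max 0 (1 - real n * infdist x A) \<partial>L) \<longlonglongrightarrow> (\<integral>x. indicator A x \<partial>L)"
    proof (rule integral_dominated_convergence[where w = "\<lambda>_. 1"])
      show "(\<lambda>x. max 0 (1 - real n * infdist x A)) \<in> borel_measurable L" for n
        unfolding measurable_cong_sets[OF L(2) refl]
        by (intro measurable_restrict_borel_continuous continuous_intros)
      show "AE x in L. (\<lambda>n. max 0 (1 - real n * infdist x A)) \<longlonglongrightarrow> indicator A x"
      proof (rule AE_I2)
        fix x
        show "(\<lambda>n. max 0 (1 - real n * infdist x A)) \<longlonglongrightarrow> indicator A x"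
        proof (cases "x \<in> A")
          case False
          then have pos: "infdist x A > 0"
            using in_closed_iff_infdist_zero[OF A(1,2)] infdist_nonneg[of x A] by (metis less_eq_real_def)
          obtain n0 :: nat where "1 / infdist x A < real n0" using reals_Archimedean2 by blast
          then have n0: "1 < real n0 * infdist x A" using pos by (simp add: pos_divide_less_eq)
          have "max 0 (1 - real n * infdist x A) = 0" if "n \<ge> n0" for n
          proof -
            have "real n0 * infdist x A \<le> real n * infdist x A" using that pos by (intro mult_right_mono) auto
            then show ?thesis using n0 by simp
          qed
          then have "eventually (\<lambda>n. max 0 (1 - real n * infdist x A) = 0) sequentially"
            by (auto simp: eventually_sequentially)
          then show ?thesis using False by (simp add: tendsto_eventually)
        qed simp
      qed
      show "AE x in L. norm (max 0 (1 - real n * infdist x A)) \<le> 1" for n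
      proof (rule AE_I2)
        fix x
        have "0 \<le> real n * infdist x A" by (intro mult_nonneg_nonneg infdist_nonneg) auto
        then show "norm (max 0 (1 - real n * infdist x A)) \<le> 1" by simp
      qed
    qed (use A in auto)
    then show ?thesis using A(3) by simp
  qed
  have closed_eq: "measure M A = measure N A" if A: "closed A" "A \<in> sets M" for A
  \<comment> \<open>The distance to the empty set is 0 by convention, so the approximation of the
    indicator fails there.\<close>
  proof (cases "A = {}")
    case False
    have "(\<lambda>n. \<integral>x. max 0 (1 - real n * infdist x A) \<partial>M) \<longlonglongrightarrow> measure M A"
      using lim[OF M sp(1) A(1) False A(2)] .
    moreover have "(\<lambda>n. \<integral>x. max 0 (1 - real n * infdist x A) \<partial>N) \<longlonglongrightarrow> measure N A"
      using lim[OF N sp(2) A(1) False] A(2) M(2) N(2) by simp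
    moreover have "(\<integral>x. max 0 (1 - real n * infdist x A) \<partial>M) = (\<integral>x. max 0 (1 - real n * infdist x A) \<partial>N)"
        for n
      by (intro eq continuous_intros)
    ultimately show ?thesis using LIMSEQ_unique by simp
  qed simp
  interpret M: prob_space M by (rule M)
  interpret N: prob_space N by (rule N)
  show ?thesis
  proof (rule measure_eqI_generator_eq[where \<Omega> = X and E = "{C \<inter> X |C. closed C}" and A = "\<lambda>_. X"])
    show "Int_stable {C \<inter> X |C. closed C}"
    proof (rule Int_stableI)
      fix a b assume "a \<in> {C \<inter> X |C. closed C}" "b \<in> {C \<inter> X |C. closed C}"
      then obtain C D where "a = C \<inter> X" "b = D \<inter> X" "closed C" "closed D" by blast
      then have "a \<inter> b = (C \<inter> D) \<inter> X" "closed (C \<inter> D)" by (auto intro: closed_Int)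
      then show "a \<inter> b \<in> {C \<inter> X |C. closed C}" by blast
    qed
    show "sets M = sigma_sets X {C \<inter> X |C. closed C}" "sets N = sigma_sets X {C \<inter> X |C. closed C}"
      using M(2) N(2) sets_restrict_borel_closed[OF compact_imp_closed[OF X]] by simp_all
    fix A assume A: "A \<in> {C \<inter> X |C. closed C}"
    then have "closed A" using X by (auto intro: closed_Int compact_imp_closed)
    moreover have "A \<in> sets M" unfolding M(2) sets_restrict_borel_closed[OF compact_imp_closed[OF X]]
        using A by (rule sigma_sets.Basic)
    ultimately show "emeasure M A = emeasure N A"
      using closed_eq by (simp add: M.emeasure_eq_measure N.emeasure_eq_measure)
  next
    show "range (\<lambda>_. X) \<subseteq> {C \<inter> X |C. closed C}" by (auto intro!: exI[of _ UNIV])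
  qed auto
qed

text \<open>Coding the points of \<open>X\<close> by real numbers makes Helly's selection theorem applicable.\<close>

lemma weak_limit_of_empirical_measures:
  fixes X :: "'a::metric_space set" and p :: "nat \<Rightarrow> nat \<Rightarrow> 'a" and H :: "nat \<Rightarrow> nat"
  assumes X: "compact X" and p: "\<And>n i. p n i \<in> X" and H: "\<And>n. H n > 0"
  shows "\<exists>r \<nu>. strict_mono (r :: nat \<Rightarrow> nat) \<and> prob_space \<nu> \<and> sets \<nu> = sets (restrict_space borel X) \<and>
    (\<forall>f :: 'a \<Rightarrow> complex. continuous_on X f \<longrightarrow>
      (\<lambda>n. 1 / of_nat (H (r n)) * (\<Sum>i<H (r n). f (p (r n) i))) \<longlonglongrightarrow> (\<integral>x. f x \<partial>\<nu>))"
proof -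
  have Xne: "X \<noteq> {}" using p by blast
  from compact_image_of_real_compact[OF X Xne]
  obtain K :: "real set" and \<pi> \<kappa> where K: "closed K" "K \<subseteq> {0..1}" "continuous_on K \<pi>" "\<pi> ` K \<subseteq> X"
    and \<kappa>': "\<forall>x\<in>X. \<kappa> x \<in> K \<and> \<pi> (\<kappa> x) = x"
    by (elim exE conjE)
  have \<kappa>: "\<kappa> x \<in> K \<and> \<pi> (\<kappa> x) = x" if "x \<in> X" for x using \<kappa>' that by (rule bspec)
  have Kne: "K \<noteq> {}" using \<kappa> Xne by blast
  define Q where "Q n = measure_pmf (pmf_of_set {..<H n})" for n
  define m where "m n = distr (Q n) borel (\<lambda>i. \<kappa> (p n i))" for n
  have Qne: "{..<H n} \<noteq> {}" "finite {..<H n}" for n using H[of n] by auto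
  have meas: "g \<in> measurable (Q n) N" if "\<And>x. g x \<in> space N" for g :: "nat \<Rightarrow> 'b" and n N
    using that unfolding Q_def by simp
  have pQ: "prob_space (Q n)" for n unfolding Q_def by (rule measure_pmf.prob_space_axioms)
  have mK: "\<kappa> (p n i) \<in> K" for n i using \<kappa> p by blast
  have rd: "real_distribution (m n)" for n
    unfolding m_def by (intro prob_space.real_distribution_distr[OF pQ] meas) simp
  have int_m: "(\<integral>t. h t \<partial>m n) = 1 / of_nat (H n) * (\<Sum>i<H n. h (\<kappa> (p n i)))"
    if h: "h \<in> borel_measurable borel" for h :: "real \<Rightarrow> complex" and n
  proof -
    have "(\<integral>t. h t \<partial>m n) = (\<integral>i. h (\<kappa> (p n i)) \<partial>Q n)"
      unfolding m_def by (rule integral_distr[OF meas h]) simp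
    also have "\<dots> = (\<Sum>i<H n. pmf (pmf_of_set {..<H n}) i *\<^sub>R h (\<kappa> (p n i)))"
      unfolding Q_def by (rule integral_measure_pmf) (use Qne in \<open>auto simp: set_pmf_of_set\<close>)
    also have "\<dots> = (\<Sum>i<H n. 1 / of_nat (H n) * h (\<kappa> (p n i)))"
      using Qne by (intro sum.cong refl) (simp add: scaleR_conv_of_real)
    finally show ?thesis by (simp add: sum_distrib_left)
  qed
  have "tight m"
    unfolding tight_def
  proof (intro conjI allI impI rd)
    fix \<epsilon> :: real assume "\<epsilon> > 0"
    have "measure (m n) {-1<..1} = 1" for n
    proof -
      have "measure (m n) {-1<..1} = measure (Q n) ((\<lambda>i. \<kappa> (p n i)) -` {-1<..1} \<inter> space (Q n))"
        unfolding m_def by (rule measure_distr[OF meas]) auto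
      also have "(\<lambda>i. \<kappa> (p n i)) -` {-1<..1} \<inter> space (Q n) = space (Q n)"
      proof -
        have "\<kappa> (p n i) \<in> {-1<..1}" for i using subsetD[OF K(2) mK[of n i]] by auto
        then show ?thesis by auto
      qed
      also have "measure (Q n) (space (Q n)) = 1" by (rule prob_space.prob_space[OF pQ])
      finally show ?thesis .
    qed
    then show "\<exists>a b. a < b \<and> (\<forall>n. 1 - \<epsilon> < measure (m n) {a<..b})"
      using \<open>\<epsilon> > 0\<close> by (intro exI[of _ "-1"] exI[of _ 1]) auto
  qed
  then obtain r M where r: "strict_mono (r :: nat \<Rightarrow> nat)" and M: "real_distribution M"
      and wc: "weak_conv_m (m \<circ> r) M"
    using tight_imp_convergent_subsubsequence[of m id] by (auto simp: strict_mono_id)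
  interpret M: real_distribution M by (rule M)
  have conv: "(\<lambda>n. 1 / of_nat (H (r n)) * (\<Sum>i<H (r n). h (\<kappa> (p (r n) i)))) \<longlonglongrightarrow> (\<integral>t. h t \<partial>M)"
    if h: "continuous_on UNIV h" "\<And>t. norm (h t) \<le> B" for h :: "real \<Rightarrow> complex" and B
  proof -
    have "(\<lambda>n. \<integral>t. h t \<partial>(m \<circ> r) n) \<longlonglongrightarrow> (\<integral>t. h t \<partial>M)"
    proof (rule weak_conv_imp_integral_bdd_continuous_conv[OF _ M wc])
      show "isCont h x" for x using h(1) by (simp add: continuous_on_eq_continuous_at)
    qed (use rd h in auto)
    moreover have "h \<in> borel_measurable borel" using h(1) by (rule borel_measurable_continuous_onI)
    ultimately show ?thesis by (simp add: int_m)
  qed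
  \<comment> \<open>The truncated distance to \<open>K\<close> vanishes at all coded points, hence
    has integral 0 in the limit, and it is positive off the closed set \<open>K\<close>.\<close>
  have AEK: "AE t in M. t \<in> K"
  proof -
    define \<phi> where "\<phi> t = min 1 (infdist t K)" for t :: real
    have \<phi>c: "continuous_on UNIV \<phi>" unfolding \<phi>_def by (intro continuous_intros)
    have \<phi>01: "0 \<le> \<phi> t" "\<phi> t \<le> 1" for t using infdist_nonneg[of t K] by (auto simp: \<phi>_def)
    have \<phi>K: "\<phi> t = 0 \<longleftrightarrow> t \<in> K" for t
      using in_closed_iff_infdist_zero[OF K(1) Kne, of t] infdist_nonneg[of t K] by (auto simp: \<phi>_def min_def)
    have "(\<lambda>n. 1 / of_nat (H (r n))
        * (\<Sum>i<H (r n). complex_of_real (\<phi> (\<kappa> (p (r n) i))))) \<longlonglongrightarrow> (\<integral>t. complex_of_real (\<phi> t) \<partial>M)"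
    proof (rule conv)
      show "continuous_on UNIV (\<lambda>t. complex_of_real (\<phi> t))" by (intro continuous_intros \<phi>c)
      show "norm (complex_of_real (\<phi> t)) \<le> 1" for t using \<phi>01[of t] by simp
    qed
    moreover have "\<phi> (\<kappa> (p n i)) = 0" for n i using \<phi>K mK by blast
    ultimately have "(\<lambda>n. 0) \<longlonglongrightarrow> (\<integral>t. complex_of_real (\<phi> t) \<partial>M)" by simp
    then have "(\<integral>t. complex_of_real (\<phi> t) \<partial>M) = 0" using LIMSEQ_unique tendsto_const by blast
    then have i0: "(\<integral>t. \<phi> t \<partial>M) = 0" by simp
    have \<phi>m: "\<phi> \<in> borel_measurable M" using borel_measurable_continuous_onI[OF \<phi>c] by simp
    have "integrable M \<phi>" using \<phi>01 by (intro M.integrable_const_bound[where B = 1] \<phi>m) auto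
    then have "AE t in M. \<phi> t = 0" using i0 \<phi>01 by (subst (asm) integral_nonneg_eq_0_iff_AE) auto
    then show ?thesis using \<phi>K by simp
  qed
  obtain x0 where x0: "x0 \<in> X" using Xne by blast
  \<comment> \<open>A total map into \<open>X\<close> is needed to push the limit measure forward;
    its value off \<open>K\<close> is immaterial because of \<open>AEK\<close>.\<close>
  define \<rho> where "\<rho> t = (if t \<in> K then \<pi> t else x0)" for t
  have \<rho>X: "\<rho> t \<in> X" for t using K(4) x0 by (auto simp: \<rho>_def)
  have "\<rho> \<in> borel_measurable borel"
    unfolding \<rho>_def using K(1,3) by (intro borel_measurable_continuous_on_if continuous_on_const) auto
  then have \<rho>m: "\<rho> \<in> measurable M (restrict_space borel X)"
    using \<rho>X by (intro measurable_restrict_space2) auto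
  define \<nu> where "\<nu> = distr M (restrict_space borel X) \<rho>"
  have "(\<lambda>n. 1 / of_nat (H (r n)) * (\<Sum>i<H (r n). f (p (r n) i))) \<longlonglongrightarrow> (\<integral>x. f x \<partial>\<nu>)"
    if f: "continuous_on X f" for f :: "'a \<Rightarrow> complex"
  proof -
    have "bounded (f ` X)" using compact_continuous_image[OF f X] by (rule compact_imp_bounded)
    then obtain B where B: "\<And>x. x \<in> X \<Longrightarrow> norm (f x) \<le> B" by (auto simp: bounded_iff)
    have B0: "0 \<le> B" using B[OF x0] norm_ge_zero order_trans by blast
    have fc: "continuous_on K (\<lambda>t. f (\<pi> t))" using continuous_on_compose2[OF f K(3,4)] .
    \<comment> \<open>Weak convergence tests bounded continuous functions on the whole line, so
      \<open>f\<close> composed with \<open>\<pi>\<close> is extended from \<open>K\<close> with the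
      same bound.\<close>
    obtain h where h: "continuous_on UNIV h" "\<And>t. t \<in> K \<Longrightarrow> h t = f (\<pi> t)" "\<And>t. t \<in> UNIV \<Longrightarrow> norm (h t) \<le> B"
    proof (rule Tietze[OF fc _ B0])
      show "closedin (top_of_set UNIV) K" using K(1) by simp
      show "norm (f (\<pi> t)) \<le> B" if "t \<in> K" for t using that K(4) by (intro B) auto
    qed blast
    have hm: "h \<in> borel_measurable M" using borel_measurable_continuous_onI[OF h(1)] by simp
    have "(\<integral>x. f x \<partial>\<nu>) = (\<integral>t. f (\<rho> t) \<partial>M)"
      unfolding \<nu>_def by (rule integral_distr[OF \<rho>m measurable_restrict_borel_continuous[OF f]])
    also have "\<dots> = (\<integral>t. h t \<partial>M)"
    proof (rule integral_cong_AE[OF _ hm])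
      show "(\<lambda>t. f (\<rho> t)) \<in> borel_measurable M"
        using measurable_compose[OF \<rho>m measurable_restrict_borel_continuous[OF f]] .
      show "AE t in M. f (\<rho> t) = h t"
        using AEK by eventually_elim (simp add: \<rho>_def h(2))
    qed
    finally have "(\<integral>x. f x \<partial>\<nu>) = (\<integral>t. h t \<partial>M)" .
    moreover have "h (\<kappa> (p n i)) = f (p n i)" for n i using h(2)[OF mK] \<kappa> p by simp
    ultimately show ?thesis using conv[OF h(1), of B] h(3) by simp
  qed
  moreover have "prob_space \<nu>" unfolding \<nu>_def by (rule M.prob_space_distr[OF \<rho>m])
  moreover have "sets \<nu> = sets (restrict_space borel X)" by (simp add: \<nu>_def)
  ultimately show ?thesis using r by blast
qed

text \<open>The Krylov-Bogolyubov argument: if arbitrarily long orbit averages stayed away from the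
  integral, a weak limit of the corresponding empirical measures would be invariant, hence equal to
  \<open>\<mu>\<close>, and would give the wrong integral of \<open>f\<close>.\<close>

lemma uniquely_ergodic_uniform_averages:
  fixes X :: "'a::metric_space set" and f :: "'a \<Rightarrow> complex"
  assumes X: "compact X" and T: "continuous_on X T" "T ` X \<subseteq> X"
    and ue: "uniquely_ergodic X T" and \<mu>: "invariant_prob_measure X T \<mu>"
    and f: "continuous_on X f" and \<epsilon>: "\<epsilon> > 0"
  shows "\<exists>H>0. \<forall>y\<in>X. norm (1 / of_nat H * (\<Sum>h<H. f ((T ^^ h) y)) - (\<integral>x. f x \<partial>\<mu>)) \<le> \<epsilon>"
proof (rule ccontr)
  assume neg: "\<not> ?thesis"
  define I where "I = (\<integral>x. f x \<partial>\<mu>)"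
  have "\<forall>n. \<exists>y. y \<in> X \<and> norm (1 / of_nat (Suc n) * (\<Sum>h<Suc n. f ((T ^^ h) y)) - I) > \<epsilon>"
    using neg unfolding I_def[symmetric] by (metis linorder_not_le zero_less_Suc)
  then obtain y where y: "\<And>n. y n \<in> X" "\<And>n. norm (1 / of_nat (Suc n) * (\<Sum>h<Suc n. f ((T ^^ h) (y n))) - I)
      > \<epsilon>"
    by metis
  have orbit: "(T ^^ i) x \<in> X" if "x \<in> X" for i x
    using that T(2) by (induction i) auto
  obtain r \<nu> where r: "strict_mono (r :: nat \<Rightarrow> nat)"
      and \<nu>: "prob_space \<nu>" "sets \<nu> = sets (restrict_space borel X)"
    and lim: "\<And>g :: 'a \<Rightarrow> complex. continuous_on X g \<Longrightarrow>
      (\<lambda>n. 1 / of_nat (Suc (r n)) * (\<Sum>i<Suc (r n). g ((T ^^ i) (y (r n))))) \<longlonglongrightarrow> (\<integral>x. g x \<partial>\<nu>)"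
    using weak_limit_of_empirical_measures[OF X, of "\<lambda>n i. (T ^^ i) (y n)" Suc] orbit y(1) by blast
  have Tm: "T \<in> measurable (restrict_space borel X) (restrict_space borel X)"
    using T by (intro measurable_restrict_space2 measurable_restrict_borel_continuous)
      (auto simp: space_restrict_space)
  then have Tm': "T \<in> measurable \<nu> (restrict_space borel X)"
    unfolding measurable_cong_sets[OF \<nu>(2) refl] .
  have sp: "space \<nu> = X" using sets_eq_imp_space_eq[OF \<nu>(2)] by (simp add: space_restrict_space)
  have inv: "(\<integral>x. g (T x) \<partial>\<nu>) = (\<integral>x. g x \<partial>\<nu>)" if g: "continuous_on X g" for g :: "'a \<Rightarrow> complex"
  proof -
    have "bounded (g ` X)" using compact_continuous_image[OF g X] by (rule compact_imp_bounded)
    then obtain B where B: "\<And>x. x \<in> X \<Longrightarrow> norm (g x) \<le> B" by (auto simp: bounded_iff)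
    have gT: "continuous_on X (\<lambda>x. g (T x))" using continuous_on_compose2[OF g T] .
    \<comment> \<open>Applying \<open>T\<close> to an orbit segment changes only its two ends, so
      the averages differ by a term of order \<open>1 / r n\<close>; this is the invariance of the
      limit.\<close>
    define e where "e n = 1 / of_nat (Suc (r n)) * (g ((T ^^ Suc (r n)) (y (r n))) - g (y (r n)))" for n
    have "1 / of_nat (Suc (r n)) * (\<Sum>i<Suc (r n). g (T ((T ^^ i) (y (r n))))) -
        1 / of_nat (Suc (r n)) * (\<Sum>i<Suc (r n). g ((T ^^ i) (y (r n)))) = e n" for n
    proof -
      have "(\<Sum>i<m. g (T ((T ^^ i) z))) - (\<Sum>i<m. g ((T ^^ i) z)) = g ((T ^^ m) z) - g z" for m z
        by (induction m) (auto simp: algebra_simps)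
      note telescope = this
      show ?thesis unfolding e_def right_diff_distrib[symmetric] telescope ..
    qed
    then have "e \<longlonglongrightarrow> (\<integral>x. g (T x) \<partial>\<nu>) - (\<integral>x. g x \<partial>\<nu>)"
      using tendsto_diff[OF lim[OF gT] lim[OF g]] by simp
    moreover have "e \<longlonglongrightarrow> 0"
    proof (rule Lim_null_comparison)
      have "norm (e n) \<le> 2 * B / real (Suc n)" for n
      proof -
        have "norm (g ((T ^^ Suc (r n)) (y (r n))) - g (y (r n))) \<le> 2 * B"
          using B[OF orbit[OF y(1)], of "Suc (r n)" "r n"] B[OF y(1), of "r n"]
            norm_triangle_ineq4[of "g ((T ^^ Suc (r n)) (y (r n)))" "g (y (r n))"] by linarith
        then have "norm (e n) \<le> 1 / real (Suc (r n)) * (2 * B)"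
          unfolding e_def norm_mult by (intro mult_mono) (auto simp: norm_divide simp del: of_nat_Suc)
        also have "\<dots> \<le> 1 / real (Suc n) * (2 * B)"
        proof (intro mult_right_mono divide_left_mono)
          show "real (Suc n) \<le> real (Suc (r n))" using seq_suble[OF r, of n] by simp
          show "0 \<le> 2 * B" using order_trans[OF norm_ge_zero B[OF y(1)[of 0]]] by simp
        qed auto
        finally show ?thesis by simp
      qed
      then show "eventually (\<lambda>n. norm (e n) \<le> 2 * B / real (Suc n)) sequentially" by simp
      show "(\<lambda>n. 2 * B / real (Suc n)) \<longlonglongrightarrow> 0"
        using tendsto_mult[OF tendsto_const[of "2 * B"] LIMSEQ_inverse_real_of_nat]
            by (simp add: divide_inverse)
    qed
    ultimately have "(\<integral>x. g (T x) \<partial>\<nu>) - (\<integral>x. g x \<partial>\<nu>) = 0" by (rule LIMSEQ_unique)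
    then show ?thesis by simp
  qed
  define \<nu>' where "\<nu>' = distr \<nu> (restrict_space borel X) T"
  have "\<nu>' = \<nu>"
  proof (rule prob_measure_eqI_continuous[OF X _ _ \<nu>])
    show "prob_space \<nu>'" unfolding \<nu>'_def by (rule prob_space.prob_space_distr[OF \<nu>(1) Tm'])
    show "sets \<nu>' = sets (restrict_space borel X)" by (simp add: \<nu>'_def)
    fix g :: "'a \<Rightarrow> real" assume g: "continuous_on X g"
    have "(\<integral>x. g x \<partial>\<nu>') = (\<integral>x. g (T x) \<partial>\<nu>)"
      unfolding \<nu>'_def by (rule integral_distr[OF Tm' measurable_restrict_borel_continuous[OF g]])
    also have "complex_of_real \<dots> = complex_of_real (\<integral>x. g x \<partial>\<nu>)"
      using inv[of "\<lambda>x. complex_of_real (g x)"] g by (simp add: continuous_on_of_real)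
    finally show "(\<integral>x. g x \<partial>\<nu>') = (\<integral>x. g x \<partial>\<nu>)" by simp
  qed
  have "invariant_prob_measure X T \<nu>"
    unfolding invariant_prob_measure_def
  proof (intro conjI ballI \<nu>)
    fix A assume A: "A \<in> sets \<nu>"
    have "emeasure \<nu>' A = emeasure \<nu> (T -` A \<inter> space \<nu>)"
      unfolding \<nu>'_def using A \<nu>(2) by (intro emeasure_distr[OF Tm']) simp
    then show "emeasure \<nu> (T -` A \<inter> X) = emeasure \<nu> A" using \<open>\<nu>' = \<nu>\<close> sp by simp
  qed
  then have "\<nu> = \<mu>" using ue \<mu> unfolding uniquely_ergodic_def by blast
  then have "(\<lambda>n. norm (1 / of_nat (Suc (r n)) * (\<Sum>i<Suc (r n). f ((T ^^ i) (y (r n)))) - I)) \<longlonglongrightarrow> norm (I - I)"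
    using lim[OF f] unfolding I_def by (intro tendsto_intros) simp
  then have "eventually (\<lambda>n. norm (1 / of_nat (Suc (r n)) * (\<Sum>i<Suc (r n). f ((T ^^ i) (y (r n)))) - I)
      < \<epsilon>) sequentially"
    using \<epsilon> by (intro order_tendstoD(2)) auto
  then show False using y(2) by (auto simp: eventually_sequentially) (meson less_asym order_refl)
qed

section \<open>Besicovitch almost periodic functions\<close>

definition cesaro :: "(nat \<Rightarrow> complex) \<Rightarrow> nat \<Rightarrow> complex" where
  "cesaro a N = 1 / of_nat N * (\<Sum>n=1..N. a n)"

lemma cesaro_add: "cesaro (\<lambda>n. a n + b n) N = cesaro a N + cesaro b N"
  by (simp add: cesaro_def sum.distrib distrib_left)

lemma cesaro_diff: "cesaro (\<lambda>n. a n - b n) N = cesaro a N - cesaro b N"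
  by (simp add: cesaro_def sum_subtractf right_diff_distrib)

lemma cesaro_mult_const: "cesaro (\<lambda>n. a n * c) N = cesaro a N * c"
  by (simp add: cesaro_def sum_distrib_right)

lemma cesaro_trig_sum:
  "cesaro (\<lambda>n. (\<Sum>j\<in>J. c j * u j n) * w n) N = (\<Sum>j\<in>J. c j * cesaro (\<lambda>n. u j n * w n) N)"
proof -
  have "(\<Sum>n=1..N. (\<Sum>j\<in>J. c j * u j n) * w n) = (\<Sum>n=1..N. \<Sum>j\<in>J. c j * (u j n * w n))"
    by (simp add: sum_distrib_right mult.assoc)
  also have "\<dots> = (\<Sum>j\<in>J. \<Sum>n=1..N. c j * (u j n * w n))" by (rule sum.swap)
  finally show ?thesis by (simp add: cesaro_def sum_distrib_left mult_ac)
qed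

lemma norm_cesaro_le:
  assumes "\<And>n. n \<ge> 1 \<Longrightarrow> norm (w n) \<le> C"
  shows "norm (cesaro (\<lambda>n. b n * w n) N) \<le> C * (1 / real N * (\<Sum>n=1..N. norm (b n)))"
proof -
  have "norm (\<Sum>n=1..N. b n * w n) \<le> (\<Sum>n=1..N. norm (b n) * C)"
    by (intro sum_norm_le) (auto simp: norm_mult intro!: mult_left_mono assms)
  then have "norm (cesaro (\<lambda>n. b n * w n) N) \<le> 1 / real N * (\<Sum>n=1..N. norm (b n) * C)"
    unfolding cesaro_def norm_mult by (intro mult_mono) (auto simp: norm_divide)
  also have "1 / real N * (\<Sum>n=1..N. norm (b n) * C) = C * (1 / real N * (\<Sum>n=1..N. norm (b n)))"
    unfolding sum_distrib_right[symmetric] by simp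
  finally show ?thesis .
qed

lemma convergent_cesaro_unit_exp: "convergent (cesaro (\<lambda>n. unit_exp (real n * \<alpha>)))"
proof (cases "unit_exp \<alpha> = 1")
  case True
  have "eventually (\<lambda>N. cesaro (\<lambda>n. unit_exp (real n * \<alpha>)) N = 1) sequentially"
    using eventually_gt_at_top[of 0] by eventually_elim (simp add: cesaro_def unit_exp_power True)
  then show ?thesis using tendsto_eventually convergentI by blast
next
  case False
  define B where "B = 2 / norm (1 - unit_exp \<alpha>)"
  have "cesaro (\<lambda>n. unit_exp (real n * \<alpha>)) \<longlonglongrightarrow> 0"
  proof (rule Lim_null_comparison)
    have "norm (cesaro (\<lambda>n. unit_exp (real n * \<alpha>)) N) \<le> 1 / real N * B" for N
      using norm_sum_geometric_le[OF norm_unit_exp False, of N]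
      unfolding cesaro_def norm_mult unit_exp_power B_def by (intro mult_mono) (auto simp: norm_divide)
    then show "eventually (\<lambda>N. norm (cesaro (\<lambda>n. unit_exp (real n * \<alpha>)) N) \<le> 1 / real N * B) sequentially"
        by simp
    show "(\<lambda>N. 1 / real N * B) \<longlonglongrightarrow> 0" by real_asymp
  qed
  then show ?thesis by (rule convergentI)
qed

lemma besicovitch_approx:
  assumes "besicovitch_almost_periodic a" "\<epsilon> > 0"
  obtains P where "trig_polynomial P"
      "eventually (\<lambda>N. 1 / real N * (\<Sum>n=1..N. norm (a n - P n)) < \<epsilon>) sequentially"
proof -
  obtain P where P: "trig_polynomial P"
      "limsup (\<lambda>N. ereal (1 / real N * (\<Sum>n=1..N. cmod (a n - P n)))) \<le> ereal (\<epsilon> / 2)"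
    using assms unfolding besicovitch_almost_periodic_def by (meson half_gt_zero)
  have "ereal (\<epsilon> / 2) < ereal \<epsilon>" using assms(2) by simp
  then have "limsup (\<lambda>N. ereal (1 / real N * (\<Sum>n=1..N. cmod (a n - P n)))) < ereal \<epsilon>"
    using P(2) by (rule le_less_trans[rotated])
  then have "eventually (\<lambda>N. ereal (1 / real N * (\<Sum>n=1..N. cmod (a n - P n))) < ereal \<epsilon>) sequentially"
    by (rule Limsup_lessD)
  then show ?thesis using that[OF P(1)] by simp
qed

text \<open>The means of \<open>a\<close> stay eventually close to those of a trigonometric
  polynomial, which converge by geometric sums, so they form a Cauchy sequence. This gives meaning
  to the \<open>lim\<close> in \<open>mean_value\<close>.\<close>

lemma convergent_cesaro_besicovitch:
  assumes a: "besicovitch_almost_periodic a"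
  shows "convergent (cesaro a)"
proof -
  have "Cauchy (cesaro a)"
  proof (rule metric_CauchyI)
    fix e :: real assume e: "e > 0"
    obtain P where P: "trig_polynomial P"
        "eventually (\<lambda>N. 1 / real N * (\<Sum>n=1..N. norm (a n - P n)) < e / 4) sequentially"
      using besicovitch_approx[OF a, of "e / 4"] e by auto
    from P(1) obtain L :: nat and c \<alpha> where "\<forall>n. P n = (\<Sum>j=1..L. c j * unit_exp (real n * \<alpha> j))"
      unfolding trig_polynomial_def by (elim exE conjE)
    then have Pn: "\<And>n. P n = (\<Sum>j=1..L. c j * unit_exp (real n * \<alpha> j))" by (rule spec)
    have "cesaro P N = (\<Sum>j=1..L. c j * cesaro (\<lambda>n. unit_exp (real n * \<alpha> j)) N)" for N
    proof -
      have "cesaro P N = cesaro (\<lambda>n. (\<Sum>j=1..L. c j * unit_exp (real n * \<alpha> j)) * 1) N"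
        by (simp add: cesaro_def Pn)
      then show ?thesis unfolding cesaro_trig_sum by simp
    qed
    then have "cesaro P = (\<lambda>N. \<Sum>j=1..L. c j * cesaro (\<lambda>n. unit_exp (real n * \<alpha> j)) N)" by (rule ext)
    moreover have "convergent (\<lambda>N. \<Sum>j=1..L. c j * cesaro (\<lambda>n. unit_exp (real n * \<alpha> j)) N)"
      by (intro convergent_sum convergent_mult convergent_const convergent_cesaro_unit_exp)
    ultimately have "Cauchy (cesaro P)" by (simp add: convergent_Cauchy)
    then obtain N1 where N1: "\<And>m n. m \<ge> N1 \<Longrightarrow> n \<ge> N1 \<Longrightarrow> dist (cesaro P m) (cesaro P n) < e / 2"
      using e by (meson half_gt_zero metric_CauchyD)
    obtain N2 where N2: "\<And>N. N \<ge> N2 \<Longrightarrow> 1 / real N * (\<Sum>n=1..N. norm (a n - P n)) < e / 4"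
      using P(2) unfolding eventually_sequentially by blast
    have close: "dist (cesaro a N) (cesaro P N) < e / 4" if "N \<ge> N2" for N
    proof -
      have "dist (cesaro a N) (cesaro P N) = norm (cesaro (\<lambda>n. (a n - P n) * 1) N)"
        by (simp add: dist_norm cesaro_diff)
      also have "\<dots> \<le> 1 * (1 / real N * (\<Sum>n=1..N. norm (a n - P n)))"
        by (rule norm_cesaro_le) simp
      finally show ?thesis using N2[OF that] by linarith
    qed
    have "dist (cesaro a m) (cesaro a n) < e" if "m \<ge> max N1 N2" "n \<ge> max N1 N2" for m n
    proof -
      have "dist (cesaro a m) (cesaro a n)
          \<le> dist (cesaro a m) (cesaro P m) + dist (cesaro P m) (cesaro P n) + dist (cesaro a n) (cesaro P n)"
        using dist_triangle[of "cesaro a m" "cesaro a n" "cesaro P m"] dist_triangle[of "cesaro P m"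
            "cesaro a n" "cesaro P n"]
          dist_commute[of "cesaro P n" "cesaro a n"] by linarith
      then show ?thesis using close[of m] close[of n] N1[of m n] that by simp
    qed
    then show "\<exists>M. \<forall>m\<ge>M. \<forall>n\<ge>M. dist (cesaro a m) (cesaro a n) < e" by blast
  qed
  then show ?thesis by (rule Cauchy_convergent)
qed

text \<open>A bounded factor \<open>w\<close> preserves approximation in mean, so \<open>a\<close>
  may be replaced by a trigonometric polynomial and then, by linearity, by single
  exponentials.\<close>

lemma cesaro_besicovitch_mult_zero:
  assumes a: "besicovitch_almost_periodic a" and w: "\<And>n. n \<ge> 1 \<Longrightarrow> norm (w n) \<le> C" and C: "C > 0"
    and zero: "\<And>\<alpha>. cesaro (\<lambda>n. unit_exp (real n * \<alpha>) * w n) \<longlonglongrightarrow> 0"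
  shows "cesaro (\<lambda>n. a n * w n) \<longlonglongrightarrow> 0"
proof (rule LIMSEQ_I)
  fix r :: real assume r: "r > 0"
  obtain P where P: "trig_polynomial P"
      "eventually (\<lambda>N. 1 / real N * (\<Sum>n=1..N. norm (a n - P n)) < r / (2 * C)) sequentially"
    using besicovitch_approx[OF a, of "r / (2 * C)"] r C by auto
  from P(1) obtain L :: nat and c \<alpha> where "\<forall>n. P n = (\<Sum>j=1..L. c j * unit_exp (real n * \<alpha> j))"
    unfolding trig_polynomial_def by (elim exE conjE)
  then have Pn: "\<And>n. P n = (\<Sum>j=1..L. c j * unit_exp (real n * \<alpha> j))" by (rule spec)
  have "(\<lambda>N. \<Sum>j=1..L. c j * cesaro (\<lambda>n. unit_exp (real n * \<alpha> j) * w n) N) \<longlonglongrightarrow> (\<Sum>j=1..L. c j * 0)"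
    by (intro tendsto_sum tendsto_mult tendsto_const zero)
  then have "cesaro (\<lambda>n. P n * w n) \<longlonglongrightarrow> 0"
    unfolding Pn cesaro_trig_sum by simp
  then have "eventually (\<lambda>N. norm (cesaro (\<lambda>n. P n * w n) N) < r / 2) sequentially"
    using r tendstoD[of "cesaro (\<lambda>n. P n * w n)" 0 sequentially "r / 2"] by simp
  with P(2) have "eventually (\<lambda>N. norm (cesaro (\<lambda>n. a n * w n) N - 0) < r) sequentially"
  proof eventually_elim
    case (elim N)
    have "norm (cesaro (\<lambda>n. (a n - P n) * w n) N) \<le> C * (1 / real N * (\<Sum>n=1..N. norm (a n - P n)))"
      by (rule norm_cesaro_le[OF w])
    also have "\<dots> \<le> C * (r / (2 * C))" using elim(1) C by (intro mult_left_mono) auto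
    also have "\<dots> = r / 2" using C by simp
    finally have 1: "norm (cesaro (\<lambda>n. (a n - P n) * w n) N) \<le> r / 2" .
    have "cesaro (\<lambda>n. a n * w n) N = cesaro (\<lambda>n. (a n - P n) * w n) N + cesaro (\<lambda>n. P n * w n) N"
      unfolding cesaro_add[symmetric] by (simp add: algebra_simps)
    then have "norm (cesaro (\<lambda>n. a n * w n) N)
        \<le> norm (cesaro (\<lambda>n. (a n - P n) * w n) N) + norm (cesaro (\<lambda>n. P n * w n) N)"
      by (metis norm_triangle_ineq)
    then show ?case using 1 elim(2) by simp
  qed
  then show "\<exists>no. \<forall>N\<ge>no. norm (cesaro (\<lambda>n. a n * w n) N - 0) < r" unfolding eventually_sequentially .
qed

theorem corollary1p26:
  fixes X :: "'a::metric_space set" and T :: "'a \<Rightarrow> 'a" and \<mu> :: "'a measure"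
    and a :: "nat \<Rightarrow> complex" and f :: "'a \<Rightarrow> complex" and x :: 'a
  assumes "compact X" and "continuous_on X T" and "T ` X \<subseteq> X"
    and "uniquely_ergodic X T" and "invariant_prob_measure X T \<mu>"
    and "besicovitch_almost_periodic a"
    and "continuous_on X f" and "x \<in> X"
  shows "(\<lambda>N. 1 / of_nat N * (\<Sum>n=1..N. a n * f ((T ^^ num_prime_factors n) x)))
           \<longlonglongrightarrow> mean_value a * (\<integral>y. f y \<partial>\<mu>)"
proof -
  define I where "I = (\<integral>y. f y \<partial>\<mu>)"
  define w where "w k = f ((T ^^ k) x) - I" for k
  have orbit: "(T ^^ k) x \<in> X" for k
    using assms(3,8) by (induction k) auto
  have "bounded (f ` X)"
    using compact_continuous_image[OF assms(7,1)] by (rule compact_imp_bounded)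
  then obtain B where B: "\<And>y. y \<in> X \<Longrightarrow> norm (f y) \<le> B" by (auto simp: bounded_iff)
  \<comment> \<open>The summand 1 keeps \<open>C\<close> positive when \<open>f\<close> vanishes on
    \<open>X\<close>, as \<open>C\<close> is divided by to obtain a sequence bounded by 1.\<close>
  define C where "C = B + norm I + 1"
  have "0 \<le> B" using order_trans[OF norm_ge_zero B[OF orbit[of 0]]] .
  then have C: "C > 0" unfolding C_def using norm_ge_zero[of I] by linarith
  have wC: "norm (w k) \<le> C" for k
    using norm_triangle_ineq4[of "f ((T ^^ k) x)" I] B[OF orbit[of k]] unfolding w_def C_def by linarith
  define F where "F k = w k / of_real C" for k
  have F: "unit_bounded F"
    unfolding unit_bounded_def F_def using wC C by (simp add: norm_divide)
  have mean: "\<exists>H>0. \<forall>k. norm (\<Sum>h<H. F (k + h)) \<le> \<epsilon> * real H" if \<epsilon>: "\<epsilon> > 0" for \<epsilon>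
  proof -
    obtain H where H: "H > 0" "\<And>y. y \<in> X \<Longrightarrow> norm (1 / of_nat H * (\<Sum>h<H. f ((T ^^ h) y)) - I) \<le> \<epsilon> * C"
      using uniquely_ergodic_uniform_averages[OF assms(1-5,7), of "\<epsilon> * C"] \<epsilon> C unfolding I_def by auto
    have "norm (\<Sum>h<H. F (k + h)) \<le> \<epsilon> * real H" for k
    proof -
      define A where "A = 1 / of_nat H * (\<Sum>h<H. f ((T ^^ h) ((T ^^ k) x))) - I"
      have "(\<Sum>h<H. F (k + h)) = (\<Sum>h<H. f ((T ^^ h) ((T ^^ k) x)) - I) / of_real C"
        unfolding F_def w_def sum_divide_distrib by (simp add: add.commute[of k] funpow_add)
      also have "(\<Sum>h<H. f ((T ^^ h) ((T ^^ k) x)) - I) = of_nat H * A"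
        using H(1) by (simp add: A_def sum_subtractf right_diff_distrib)
      finally have "norm (\<Sum>h<H. F (k + h)) = real H * norm A / C" using C by (simp add: norm_mult norm_divide)
      also have "\<dots> \<le> real H * (\<epsilon> * C) / C"
        using H(2)[OF orbit[of k]] C unfolding A_def by (intro divide_right_mono mult_left_mono) auto
      finally show ?thesis using C by (simp add: mult.commute)
    qed
    then show ?thesis using H(1) by blast
  qed
  have zero: "cesaro (\<lambda>n. unit_exp (real n * \<alpha>) * w (num_prime_factors n)) \<longlonglongrightarrow> 0" for \<alpha>
  proof -
    have "cesaro (\<lambda>n. unit_exp (real n * \<alpha>) * F (num_prime_factors n)) \<longlonglongrightarrow> 0"
      using exponential_average_zero[OF F mean] unfolding cesaro_def .
    then have "(\<lambda>N. cesaro (\<lambda>n. unit_exp (real n * \<alpha>) * F (num_prime_factors n)) N * of_real C) \<longlonglongrightarrow> 0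
        * of_real C"
      by (intro tendsto_mult tendsto_const)
    moreover have "F k * of_real C = w k" for k using C by (simp add: F_def)
    ultimately show ?thesis unfolding cesaro_mult_const[symmetric] mult.assoc by simp
  qed
  have "cesaro (\<lambda>n. a n * w (num_prime_factors n)) \<longlonglongrightarrow> 0"
    using cesaro_besicovitch_mult_zero[OF assms(6) wC C zero] .
  moreover have "cesaro a \<longlonglongrightarrow> mean_value a"
    using convergent_cesaro_besicovitch[OF assms(6)]
    unfolding mean_value_def cesaro_def[abs_def] by (simp add: convergent_LIMSEQ_iff)
  \<comment> \<open>The constant part \<open>I\<close> of \<open>f\<close> along the orbit
    contributes the mean of \<open>a\<close>, and the part \<open>w\<close> of integral zero
    contributes nothing.\<close>
  ultimately have "(\<lambda>N. cesaro (\<lambda>n. a n * w (num_prime_factors n)) N + cesaro a N * I) \<longlonglongrightarrow> 0 + mean_value a * I"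
    by (intro tendsto_add tendsto_mult tendsto_const)
  moreover have "cesaro (\<lambda>n. a n * w (num_prime_factors n)) N + cesaro a N * I
      = 1 / of_nat N * (\<Sum>n=1..N. a n * f ((T ^^ num_prime_factors n) x))" for N
    unfolding cesaro_mult_const[symmetric] cesaro_add[symmetric] by (simp add: cesaro_def w_def algebra_simps)
  ultimately show ?thesis by (simp add: I_def)
qed

end
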